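(* Let $1\le p,q,r<\infty$ with $q<r\le p^*$. Then $W^{1,(q,p)}_{\{-N,p-N\}}(\mathbb{R}^N_* )$ is continuously embedded into $L^r(\mathbb{R}^N;|x|^{-N}dx)$, but when $N\ge2$, for every $C>0$ and every $\theta\in[0,1]$ the inequality $\|u\|_{-N,r}\le C\|\nabla u\|_{p-N,p}^\theta\|u\|_{-N,q}^{1-\theta}$ fails for some $u\in W^{1,(q,p)}_{\{-N,p-N\}}(\mathbb{R}^N_* )$.
   Context: $N\ge1$, $\mathbb{R}^N_*:=\mathbb{R}^N\setminus\{0\}$. For $d\in\mathbb{R}$, $0<s<\infty$, $\|u\|_{d,s}:=(\int_{\mathbb{R}^N}|x|^d|u|^s dx)^{1/s}$ ($\{0\}$ of measure $0$; Euclidean norm for vector-valued $u$), $L^s(\mathbb{R}^N;|x|^ddx)$ the measurable $u$ with $\|u\|_{d,s}<\infty$. $W^{1,(q,p)}_{\{a,b\}}(\mathbb{R}^N_* )$ is the set of $u\in L^1_{loc}(\mathbb{R}^N_* )$ with $\|u\|_{a,q},\|\nabla u\|_{b,p}<\infty$ (distributional gradient on $\mathbb{R}^N_*$), normed by $\|u\|_{a,q}+\|\nabla u\|_{b,p}$. $p^*:=\infty$ if $p\ge N$, $Np/(N-p)$ if $p<N$. *)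

theory Defs
  imports "HOL-Analysis.Analysis"
begin

fun Ck_on :: "nat \<Rightarrow> 'a::euclidean_space set \<Rightarrow> ('a \<Rightarrow> real) \<Rightarrow> bool" where
  "Ck_on 0 S f = continuous_on S f"
| "Ck_on (Suc k) S f =
     (\<exists>f'. (\<forall>x\<in>S. (f has_derivative f' x) (at x)) \<and> (\<forall>v. Ck_on k S (\<lambda>x. f' x v)))"

definition Cinf_on :: "'a::euclidean_space set \<Rightarrow> ('a \<Rightarrow> real) \<Rightarrow> bool" where
  "Cinf_on S f \<longleftrightarrow> (\<forall>k. Ck_on k S f)"

definition test_fun_punct :: "('a::euclidean_space \<Rightarrow> real) \<Rightarrow> bool" where
  "test_fun_punct \<phi> \<longleftrightarrow> Cinf_on UNIV \<phi> \<and> compact (closure {x. \<phi> x \<noteq> 0})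
      \<and> 0 \<notin> closure {x. \<phi> x \<noteq> 0}"

definition loc_int_punct :: "('a::euclidean_space \<Rightarrow> real) \<Rightarrow> bool" where
  "loc_int_punct u \<longleftrightarrow> (\<forall>K. compact K \<and> K \<subseteq> - {0} \<longrightarrow> set_integrable lebesgue K u)"

definition weak_grad_punct :: "('a::euclidean_space \<Rightarrow> real) \<Rightarrow> ('a \<Rightarrow> 'a) \<Rightarrow> bool" where
  "weak_grad_punct u g \<longleftrightarrow> loc_int_punct u \<and> (\<forall>i\<in>Basis. loc_int_punct (\<lambda>x. g x \<bullet> i)) \<and>
     (\<forall>\<phi>. test_fun_punct \<phi> \<longrightarrow> (\<forall>i\<in>Basis.
        (\<integral>x. u x * frechet_derivative \<phi> (at x) i \<partial>lebesgue)
          = - (\<integral>x. (g x \<bullet> i) * \<phi> x \<partial>lebesgue)))"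

text \<open>\<integral> |x|^d |u|^s dx (possibly infinite), and \<parallel>u\<parallel>_{d,s} (meaningful when finite).\<close>
definition wint :: "real \<Rightarrow> real \<Rightarrow> ('a::euclidean_space \<Rightarrow> 'b::real_normed_vector) \<Rightarrow> ennreal" where
  "wint d s u = (\<integral>\<^sup>+ x. ennreal (norm x powr d * norm (u x) powr s) \<partial>lebesgue)"

definition wnorm :: "real \<Rightarrow> real \<Rightarrow> ('a::euclidean_space \<Rightarrow> 'b::real_normed_vector) \<Rightarrow> real" where
  "wnorm d s u = enn2real (wint d s u) powr (1 / s)"

definition in_wL :: "real \<Rightarrow> real \<Rightarrow> ('a::euclidean_space \<Rightarrow> 'b::real_normed_vector) \<Rightarrow> bool" where
  "in_wL d s u \<longleftrightarrow> u \<in> borel_measurable lebesgue \<and> wint d s u < \<infinity>"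

definition in_W :: "real \<Rightarrow> real \<Rightarrow> real \<Rightarrow> real \<Rightarrow> ('a::euclidean_space \<Rightarrow> real) \<Rightarrow> ('a \<Rightarrow> 'a) \<Rightarrow> bool" where
  "in_W q p a b u g \<longleftrightarrow> weak_grad_punct u g \<and> in_wL a q u \<and> in_wL b p g"

definition pw :: "real \<Rightarrow> real \<Rightarrow> real" where
  "pw t e = (if e = 0 then 1 else t powr e)"

end

theory Submission
  imports Defs
begin

text \<open>
  With \<open>\<mu> = |x|\<^sup>-\<^sup>N dx\<close>, the space is the unweighted \<open>W\<^sup>1\<close> space of the cylinder
  \<open>\<real> \<times> S\<^sup>N\<^sup>-\<^sup>1\<close>, with \<open>|x||\<nabla>u|\<close> as length of the gradient.

  Embedding. After mollifying \<open>u\<close>, the Gagliardo-Nirenberg inequality for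
  \<open>|x|\<^sup>1\<^sup>-\<^sup>N \<Phi>(u)\<close> gives
  \<open>(\<integral>\<Phi>(u)\<^sup>\<kappa> d\<mu>)\<^sup>1\<^sup>/\<^sup>\<kappa> \<le> K \<integral>(|\<Phi>'(u)||x||\<nabla>u| + \<Phi>(u)) d\<mu>\<close> with \<open>\<kappa> = N/(N-1)\<close>,
  and for every \<open>\<kappa> > 1\<close> when \<open>N = 1\<close>. Take for \<open>\<Phi>(u)\<close> a bounded truncation of
  \<open>(1 + (|u| - 1)\<^sub>+)\<^sup>\<gamma> - 1\<close>, which lives on \<open>{|u| > 1}\<close>. If the \<open>L\<^sup>q\<close> norm is small then
  \<open>\<mu>{|u| > 1}\<close> is small, the zero order term is absorbed, and a bound independent of the
  truncation remains. On the set \<open>{|u| > 1}\<close> of finite measure \<open>p\<close> may be lowered below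
  \<open>N\<close>. Scaling \<open>u\<close> removes the smallness assumption.

  Failure. Functions spread over a length \<open>m\<close> of the cylinder force
  \<open>\<theta> \<le> \<theta>/p + (1-\<theta>)/q - 1/r\<close>; bumps of width \<open>1/k\<close> near a unit vector force
  \<open>N(\<theta>/p + (1-\<theta>)/q - 1/r) \<le> \<theta>\<close>. For \<open>N \<ge> 2\<close> this gives \<open>\<theta> = 0\<close>, hence \<open>q \<ge> r\<close>.
\<close>

section \<open>Loomis-Whitney along lines\<close>

text \<open>The exponent of |x|^(1-N) serves both sides: its power \<kappa> = N/(N-1) is |x|^(-N),
  and |x|^(1-N) |\<nabla>u| is |x||\<nabla>u| times |x|^(-N). The zero order term is the cost of
  differentiating this weight. Absorbing that term means moving a multiple of
  (\<integral>\<Phi>(u)^\<kappa> d\<mu>)^(1/\<kappa>) to the left, which is legitimate only if the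
  integral is known to be finite. Hence \<Phi> is bounded, and because \<mu> has infinite mass it
  vanishes for |u| \<le> 1. The power is \<gamma> = p(D-1)/(D-p) with \<kappa> = D/(D-1), where D =
  N unless N = 1, and then any D > 1 is admissible. For it |\<Phi>'| is at most a multiple of (1 +
  \<Phi>)^(\<kappa>(1-1/p)), and \<Phi>^\<kappa> grows like |u|^(Dp/(D-p)), the Sobolev conjugate
  power. The gap 1/\<kappa> - (1-1/p) = 1/p - 1/D is positive exactly when p < D; this closes the
  estimate and is why p \<ge> N has to be lowered. The chain rule is applied only to mollified
  functions.\<close>

definition eroot :: "nat \<Rightarrow> ennreal \<Rightarrow> ennreal" where
  "eroot n x = (if x = \<infinity> then \<infinity> else ennreal (root n (enn2real x)))"

lemma eroot_measurable [measurable]: "eroot n \<in> borel_measurable borel"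
  unfolding eroot_def by measurable

lemma eroot_power: "n > 0 \<Longrightarrow> eroot n x ^ n = x"
  by (cases x) (auto simp: eroot_def ennreal_power)

lemma ennreal_power_eq_iff:
  fixes x y :: ennreal
  assumes "n > 0"
  shows "x ^ n = y ^ n \<longleftrightarrow> x = y"
proof
  assume eq: "x ^ n = y ^ n"
  show "x = y"
  proof (rule ccontr)
    assume "x \<noteq> y"
    then consider "x < y" | "y < x" by fastforce
    then show False
    proof cases
      case 1
      then have "x ^ n < y ^ n" using \<open>n > 0\<close> by (cases x; cases y) (auto simp: ennreal_power ennreal_less_iff power_strict_mono)
      then show ?thesis using eq by simp
    next
      case 2
      then have "y ^ n < x ^ n" using \<open>n > 0\<close> by (cases x; cases y) (auto simp: ennreal_power ennreal_less_iff power_strict_mono)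
      then show ?thesis using eq by simp
    qed
  qed
qed simp

lemma eroot_power': "n > 0 \<Longrightarrow> eroot n (x ^ n) = x"
  using eroot_power ennreal_power_eq_iff by blast

lemma eroot_mult: "n > 0 \<Longrightarrow> eroot n (x * y) = eroot n x * eroot n y"
  by (metis eroot_power eroot_power' power_mult_distrib)

lemma eroot_mono:
  assumes "n > 0" "x \<le> y"
  shows "eroot n x \<le> eroot n y"
  using assms by (cases x; cases y) (auto simp: eroot_def top_unique intro!: ennreal_leI)

lemma eroot_0 [simp]: "eroot n 0 = 0"
  by (simp add: eroot_def)

lemma eroot_top [simp]: "eroot n top = top"
  by (simp add: eroot_def)

lemma eroot_eq_0: "n > 0 \<Longrightarrow> eroot n x = 0 \<longleftrightarrow> x = 0"
  by (metis eroot_0 eroot_power power_0_left less_irrefl)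

text \<open>Each factor is at most the root of the whole sum, and n such roots multiply back to the
  sum.\<close>

lemma prod_eroot_le_sum:
  assumes "finite A" "card A = n" "n > 0"
  shows "(\<Prod>i\<in>A. eroot n (a i)) \<le> (\<Sum>i\<in>A. a i)"
proof -
  have "(\<Prod>i\<in>A. eroot n (a i)) \<le> (\<Prod>i\<in>A. eroot n (\<Sum>i\<in>A. a i))"
    using assms by (intro prod_mono_ennreal eroot_mono member_le_sum) auto
  then show ?thesis using assms by (simp add: eroot_power)
qed

text \<open>The factor \<open>n\<close> is not sharp; accepting it avoids the arithmetic-geometric mean inequality.\<close>
lemma nn_integral_prod_eroot_le:
  assumes A: "finite A" "card A = n" "n > 0"
    and f[measurable]: "\<And>i. i \<in> A \<Longrightarrow> f i \<in> borel_measurable M"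
  shows "(\<integral>\<^sup>+x. (\<Prod>i\<in>A. eroot n (f i x)) \<partial>M) \<le> of_nat n * (\<Prod>i\<in>A. eroot n (\<integral>\<^sup>+x. f i x \<partial>M))"
proof -
  define c where "c i = (\<integral>\<^sup>+x. f i x \<partial>M)" for i
  \<comment> \<open>A vanishing integral kills the product almost everywhere; an infinite one, with
    none vanishing, makes the right side infinite. In the remaining case every function is divided
    by its integral, and the n normalised functions contribute 1 each to the sum.\<close>
  consider (z) "\<exists>i\<in>A. c i = 0" | (t) "\<exists>i\<in>A. c i = top" "\<forall>i\<in>A. c i \<noteq> 0" | (f) "\<forall>i\<in>A. c i \<noteq> 0 \<and> c i \<noteq> top" by blast
  then show ?thesis
  proof cases
    case z
    then obtain i where i: "i \<in> A" "c i = 0" by blast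
    then have "AE x in M. f i x = 0" using nn_integral_0_iff_AE[of "f i" M] f unfolding c_def by simp
    then have "AE x in M. (\<Prod>i\<in>A. eroot n (f i x)) = 0"
      by eventually_elim (use i A in \<open>auto simp: prod_zero_iff intro!: bexI[of _ i]\<close>)
    then have "(\<integral>\<^sup>+x. (\<Prod>i\<in>A. eroot n (f i x)) \<partial>M) = 0"
      by (subst nn_integral_cong_AE[where v="\<lambda>_. 0"]) auto
    then show ?thesis by simp
  next
    case t
    then obtain i where i: "i \<in> A" "c i = top" by blast
    have "(\<Prod>i\<in>A. eroot n (c i)) = eroot n (c i) * (\<Prod>i\<in>A-{i}. eroot n (c i))"
      using A i by (simp add: prod.remove)
    moreover have "(\<Prod>i\<in>A-{i}. eroot n (c i)) \<noteq> 0"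
      using t A by (auto simp: prod_zero_iff eroot_eq_0)
    ultimately have "(\<Prod>i\<in>A. eroot n (c i)) = top" using i by (simp add: ennreal_top_mult)
    then show ?thesis using A unfolding c_def by (simp add: ennreal_mult_top)
  next
    case f
    have eq: "f i x = c i * (f i x / c i)" if "i \<in> A" for i x
      using f that by (simp add: ennreal_times_divide) (metis mult.commute mult_divide_eq_ennreal)
    have "(\<integral>\<^sup>+x. (\<Prod>i\<in>A. eroot n (f i x)) \<partial>M) = (\<integral>\<^sup>+x. (\<Prod>i\<in>A. eroot n (c i)) * (\<Prod>i\<in>A. eroot n (f i x / c i)) \<partial>M)"
      unfolding prod.distrib[symmetric] eroot_mult[OF A(3), symmetric]
      using eq by (intro nn_integral_cong prod.cong refl) (auto cong: prod.cong)
    also have "\<dots> \<le> (\<integral>\<^sup>+x. (\<Prod>i\<in>A. eroot n (c i)) * (\<Sum>i\<in>A. f i x / c i) \<partial>M)"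
      using A by (intro nn_integral_mono mult_left_mono prod_eroot_le_sum) auto
    also have "\<dots> = (\<Prod>i\<in>A. eroot n (c i)) * (\<Sum>i\<in>A. (\<integral>\<^sup>+x. f i x / c i \<partial>M))"
      by (subst nn_integral_cmult) (auto simp: nn_integral_sum)
    also have "(\<Sum>i\<in>A. (\<integral>\<^sup>+x. f i x / c i \<partial>M)) = (\<Sum>i\<in>A. 1)"
      using f by (intro sum.cong refl) (auto simp: nn_integral_divide c_def[symmetric] ennreal_divide_self top.not_eq_extremum)
    finally show ?thesis using A unfolding c_def by (simp add: mult.commute)
  qed
qed

section \<open>Iterated integration along coordinate lines\<close>

definition line_int :: "'a::euclidean_space \<Rightarrow> ('a \<Rightarrow> ennreal) \<Rightarrow> 'a \<Rightarrow> ennreal" where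
  "line_int b F x = (\<integral>\<^sup>+t. F (x + t *\<^sub>R b) \<partial>lborel)"

lemma line_int_measurable [measurable]:
  assumes [measurable]: "F \<in> borel_measurable borel"
  shows "line_int b F \<in> borel_measurable borel"
  unfolding line_int_def by measurable

lemma line_int_commute:
  assumes [measurable]: "F \<in> borel_measurable borel"
  shows "line_int a (line_int b F) = line_int b (line_int a F)"
proof
  fix x
  show "line_int a (line_int b F) x = line_int b (line_int a F) x"
    unfolding line_int_def
    by (subst lborel_pair.Fubini') (auto simp: algebra_simps)
qed

text \<open>A line integral is kept as a function on the whole space. This invariance replaces the
  usual statement that it depends only on the projection along \<open>b\<close>, and it is what lets
  a factor leave the integral in the Loomis-Whitney induction.\<close>

lemma line_int_shift:
  assumes [measurable]: "F \<in> borel_measurable borel"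
  shows "line_int b F (x + s *\<^sub>R b) = line_int b F x"
  unfolding line_int_def
  by (subst (2) nn_integral_real_affine[where c=1 and t=s]) (auto simp: algebra_simps)

lemma line_int_mono: "(\<And>x. F x \<le> G x) \<Longrightarrow> line_int b F x \<le> line_int b G x"
  unfolding line_int_def by (intro nn_integral_mono) auto

lemma foldr_line_int_measurable [measurable]:
  "F \<in> borel_measurable borel \<Longrightarrow> foldr line_int bs F \<in> borel_measurable borel"
  by (induction bs) auto

lemma foldr_line_int_commute:
  "F \<in> borel_measurable borel \<Longrightarrow> line_int b (foldr line_int bs F) = foldr line_int bs (line_int b F)"
  by (induction bs) (auto simp: line_int_commute)

text \<open>Links the iterated integrals to the product measure, of which \<open>lborel\<close> is
  the image under the coordinate map. The base point \<open>x\<close> is generalised, since each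
  integration moves it.\<close>

lemma foldr_line_int_eq_PiM:
  fixes F :: "'a::euclidean_space \<Rightarrow> ennreal"
  assumes [measurable]: "F \<in> borel_measurable borel"
  shows "distinct bs \<Longrightarrow> foldr line_int bs F x = (\<integral>\<^sup>+f. F (x + (\<Sum>b\<in>set bs. f b *\<^sub>R b)) \<partial>PiM (set bs) (\<lambda>_. lborel))"
proof (induction bs arbitrary: x)
  case Nil
  interpret product_sigma_finite "\<lambda>_::'a. lborel :: real measure" by standard
  show ?case by (simp add: PiM_empty nn_integral_count_space_finite)
next
  case (Cons a bs)
  interpret product_sigma_finite "\<lambda>_::'a. lborel :: real measure" by standard
  have "foldr line_int (a # bs) F x = (\<integral>\<^sup>+t. (\<integral>\<^sup>+f. F (x + t *\<^sub>R a + (\<Sum>b\<in>set bs. f b *\<^sub>R b)) \<partial>PiM (set bs) (\<lambda>_. lborel)) \<partial>lborel)"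
    using Cons by (simp add: line_int_def[of a])
  also have "\<dots> = (\<integral>\<^sup>+t. (\<integral>\<^sup>+f. F (x + (\<Sum>b\<in>set (a#bs). (f(a:=t)) b *\<^sub>R b)) \<partial>PiM (set bs) (\<lambda>_. lborel)) \<partial>lborel)"
  proof (intro nn_integral_cong)
    fix t and f :: "'a \<Rightarrow> real"
    have "(\<Sum>b\<in>set bs. (f(a:=t)) b *\<^sub>R b) = (\<Sum>b\<in>set bs. f b *\<^sub>R b)"
      using Cons by (intro sum.cong) auto
    then show "F (x + t *\<^sub>R a + (\<Sum>b\<in>set bs. f b *\<^sub>R b)) = F (x + (\<Sum>b\<in>set (a#bs). (f(a:=t)) b *\<^sub>R b))"
      using Cons by (simp add: add.assoc)
  qed
  also have "\<dots> = (\<integral>\<^sup>+f. F (x + (\<Sum>b\<in>set (a#bs). f b *\<^sub>R b)) \<partial>PiM (insert a (set bs)) (\<lambda>_. lborel))"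
    using Cons by (subst product_nn_integral_insert_rev) (auto simp del: sum.insert)
  finally show ?case by simp
qed

text \<open>The starting point only translates the integrand, which Lebesgue measure does not
  notice.\<close>

lemma foldr_line_int_Basis:
  fixes F :: "'a::euclidean_space \<Rightarrow> ennreal"
  assumes [measurable]: "F \<in> borel_measurable borel"
    and bs: "distinct bs" "set bs = Basis"
  shows "foldr line_int bs F x = (\<integral>\<^sup>+y. F y \<partial>lborel)"
proof -
  have "foldr line_int bs F x = (\<integral>\<^sup>+y. F (x + y) \<partial>lborel)"
    unfolding foldr_line_int_eq_PiM[OF assms(1) bs(1)] bs
    by (subst (2) lborel_eq) (simp add: nn_integral_distr)
  also have "\<dots> = (\<integral>\<^sup>+y. F y \<partial>distr lborel borel ((+) x))"
    by (simp add: nn_integral_distr)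
  finally show ?thesis by (simp add: lborel_distr_plus)
qed

text \<open>Induction on the directions already integrated. At each stage factor \<open>b\<close>
  carries the integral of \<open>D b\<close> along the processed directions, and along
  \<open>b\<close> as well if that one is still to come. Integrating along a new \<open>j\<close>
  leaves factor \<open>j\<close> constant, so only n of the n + 1 factors remain, as many as the
  Hoelder type inequality takes; each step costs a factor n.\<close>

lemma loomis_whitney_aux:
  fixes D :: "'a::euclidean_space \<Rightarrow> 'a \<Rightarrow> ennreal"
  assumes S: "finite S" "card S = Suc n" "n > 0"
    and D[measurable]: "\<And>b. b \<in> S \<Longrightarrow> D b \<in> borel_measurable borel"
  shows "distinct bs \<Longrightarrow> set bs \<subseteq> S \<Longrightarrow>
    foldr line_int bs (\<lambda>x. \<Prod>b\<in>S. eroot n (line_int b (D b) x)) x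
      \<le> of_nat n ^ length bs * (\<Prod>b\<in>S. eroot n (foldr line_int bs (if b \<in> set bs then D b else line_int b (D b)) x))"
proof (induction bs arbitrary: x)
  case Nil
  show ?case by simp
next
  case (Cons j bs)
  define H where "H b = foldr line_int bs (if b \<in> set bs then D b else line_int b (D b))" for b
  have H[measurable]: "H b \<in> borel_measurable borel" if "b \<in> S" for b
    unfolding H_def using D[OF that] by auto
  have j: "j \<in> S" "j \<notin> set bs" using Cons by auto
  \<comment> \<open>By commutation the integral along \<open>j\<close> can be put outermost, where a
    shift along \<open>j\<close> is invisible.\<close>
  have Hj: "H j = line_int j (foldr line_int bs (D j))"
    using j D by (simp add: H_def foldr_line_int_commute)
  have "foldr line_int (j # bs) (\<lambda>x. \<Prod>b\<in>S. eroot n (line_int b (D b) x)) x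
      \<le> line_int j (\<lambda>x. of_nat n ^ length bs * (\<Prod>b\<in>S. eroot n (H b x))) x"
    using Cons by (simp add: H_def line_int_mono)
  also have "\<dots> = (\<integral>\<^sup>+t. of_nat n ^ length bs * eroot n (H j x) * (\<Prod>b\<in>S-{j}. eroot n (H b (x + t *\<^sub>R j))) \<partial>lborel)"
    unfolding line_int_def
  proof (intro nn_integral_cong)
    fix t
    have "H j (x + t *\<^sub>R j) = H j x" unfolding Hj using j by (intro line_int_shift) auto
    then show "of_nat n ^ length bs * (\<Prod>b\<in>S. eroot n (H b (x + t *\<^sub>R j))) =
         of_nat n ^ length bs * eroot n (H j x) * (\<Prod>b\<in>S-{j}. eroot n (H b (x + t *\<^sub>R j)))"
      using S j by (simp add: prod.remove[of S j] mult.assoc)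
  qed
  also have "\<dots> = of_nat n ^ length bs * eroot n (H j x) * (\<integral>\<^sup>+t. (\<Prod>b\<in>S-{j}. eroot n (H b (x + t *\<^sub>R j))) \<partial>lborel)"
    by (rule nn_integral_cmult) measurable
  also have "\<dots> \<le> of_nat n ^ length bs * eroot n (H j x) * (of_nat n * (\<Prod>b\<in>S-{j}. eroot n (\<integral>\<^sup>+t. H b (x + t *\<^sub>R j) \<partial>lborel)))"
    using S j by (intro mult_left_mono nn_integral_prod_eroot_le) auto
  also have "\<dots> = of_nat n ^ length (j#bs) * (eroot n (H j x) * (\<Prod>b\<in>S-{j}. eroot n (line_int j (H b) x)))"
    by (simp add: line_int_def mult_ac)
  also have "(eroot n (H j x) * (\<Prod>b\<in>S-{j}. eroot n (line_int j (H b) x))) =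
     (\<Prod>b\<in>S. eroot n (foldr line_int (j#bs) (if b \<in> set (j#bs) then D b else line_int b (D b)) x))"
    unfolding prod.remove[OF S(1) j(1)]
    by (intro arg_cong2[where f="(*)"] prod.cong) (auto simp: Hj, auto simp: H_def)
  finally show ?case .
qed

text \<open>Once all n + 1 directions have been processed every factor is a full integral, and each
  direction has contributed one factor n.\<close>

lemma loomis_whitney:
  fixes D :: "'a::euclidean_space \<Rightarrow> 'a \<Rightarrow> ennreal"
  assumes N: "DIM('a) = Suc n" "n > 0"
    and D[measurable]: "\<And>b. b \<in> Basis \<Longrightarrow> D b \<in> borel_measurable borel"
  shows "(\<integral>\<^sup>+x. (\<Prod>b\<in>Basis. eroot n (line_int b (D b) x)) \<partial>lborel)
      \<le> of_nat n ^ Suc n * (\<Prod>b\<in>Basis. eroot n (\<integral>\<^sup>+x. D b x \<partial>lborel))"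
proof -
  obtain bs where bs: "distinct bs" "set bs = (Basis :: 'a set)"
    using finite_distinct_list[OF finite_Basis] by blast
  have "length bs = Suc n" using bs N distinct_card by fastforce
  then show ?thesis
    using loomis_whitney_aux[of "Basis :: 'a set" n D bs 0] bs N
    by (simp add: foldr_line_int_Basis cong: prod.cong)
qed

section \<open>Smooth mollifiers\<close>

text \<open>The power in the denominator makes the family closed under differentiation: the
  derivative of member n is a combination of members n + 1 and n + 2. Smoothness of the flat
  function exp(-1/t) is then an induction over the order with n arbitrary.\<close>

definition expinv :: "nat \<Rightarrow> real \<Rightarrow> real" where
  "expinv n t = (if t > 0 then exp (- 1 / t) / t ^ n else 0)"

text \<open>A single term of the exponential series at 1/t. As m is free, exp(-1/t) beats every
  negative power of t near 0.\<close>

lemma expinv_bound: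
  assumes "(t::real) > 0"
  shows "exp (- 1 / t) \<le> fact m * t ^ m"
proof -
  have "(1 / t) ^ m / fact m \<le> exp (1 / t)"
    using sum_le_suminf[OF summable_exp[of "1 / t"], of "{m}"] assms
    by (simp add: exp_def divide_inverse mult.commute)
  then show ?thesis using assms
    by (simp add: exp_minus field_simps power_divide)
qed

lemma has_real_derivative_expinv:
  "(expinv n has_real_derivative (expinv (n + 2) t - n * expinv (n + 1) t)) (at t)"
proof -
  consider "t > 0" | "t < 0" | "t = 0" by linarith
  then show ?thesis
  proof cases
    case 1
    have "((\<lambda>t. exp (- 1 / t) / t ^ n) has_real_derivative (expinv (n + 2) t - n * expinv (n + 1) t)) (at t)"
    proof -
      have "((\<lambda>t. exp (- inverse t) * inverse t ^ n) has_real_derivative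
          exp (- inverse t) * inverse t ^ 2 * inverse t ^ n
            + exp (- inverse t) * (n * inverse t ^ (n - 1) * (- (inverse t ^ 2)))) (at t)"
        using 1 by (auto intro!: derivative_eq_intros simp: power2_eq_square)
      moreover have "exp (- inverse t) * inverse t ^ 2 * inverse t ^ n
            + exp (- inverse t) * (n * inverse t ^ (n - 1) * (- (inverse t ^ 2)))
          = expinv (n + 2) t - n * expinv (n + 1) t"
        using 1 by (cases n) (simp_all add: expinv_def divide_inverse power_inverse power2_eq_square algebra_simps)
      ultimately show ?thesis by (simp add: divide_inverse power_inverse)
    qed
    then show ?thesis
      by (rule has_field_derivative_transform_within_open[of _ _ _ "{0<..}"]) (use 1 in \<open>auto simp: expinv_def\<close>)
  next
    case 2
    have "((\<lambda>t. 0) has_real_derivative 0) (at t)" by simp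
    then have "(expinv n has_real_derivative 0) (at t)"
      by (rule has_field_derivative_transform_within_open[of _ _ _ "{..<0}"]) (use 2 in \<open>auto simp: expinv_def\<close>)
    then show ?thesis using 2 by (simp add: expinv_def)
  next
    case 3
    \<comment> \<open>With m = n + 2 in \<open>expinv_bound\<close>, one power pays for the division
      by h and another one is left over, so the quotient is at most a multiple of |h|.\<close>
    have "((\<lambda>h. (expinv n (0 + h) - expinv n 0) / h) \<longlongrightarrow> 0) (at 0)"
    proof (rule Lim_null_comparison)
      show "\<forall>\<^sub>F h in at 0. norm ((expinv n (0 + h) - expinv n 0) / h) \<le> fact (n + 2) * \<bar>h\<bar>"
      proof (intro always_eventually allI)
        fix h :: real
        show "norm ((expinv n (0 + h) - expinv n 0) / h) \<le> fact (n + 2) * \<bar>h\<bar>"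
        proof (cases "h > 0")
          case True
          have "exp (- 1 / h) / h ^ n / h \<le> (fact (n + 2) * h ^ (n + 2)) / h ^ n / h"
            using expinv_bound[OF True, of "n + 2"] True by (intro divide_right_mono) auto
          also have "\<dots> = fact (n + 2) * h" using True by (simp add: power_add power2_eq_square)
          finally show ?thesis using True by (simp add: expinv_def)
        next
          case False
          then have "(expinv n (0 + h) - expinv n 0) / h = 0" by (simp add: expinv_def)
          then show ?thesis by (metis abs_ge_zero fact_ge_zero mult_nonneg_nonneg norm_zero)
        qed
      qed
      show "((\<lambda>h::real. fact (n + 2) * \<bar>h\<bar>) \<longlongrightarrow> 0) (at 0)"
        by (auto intro!: tendsto_eq_intros)
    qed
    then show ?thesis using 3 by (simp add: DERIV_def expinv_def)
  qed
qed

section \<open>Closure properties of the classes C^k\<close>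

lemma Ck_on_SucD: "Ck_on (Suc k) UNIV f \<Longrightarrow> Ck_on k UNIV f"
proof (induction k arbitrary: f)
  case 0
  then obtain f' where "\<And>x. (f has_derivative f' x) (at x)" by auto
  then show ?case by (auto intro!: continuous_at_imp_continuous_on intro: has_derivative_continuous)
next
  case (Suc k)
  from Suc.prems obtain f' where f': "\<And>x. (f has_derivative f' x) (at x)" "\<And>v. Ck_on (Suc k) UNIV (\<lambda>x. f' x v)"
    unfolding Ck_on.simps(2)[of "Suc k"] by blast
  have "Ck_on k UNIV (\<lambda>x. f' x v)" for v by (rule Suc.IH[OF f'(2)])
  with f'(1) show ?case unfolding Ck_on.simps(2) by blast
qed

lemma Ck_on_const: "Ck_on k UNIV (\<lambda>x. c)"
proof (induction k arbitrary: c)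
  case (Suc k)
  then show ?case by (auto intro!: exI[of _ "\<lambda>x v. 0"] derivative_eq_intros)
qed simp

lemma Ck_on_add:
  "Ck_on k UNIV f \<Longrightarrow> Ck_on k UNIV g \<Longrightarrow> Ck_on k UNIV (\<lambda>x. f x + g x)"
proof (induction k arbitrary: f g)
  case 0
  then show ?case by (auto intro!: continuous_intros)
next
  case (Suc k)
  from Suc.prems obtain f' g' where
    "\<And>x. (f has_derivative f' x) (at x)" "\<And>v. Ck_on k UNIV (\<lambda>x. f' x v)"
    "\<And>x. (g has_derivative g' x) (at x)" "\<And>v. Ck_on k UNIV (\<lambda>x. g' x v)"
    by auto
  then show ?case using Suc.IH
    by (auto intro!: exI[of _ "\<lambda>x v. f' x v + g' x v"] derivative_eq_intros)
qed

text \<open>The product rule multiplies derivatives of order k with the undifferentiated factors,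
  which therefore must be of class C^k themselves; \<open>Ck_on_SucD\<close> supplies this.\<close>

lemma Ck_on_mult:
  "Ck_on k UNIV f \<Longrightarrow> Ck_on k UNIV g \<Longrightarrow> Ck_on k UNIV (\<lambda>x. f x * g x)"
proof (induction k arbitrary: f g)
  case 0
  then show ?case by (auto intro!: continuous_intros)
next
  case (Suc k)
  from Suc.prems obtain f' g' where
    "\<And>x. (f has_derivative f' x) (at x)" "\<And>v. Ck_on k UNIV (\<lambda>x. f' x v)"
    "\<And>x. (g has_derivative g' x) (at x)" "\<And>v. Ck_on k UNIV (\<lambda>x. g' x v)"
    by auto
  moreover have "Ck_on k UNIV f" "Ck_on k UNIV g" using Suc.prems Ck_on_SucD by blast+
  ultimately show ?case using Suc.IH
    by (auto intro!: exI[of _ "\<lambda>x v. f x * g' x v + f' x v * g x"] derivative_eq_intros Ck_on_add)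
qed

lemma Ck_on_prod:
  "finite A \<Longrightarrow> (\<And>i. i \<in> A \<Longrightarrow> Ck_on k UNIV (f i)) \<Longrightarrow> Ck_on k UNIV (\<lambda>x. \<Prod>i\<in>A. f i x)"
  by (induction A rule: finite_induct) (auto intro!: Ck_on_const Ck_on_mult)

lemma Ck_on_reflect: "Ck_on k UNIV f \<Longrightarrow> Ck_on k UNIV (\<lambda>x. f (z - x))"
proof (induction k arbitrary: f)
  case 0
  then show ?case
    by (auto intro!: continuous_on_compose2[of UNIV f] continuous_intros)
next
  case (Suc k)
  from Suc.prems obtain f' where f':
    "\<And>x. (f has_derivative f' x) (at x)" "\<And>v. Ck_on k UNIV (\<lambda>x. f' x v)"
    by auto
  have "((\<lambda>x. f (z - x)) has_derivative (\<lambda>v. f' (z - x) (- v))) (at x)" for x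
    by (rule has_derivative_compose[of "\<lambda>x. z - x" "\<lambda>v. - v" x UNIV f "f' (z - x)"])
      (auto intro!: derivative_eq_intros f')
  then show ?case using Suc.IH[OF f'(2)]
    by (auto intro!: exI[of _ "\<lambda>x v. f' (z - x) (- v)"])
qed

lemma Ck_on_expinv: "Ck_on k UNIV (\<lambda>x::'a::euclidean_space. expinv n (a \<bullet> x + c))"
proof (induction k arbitrary: n)
  case 0
  have "continuous_on UNIV (expinv n)"
    using has_real_derivative_expinv by (intro DERIV_continuous_on) (auto intro: has_field_derivative_at_within)
  then show ?case
    by (auto intro!: continuous_on_compose2[of UNIV "expinv n"] continuous_intros)
next
  case (Suc k)
  define f' where "f' x v = (expinv (n + 2) (a \<bullet> x + c) + (- real n) * expinv (n + 1) (a \<bullet> x + c)) * (a \<bullet> v)" for x v :: 'a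
  have "((\<lambda>x. expinv n (a \<bullet> x + c)) has_derivative f' x) (at x)" for x
  proof -
    have "((\<lambda>x. a \<bullet> x + c) has_derivative (\<lambda>v. a \<bullet> v)) (at x)"
      by (auto intro!: derivative_eq_intros)
    from has_derivative_compose[OF this has_real_derivative_expinv[unfolded has_field_derivative_def]]
    show ?thesis by (simp add: f'_def[abs_def])
  qed
  moreover have "Ck_on k UNIV (\<lambda>x. f' x v)" for v
    unfolding f'_def by (intro Ck_on_mult Ck_on_add Ck_on_const Suc.IH)
  ultimately show ?case by auto
qed

text \<open>A product over the coordinates of one-dimensional bumps, so that only affine functions
  enter \<open>expinv\<close> and no smoothness of the norm is involved.\<close>

lemma mollifier_exists:
  assumes "\<delta> > 0"
  shows "\<exists>\<rho>::'a::euclidean_space \<Rightarrow> real. Cinf_on UNIV \<rho> \<and> (\<forall>x. \<rho> x \<ge> 0) \<and> (\<forall>x. \<rho> x \<noteq> 0 \<longrightarrow> norm x \<le> \<delta>)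
     \<and> integrable lborel \<rho> \<and> (\<integral>x. \<rho> x \<partial>lborel) = 1"
proof -
  \<comment> \<open>Half the side of the supporting cube. The norm is at most the sum of the N
    absolute coordinates, so the cube lies in the ball of radius \<delta>.\<close>
  define d where "d = \<delta> / DIM('a)"
  have d: "d > 0" using assms by (simp add: d_def)
  define k :: "'a \<Rightarrow> real" where "k x = (\<Prod>b\<in>Basis. expinv 0 (b \<bullet> x + d) * expinv 0 ((- b) \<bullet> x + d))" for x
  have Ck: "Ck_on j UNIV k" for j
    unfolding k_def by (intro Ck_on_prod Ck_on_mult Ck_on_expinv) auto
  have nn: "k x \<ge> 0" for x unfolding k_def by (intro prod_nonneg) (auto simp: expinv_def)
  have supp: "norm x \<le> \<delta>" if "k x \<noteq> 0" for x
  proof -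
    have "\<bar>x \<bullet> b\<bar> \<le> d" if "b \<in> Basis" for b
      using \<open>k x \<noteq> 0\<close> that by (auto simp: k_def prod_zero_iff expinv_def inner_commute split: if_splits)
    then have "(\<Sum>b\<in>Basis. \<bar>x \<bullet> b\<bar>) \<le> DIM('a) * d" by (intro sum_bounded_above) auto
    then show ?thesis using norm_le_l1[of x] by (simp add: d_def)
  qed
  have cont: "continuous_on UNIV k" using Ck[of 0] by simp
  then have [measurable]: "k \<in> borel_measurable borel" by (rule borel_measurable_continuous_onI)
  have int: "integrable lborel k"
  proof -
    have "integrable lborel (\<lambda>x. indicator (cball 0 \<delta>) x *\<^sub>R k x)"
      using cont continuous_on_subset by (intro borel_integrable_compact) auto
    then show ?thesis
      by (rule Bochner_Integration.integrable_cong[THEN iffD1, rotated 2]) (use supp in \<open>auto simp: indicator_def\<close>)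
  qed
  \<comment> \<open>Needed for the normalisation: the set where \<open>k\<close> is positive is open
    and contains 0, hence is not a null set.\<close>
  have "(\<integral>x. k x \<partial>lborel) > 0"
  proof -
    have "k 0 > 0" unfolding k_def using d by (intro prod_pos) (auto simp: expinv_def)
    moreover have "open {x. k x > 0}"
      using open_Collect_less[OF continuous_on_const cont] by simp
    ultimately have "{x. k x > 0} \<notin> null_sets lborel"
      using open_not_negligible[of "{x. k x > 0}"] null_sets_completionI[of "{x. k x > 0}" lborel]
      unfolding negligible_iff_null_sets by blast
    then have "\<not> (AE x in lborel. x \<notin> {x. k x > 0})"
      by (subst AE_iff_null_sets[symmetric]) auto
    then have "\<not> (AE x in lborel. k x = 0)"
    proof (rule contrapos_nn)
      assume "AE x in lborel. k x = 0"
      then show "AE x in lborel. x \<notin> {x. k x > 0}" by eventually_elim simp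
    qed
    then show ?thesis
      using integral_nonneg_eq_0_iff_AE[OF int] nn Bochner_Integration.integral_nonneg[of lborel k]
      by (metis (mono_tags, lifting) always_eventually less_le)
  qed
  moreover define \<rho> where "\<rho> x = (1 / (\<integral>x. k x \<partial>lborel)) * k x" for x
  moreover have "Cinf_on UNIV \<rho>"
    unfolding Cinf_on_def \<rho>_def by (intro allI Ck_on_mult Ck_on_const Ck)
  ultimately have "Cinf_on UNIV \<rho>" "\<forall>x. \<rho> x \<ge> 0" "\<forall>x. \<rho> x \<noteq> 0 \<longrightarrow> norm x \<le> \<delta>"
     "integrable lborel \<rho>" "(\<integral>x. \<rho> x \<partial>lborel) = 1"
    unfolding \<rho>_def using nn supp int by auto
  then show ?thesis by blast
qed

lemma Cinf_on_has_continuous_derivative: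
  assumes "Cinf_on UNIV f"
  shows "\<exists>f'. (\<forall>x. (f has_derivative f' x) (at x)) \<and> (\<forall>v. continuous_on UNIV (\<lambda>x. f' x v))"
proof -
  have "Ck_on (Suc 0) UNIV f" using assms unfolding Cinf_on_def by blast
  then show ?thesis by auto
qed

lemma closure_support_reflect:
  assumes "\<And>x. \<rho> x \<noteq> 0 \<Longrightarrow> norm x \<le> \<delta>"
  shows "closure {y. \<rho> (z - y) \<noteq> 0} \<subseteq> cball z \<delta>"
  using assms by (intro closure_minimal) (auto simp: dist_norm)

text \<open>The condition on \<open>norm z\<close> keeps the ball of radius \<delta> about
  \<open>z\<close> away from the origin; this is what makes shifted mollifiers admissible in the
  punctured weak formulation.\<close>

lemma test_fun_punct_reflect:
  assumes "Cinf_on UNIV \<rho>" and supp: "\<And>x. \<rho> x \<noteq> 0 \<Longrightarrow> norm x \<le> \<delta>" and "\<delta> < norm z"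
  shows "test_fun_punct (\<lambda>y. \<rho> (z - y))"
proof -
  note cl = closure_support_reflect[of \<rho> \<delta> z, OF supp]
  have "compact (closure {y. \<rho> (z - y) \<noteq> 0})"
    using cl bounded_subset[OF bounded_cball] by (auto simp: compact_eq_bounded_closed)
  moreover have "0 \<notin> closure {y. \<rho> (z - y) \<noteq> 0}" using cl assms(3) by auto
  ultimately show ?thesis
    using assms(1) by (auto simp: test_fun_punct_def Cinf_on_def intro!: Ck_on_reflect)
qed

section \<open>Convolution and continuity of translation\<close>

lemma nn_integral_lborel_translate:
  fixes f :: "'a::euclidean_space \<Rightarrow> ennreal"
  assumes [measurable]: "f \<in> borel_measurable borel"
  shows "(\<integral>\<^sup>+x. f (x + w) \<partial>lborel) = (\<integral>\<^sup>+x. f x \<partial>lborel)"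
proof -
  have "(\<integral>\<^sup>+x. f x \<partial>lborel) = (\<integral>\<^sup>+x. f x \<partial>distr lborel borel ((+) w))"
    by (simp add: lborel_distr_plus)
  then show ?thesis by (simp add: nn_integral_distr add.commute)
qed

lemma nn_integral_lborel_reflect:
  fixes f :: "'a::euclidean_space \<Rightarrow> ennreal"
  assumes [measurable]: "f \<in> borel_measurable borel"
  shows "(\<integral>\<^sup>+x. f (w - x) \<partial>lborel) = (\<integral>\<^sup>+x. f x \<partial>lborel)"
proof -
  have "(\<integral>\<^sup>+x. f x \<partial>lborel) = (\<integral>\<^sup>+x. f x \<partial>density (distr lborel borel ((-) w)) (\<lambda>_. 1))"
    using lborel_affine[of "-1" w] by simp
  then show ?thesis by (simp add: nn_integral_distr nn_integral_density)
qed

definition conv :: "('a::euclidean_space \<Rightarrow> real) \<Rightarrow> ('a \<Rightarrow> real) \<Rightarrow> 'a \<Rightarrow> real" where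
  "conv f h x = (\<integral>y. f y * h (x - y) \<partial>lborel)"

context
  fixes f h :: "'a::euclidean_space \<Rightarrow> real" and M :: real
  assumes f: "integrable lborel f"
    and h: "continuous_on UNIV h" "\<And>x. \<bar>h x\<bar> \<le> M"
begin

lemma conv_bound: "\<bar>f y * h z\<bar> \<le> M * \<bar>f y\<bar>"
  using mult_right_mono[OF h(2)[of z], of "\<bar>f y\<bar>"] by (simp add: abs_mult mult.commute)

lemma conv_measurable: "(\<lambda>y. f y * h (x - y)) \<in> borel_measurable lborel"
proof -
  have [measurable]: "f \<in> borel_measurable borel" "h \<in> borel_measurable borel"
    using f h by (auto intro: borel_measurable_continuous_onI)
  show ?thesis by measurable
qed

lemma conv_integrable: "integrable lborel (\<lambda>y. f y * h (x - y))"
  by (rule Bochner_Integration.integrable_bound[where f="\<lambda>y. M * \<bar>f y\<bar>"])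
    (use f conv_bound conv_measurable in \<open>auto intro!: always_eventually order_trans[OF conv_bound abs_ge_self]\<close>)

lemma continuous_conv: "continuous_on UNIV (conv f h)"
proof (intro continuous_at_imp_continuous_on ballI)
  fix x
  show "isCont (conv f h) x"
    unfolding continuous_at_sequentially o_def conv_def
  proof (intro allI impI)
    fix X assume X: "X \<longlonglongrightarrow> x"
    show "(\<lambda>n. \<integral>y. f y * h (X n - y) \<partial>lborel) \<longlonglongrightarrow> (\<integral>y. f y * h (x - y) \<partial>lborel)"
    proof (rule integral_dominated_convergence[where w="\<lambda>y. M * \<bar>f y\<bar>"])
      show "AE y in lborel. (\<lambda>n. f y * h (X n - y)) \<longlonglongrightarrow> f y * h (x - y)"
      proof (intro always_eventually allI tendsto_mult tendsto_const)
        fix y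
        have "isCont h (x - y)" using h(1) by (simp add: continuous_on_eq_continuous_at)
        then show "(\<lambda>n. h (X n - y)) \<longlonglongrightarrow> h (x - y)"
          by (rule isCont_tendsto_compose) (auto intro!: tendsto_intros X)
      qed
    qed (use f conv_bound conv_measurable in auto)
  qed
qed

end

text \<open>The derivative falls on the kernel, so integrability of \<open>f\<close> is enough. It
  is stated along a line because only the restriction to coordinate lines enters the Sobolev
  bound.\<close>

lemma has_real_derivative_conv:
  fixes f h :: "'a::euclidean_space \<Rightarrow> real"
  assumes f: "integrable lborel f"
    and h: "continuous_on UNIV h" "\<And>x. \<bar>h x\<bar> \<le> M0"
    and h': "\<And>x. (h has_derivative h' x) (at x)"
    and hb: "continuous_on UNIV (\<lambda>x. h' x b)" "\<And>x. \<bar>h' x b\<bar> \<le> M"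
  shows "((\<lambda>t. conv f h (x + t *\<^sub>R b)) has_real_derivative conv f (\<lambda>x. h' x b) (x + t *\<^sub>R b)) (at t)"
proof -
  have [measurable]: "f \<in> borel_measurable borel" "h \<in> borel_measurable borel" "(\<lambda>x. h' x b) \<in> borel_measurable borel"
    using f h hb by (auto intro: borel_measurable_continuous_onI)
  have line: "((\<lambda>s. h (z + s *\<^sub>R b)) has_real_derivative h' (z + s *\<^sub>R b) b) (at s)" for z s
  proof -
    have "((\<lambda>s. z + s *\<^sub>R b) has_derivative (\<lambda>s. s *\<^sub>R b)) (at s)"
      by (auto intro!: derivative_eq_intros)
    from has_derivative_compose[OF this h']
    have "((\<lambda>s. h (z + s *\<^sub>R b)) has_derivative (\<lambda>r. h' (z + s *\<^sub>R b) (r *\<^sub>R b))) (at s)" .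
    moreover have "h' (z + s *\<^sub>R b) (r *\<^sub>R b) = h' (z + s *\<^sub>R b) b * r" for r
      using linear_scale[OF has_derivative_linear[OF h']] by (simp add: mult.commute)
    ultimately show ?thesis by (simp add: has_field_derivative_def mult_commute_abs)
  qed
  \<comment> \<open>The mean value theorem; it supplies the majorant of the difference quotients for
    dominated convergence.\<close>
  have lip: "\<bar>h (z + s *\<^sub>R b) - h z\<bar> \<le> M * \<bar>s\<bar>" for z s
    using field_differentiable_bound[of UNIV "\<lambda>s. h (z + s *\<^sub>R b)" "\<lambda>s. h' (z + s *\<^sub>R b) b" M 0 s] line hb(2)
    by (simp add: norm_minus_commute abs_minus_commute)
  have "((\<lambda>s. (conv f h (x + (t + s) *\<^sub>R b) - conv f h (x + t *\<^sub>R b)) / s) \<longlongrightarrow> conv f (\<lambda>x. h' x b) (x + t *\<^sub>R b)) (at 0)"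
    unfolding tendsto_at_iff_sequentially o_def
  proof (intro allI impI)
    fix S :: "nat \<Rightarrow> real" assume S: "\<forall>i. S i \<in> UNIV - {0}" "S \<longlonglongrightarrow> 0"
    let ?z = "\<lambda>y. x + t *\<^sub>R b - y"
    have eq: "(conv f h (x + (t + S n) *\<^sub>R b) - conv f h (x + t *\<^sub>R b)) / S n
        = (\<integral>y. f y * ((h (?z y + S n *\<^sub>R b) - h (?z y)) / S n) \<partial>lborel)" for n
    proof -
      have "conv f h (x + (t + S n) *\<^sub>R b) - conv f h (x + t *\<^sub>R b)
        = (\<integral>y. f y * h (x + (t + S n) *\<^sub>R b - y) - f y * h (x + t *\<^sub>R b - y) \<partial>lborel)"
        unfolding conv_def by (intro Bochner_Integration.integral_diff[symmetric] conv_integrable[OF f h])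
      then have "(conv f h (x + (t + S n) *\<^sub>R b) - conv f h (x + t *\<^sub>R b)) / S n
        = (\<integral>y. (f y * h (x + (t + S n) *\<^sub>R b - y) - f y * h (x + t *\<^sub>R b - y)) / S n \<partial>lborel)"
        by simp
      also have "\<dots> = (\<integral>y. f y * ((h (?z y + S n *\<^sub>R b) - h (?z y)) / S n) \<partial>lborel)"
        by (intro Bochner_Integration.integral_cong refl) (simp add: algebra_simps diff_divide_distrib)
      finally show ?thesis .
    qed
    show "(\<lambda>n. (conv f h (x + (t + S n) *\<^sub>R b) - conv f h (x + t *\<^sub>R b)) / S n) \<longlonglongrightarrow> conv f (\<lambda>x. h' x b) (x + t *\<^sub>R b)"
      unfolding eq unfolding conv_def
    proof (rule integral_dominated_convergence[where w="\<lambda>y. M * \<bar>f y\<bar>"])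
      show "AE y in lborel. (\<lambda>n. f y * ((h (?z y + S n *\<^sub>R b) - h (?z y)) / S n)) \<longlonglongrightarrow> f y * h' (?z y) b"
      proof (intro always_eventually allI tendsto_mult tendsto_const)
        fix y
        have "((\<lambda>s. (h (?z y + s *\<^sub>R b) - h (?z y)) / s) \<longlongrightarrow> h' (?z y) b) (at 0)"
          using line[of "?z y" 0] by (simp add: DERIV_def)
        then show "(\<lambda>n. (h (?z y + S n *\<^sub>R b) - h (?z y)) / S n) \<longlonglongrightarrow> h' (?z y) b"
          using S unfolding tendsto_at_iff_sequentially o_def by blast
      qed
      show "AE y in lborel. norm (f y * ((h (?z y + S n *\<^sub>R b) - h (?z y)) / S n)) \<le> M * \<bar>f y\<bar>" for n
      proof (intro always_eventually allI)
        fix y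
        have "\<bar>(h (?z y + S n *\<^sub>R b) - h (?z y)) / S n\<bar> \<le> M"
          using lip[of "?z y" "S n"] S(1) by (simp add: field_simps)
        from mult_right_mono[OF this, of "\<bar>f y\<bar>"]
        show "norm (f y * ((h (?z y + S n *\<^sub>R b) - h (?z y)) / S n)) \<le> M * \<bar>f y\<bar>"
          by (simp add: abs_mult mult.commute)
      qed
    qed (use f in auto)
  qed
  then show ?thesis by (simp add: DERIV_def)
qed

section \<open>Continuity of translations in L^1\<close>

definition transl_diff :: "('a::euclidean_space \<Rightarrow> real) \<Rightarrow> 'a \<Rightarrow> ennreal" where
  "transl_diff f w = (\<integral>\<^sup>+x. ennreal \<bar>f (x + w) - f x\<bar> \<partial>lborel)"

text \<open>Each point of an open set stays in it under small translations, so the mass that leaves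
  tends to zero by dominated convergence. The mass that enters under \<open>w\<close> is the mass
  that leaves under \<open>- w\<close>, which gives the other half of the symmetric
  difference.\<close>

lemma transl_diff_indicator_open:
  fixes U :: "'a::euclidean_space set"
  assumes U: "open U" "emeasure lborel U < \<infinity>"
  shows "(transl_diff (indicator U) \<longlongrightarrow> 0) (at 0)"
  unfolding tendsto_at_iff_sequentially o_def
proof (intro allI impI)
  fix X :: "nat \<Rightarrow> 'a" assume "\<forall>i. X i \<in> UNIV - {0}" and X: "X \<longlonglongrightarrow> 0"
  have [measurable]: "U \<in> sets borel" using U by auto
  define G where "G w = (\<integral>\<^sup>+x. ennreal (indicator U x * (1 - indicator U (x + w))) \<partial>lborel)" for w
  have lim: "(\<lambda>n. G (Y n)) \<longlonglongrightarrow> 0" if Y: "Y \<longlonglongrightarrow> 0" for Y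
  proof -
    have "(\<lambda>n. G (Y n)) \<longlonglongrightarrow> (\<integral>\<^sup>+x. 0 \<partial>(lborel :: 'a measure))"
      unfolding G_def
    proof (rule nn_integral_dominated_convergence[where w="indicator U"])
      show "(\<integral>\<^sup>+x. indicator U x \<partial>lborel) < \<infinity>" using U by simp
      show "AE x in lborel. (\<lambda>n. ennreal (indicator U x * (1 - indicator U (x + Y n)))) \<longlonglongrightarrow> 0"
      proof (intro always_eventually allI)
        fix x
        have "eventually (\<lambda>n. ennreal (indicator U x * (1 - indicator U (x + Y n))) = 0) sequentially"
        proof (cases "x \<in> U")
          case True
          have "(\<lambda>n. x + Y n) \<longlonglongrightarrow> x" using tendsto_add[OF tendsto_const Y, of x] by simp
          from topological_tendstoD[OF this U(1) True] show ?thesis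
            by eventually_elim simp
        qed simp
        then show "(\<lambda>n. ennreal (indicator U x * (1 - indicator U (x + Y n)))) \<longlonglongrightarrow> 0"
          by (rule tendsto_eventually)
      qed
      show "AE x in lborel. ennreal (indicator U x * (1 - indicator U (x + Y n))) \<le> indicator U x" for n
        by (intro always_eventually) (auto simp: indicator_def)
    qed measurable
    then show ?thesis by simp
  qed
  have eq: "transl_diff (indicator U) w = G w + G (- w)" for w :: 'a
  proof -
    have "transl_diff (indicator U) w = (\<integral>\<^sup>+x. ennreal (indicator U x * (1 - indicator U (x + w))) +
         ennreal (indicator U (x + w) * (1 - indicator U (x + w + (- w)))) \<partial>lborel)"
      unfolding transl_diff_def by (intro nn_integral_cong) (auto simp: indicator_def)
    also have "\<dots> = G w + (\<integral>\<^sup>+x. ennreal (indicator U (x + w) * (1 - indicator U (x + w + (- w)))) \<partial>lborel)"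
      unfolding G_def by (rule nn_integral_add) measurable
    also have "(\<integral>\<^sup>+x. ennreal (indicator U (x + w) * (1 - indicator U (x + w + (- w)))) \<partial>lborel) = G (- w)"
      unfolding G_def by (rule nn_integral_lborel_translate[of "\<lambda>x. ennreal (indicator U x * (1 - indicator U (x + (- w))))"]) measurable
    finally show ?thesis .
  qed
  have "(\<lambda>n. G (X n) + G (- X n)) \<longlonglongrightarrow> 0 + 0"
    using tendsto_minus[OF X] by (intro tendsto_add lim X) simp
  then show "(\<lambda>n. transl_diff (indicator U) (X n)) \<longlonglongrightarrow> 0" by (simp add: eq)
qed

lemma transl_diff_triangle:
  assumes [measurable]: "f \<in> borel_measurable borel" "g \<in> borel_measurable borel"
  shows "transl_diff f w \<le> transl_diff g w + 2 * (\<integral>\<^sup>+x. ennreal \<bar>f x - g x\<bar> \<partial>lborel)"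
proof -
  have "transl_diff f w \<le> (\<integral>\<^sup>+x. ennreal \<bar>g (x + w) - g x\<bar> + (ennreal \<bar>f (x + w) - g (x + w)\<bar> + ennreal \<bar>f x - g x\<bar>) \<partial>lborel)"
    unfolding transl_diff_def
    by (intro nn_integral_mono) (auto simp flip: ennreal_plus intro!: ennreal_leI)
  also have "\<dots> = transl_diff g w + ((\<integral>\<^sup>+x. ennreal \<bar>f (x + w) - g (x + w)\<bar> \<partial>lborel) + (\<integral>\<^sup>+x. ennreal \<bar>f x - g x\<bar> \<partial>lborel))"
    unfolding transl_diff_def by (simp add: nn_integral_add)
  also have "(\<integral>\<^sup>+x. ennreal \<bar>f (x + w) - g (x + w)\<bar> \<partial>lborel) = (\<integral>\<^sup>+x. ennreal \<bar>f x - g x\<bar> \<partial>lborel)"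
    by (rule nn_integral_lborel_translate[of "\<lambda>x. ennreal \<bar>f x - g x\<bar>"]) measurable
  finally show ?thesis by (simp add: mult_2)
qed

text \<open>Translating a function and its approximant changes their L^1 distance by nothing, so the
  property passes to L^1 limits.\<close>

lemma transl_diff_approx:
  fixes f :: "'a::euclidean_space \<Rightarrow> real"
  assumes [measurable]: "f \<in> borel_measurable borel"
    and ap: "\<And>e. e > 0 \<Longrightarrow> \<exists>g\<in>borel_measurable borel. (transl_diff g \<longlongrightarrow> 0) (at 0) \<and>
        (\<integral>\<^sup>+x. ennreal \<bar>f x - g x\<bar> \<partial>lborel) \<le> ennreal e"
  shows "(transl_diff f \<longlongrightarrow> 0) (at 0)"
proof (rule order_tendstoI)
  fix a :: ennreal assume "0 < a"
  then obtain z where z: "0 < z" "z < a" using dense by blast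
  then obtain e where e: "0 < e" "ennreal e < a" by (cases z) auto
  obtain g where [measurable]: "g \<in> borel_measurable borel" and g: "(transl_diff g \<longlongrightarrow> 0) (at 0)"
    "(\<integral>\<^sup>+x. ennreal \<bar>f x - g x\<bar> \<partial>lborel) \<le> ennreal (e / 4)"
    using ap[of "e/4"] e by auto
  have "eventually (\<lambda>w. transl_diff g w < ennreal (e / 2)) (at 0)"
    using order_tendstoD(2)[OF g(1), of "ennreal (e/2)"] e by auto
  then show "eventually (\<lambda>w. transl_diff f w < a) (at 0)"
  proof eventually_elim
    case (elim w)
    have "transl_diff f w \<le> transl_diff g w + 2 * (\<integral>\<^sup>+x. ennreal \<bar>f x - g x\<bar> \<partial>lborel)"
      by (rule transl_diff_triangle) measurable
    also have "\<dots> \<le> ennreal (e / 2) + 2 * ennreal (e / 4)"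
      using elim g(2) by (intro add_mono mult_left_mono) auto
    also have "\<dots> = ennreal e"
      using e by (simp add: ennreal_numeral[symmetric] ennreal_mult[symmetric] ennreal_plus[symmetric] del: ennreal_numeral ennreal_plus)
    finally show ?case using e by order
  qed
qed (simp add: not_less_zero)

text \<open>Open sets approximate sets of finite measure from outside, and the induction for
  integrable functions carries the property from indicators to sums and limits.\<close>

lemma transl_diff_tendsto_0:
  fixes f :: "'a::euclidean_space \<Rightarrow> real"
  assumes "integrable lborel f"
  shows "(transl_diff f \<longlongrightarrow> 0) (at 0)"
  using assms
proof (induction rule: integrable_induct)
  case (base A c)
  have ind: "(transl_diff (indicator A) \<longlongrightarrow> 0) (at 0)"
  proof (rule transl_diff_approx)
    show "indicator A \<in> borel_measurable borel" using base by auto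
    fix e :: real assume "e > 0"
    then obtain U where U: "open U" "A \<subseteq> U" "emeasure lborel (U - A) < ennreal e"
      using outer_regular_lborel[of A e] base by auto
    have [measurable]: "U \<in> sets borel" "A \<in> sets borel" using U base by auto
    have "emeasure lborel U \<le> emeasure lborel A + emeasure lborel (U - A)"
      using U base by (metis Diff_partition emeasure_subadditive sets_lborel \<open>U \<in> sets borel\<close> sets.Diff)
    also have "\<dots> < \<infinity>" using U base by (auto simp: less_top[symmetric])
    finally have "(transl_diff (indicator U) \<longlongrightarrow> 0) (at 0)"
      by (intro transl_diff_indicator_open U)
    moreover have "(\<integral>\<^sup>+x. ennreal \<bar>indicator A x - indicator U x\<bar> \<partial>lborel) = (\<integral>\<^sup>+x. indicator (U - A) x \<partial>lborel)"
      using U by (intro nn_integral_cong) (auto simp: indicator_def)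
    ultimately show "\<exists>g\<in>borel_measurable borel. (transl_diff g \<longlongrightarrow> 0) (at 0) \<and>
        (\<integral>\<^sup>+x. ennreal \<bar>indicator A x - g x\<bar> \<partial>lborel) \<le> ennreal e"
      using U by (intro bexI[of _ "indicator U"]) auto
  qed
  have "transl_diff (\<lambda>x. indicator A x *\<^sub>R c) w = ennreal \<bar>c\<bar> * transl_diff (indicator A) w" for w
  proof -
    have [measurable]: "A \<in> sets borel" using base by auto
    have "(\<integral>\<^sup>+x. ennreal \<bar>indicator A (x + w) *\<^sub>R c - indicator A x *\<^sub>R c\<bar> \<partial>lborel)
       = (\<integral>\<^sup>+x. ennreal \<bar>c\<bar> * ennreal \<bar>indicator A (x + w) - indicator A x\<bar> \<partial>lborel)"
      by (intro nn_integral_cong) (auto simp: indicator_def)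
    then show ?thesis unfolding transl_diff_def by (simp add: nn_integral_cmult)
  qed
  then show ?case using tendsto_mult_ennreal[OF tendsto_const ind, of "ennreal \<bar>c\<bar>"] by (simp add: fun_eq_iff[symmetric])
next
  case (add f g)
  have [measurable]: "f \<in> borel_measurable borel" "g \<in> borel_measurable borel" using add by auto
  have le: "transl_diff (\<lambda>x. f x + g x) w \<le> transl_diff f w + transl_diff g w" for w
  proof -
    have "transl_diff (\<lambda>x. f x + g x) w \<le> (\<integral>\<^sup>+x. ennreal \<bar>f (x + w) - f x\<bar> + ennreal \<bar>g (x + w) - g x\<bar> \<partial>lborel)"
      unfolding transl_diff_def by (intro nn_integral_mono) (auto simp flip: ennreal_plus intro!: ennreal_leI)
    also have "\<dots> = transl_diff f w + transl_diff g w"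
      unfolding transl_diff_def by (rule nn_integral_add) measurable
    finally show ?thesis .
  qed
  have lim: "((\<lambda>w. transl_diff f w + transl_diff g w) \<longlongrightarrow> 0) (at 0)"
    using tendsto_add[OF add(3,4)] by simp
  have "eventually (\<lambda>w. (0::ennreal) \<le> transl_diff (\<lambda>x. f x + g x) w) (at 0)" by simp
  moreover have "eventually (\<lambda>w. transl_diff (\<lambda>x. f x + g x) w \<le> transl_diff f w + transl_diff g w) (at 0)"
    using le by (intro always_eventually allI)
  ultimately show ?case
    by (rule tendsto_sandwich[OF _ _ tendsto_const lim])
next
  case (lim f s)
  have [measurable]: "f \<in> borel_measurable borel" "\<And>i. s i \<in> borel_measurable borel" using lim by auto
  show ?case
  proof (rule transl_diff_approx)
    fix e :: real assume "e > 0"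
    have "(\<lambda>i. \<integral>\<^sup>+x. ennreal (norm (s i x - f x)) \<partial>lborel) \<longlonglongrightarrow> 0"
    proof -
      have "(\<lambda>i. \<integral>\<^sup>+x. ennreal (norm (s i x - f x)) \<partial>lborel) \<longlonglongrightarrow> (\<integral>\<^sup>+x. 0 \<partial>(lborel :: 'a measure))"
      \<comment> \<open>The induction rule provides approximants bounded by twice |f|; hence the
        factor 3.\<close>
      proof (rule nn_integral_dominated_convergence[where w="\<lambda>x. ennreal (3 * norm (f x))"])
        show "(\<integral>\<^sup>+x. ennreal (3 * norm (f x)) \<partial>lborel) < \<infinity>"
          using lim(4) by (subst nn_integral_eq_integral) auto
        show "AE x in lborel. (\<lambda>i. ennreal (norm (s i x - f x))) \<longlonglongrightarrow> 0"
        proof (intro AE_I2)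
          fix x assume "x \<in> space (lborel :: 'a measure)"
          then have "(\<lambda>i. norm (s i x - f x)) \<longlonglongrightarrow> norm (f x - f x)"
            by (intro tendsto_intros lim(2))
          then show "(\<lambda>i. ennreal (norm (s i x - f x))) \<longlonglongrightarrow> 0"
            using tendsto_ennrealI by fastforce
        qed
        show "AE x in lborel. ennreal (norm (s i x - f x)) \<le> ennreal (3 * norm (f x))" for i
        proof (intro AE_I2 ennreal_leI)
          fix x assume "x \<in> space (lborel :: 'a measure)"
          then show "norm (s i x - f x) \<le> 3 * norm (f x)"
            using lim(3)[of x i] norm_triangle_ineq4[of "s i x" "f x"] by linarith
        qed
      qed measurable
      then show ?thesis by simp
    qed
    then have "eventually (\<lambda>i. (\<integral>\<^sup>+x. ennreal (norm (s i x - f x)) \<partial>lborel) < ennreal e) sequentially"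
      using \<open>e > 0\<close> by (intro order_tendstoD) auto
    then obtain i where "(\<integral>\<^sup>+x. ennreal (norm (s i x - f x)) \<partial>lborel) < ennreal e"
      by (auto simp: eventually_sequentially)
    then show "\<exists>g\<in>borel_measurable borel. (transl_diff g \<longlongrightarrow> 0) (at 0) \<and>
        (\<integral>\<^sup>+x. ennreal \<bar>f x - g x\<bar> \<partial>lborel) \<le> ennreal e"
      using lim(5) by (intro bexI[of _ "s i"]) (auto simp: abs_minus_commute)
  qed measurable
qed

text \<open>As \<rho> has integral 1, the difference at \<open>x\<close> is the \<rho>-average of
  f(x - w) - f(x); Tonelli then leaves the \<rho>-average of the translation differences.\<close>

lemma nn_integral_conv_diff_le:
  fixes f \<rho> :: "'a::euclidean_space \<Rightarrow> real"
  assumes f: "integrable lborel f"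
    and \<rho>: "continuous_on UNIV \<rho>" "\<And>x. \<bar>\<rho> x\<bar> \<le> M" "\<And>x. \<rho> x \<ge> 0" "integrable lborel \<rho>" "(\<integral>x. \<rho> x \<partial>lborel) = 1"
    and bound: "\<And>w. \<rho> w \<noteq> 0 \<Longrightarrow> transl_diff f (- w) \<le> c"
  shows "(\<integral>\<^sup>+x. ennreal \<bar>conv f \<rho> x - f x\<bar> \<partial>lborel) \<le> c"
proof -
  have [measurable]: "f \<in> borel_measurable borel" "\<rho> \<in> borel_measurable borel"
    using f \<rho> by (auto intro: borel_measurable_continuous_onI)
  have one: "(\<integral>\<^sup>+y. ennreal (\<rho> y) \<partial>lborel) = 1"
    using \<rho> by (subst nn_integral_eq_integral) auto
  have one': "(\<integral>\<^sup>+y. ennreal (\<rho> (x - y)) \<partial>lborel) = 1" for x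
    using nn_integral_lborel_reflect[of "\<lambda>y. ennreal (\<rho> y)" x] one by simp
  have int: "integrable lborel (\<lambda>y. \<rho> (x - y))" for x
    using one'[of x] \<rho>(3) by (intro integrableI_nonneg) auto
  have int1: "(\<integral>y. \<rho> (x - y) \<partial>lborel) = 1" for x
    using one'[of x] \<rho>(3) by (subst integral_eq_nn_integral) auto
  have pt: "ennreal \<bar>conv f \<rho> x - f x\<bar> \<le> (\<integral>\<^sup>+w. ennreal (\<rho> w) * ennreal \<bar>f (x + (- w)) - f x\<bar> \<partial>lborel)" for x
  proof -
    have "conv f \<rho> x - f x = (\<integral>y. f y * \<rho> (x - y) \<partial>lborel) - (\<integral>y. f x * \<rho> (x - y) \<partial>lborel)"
      using int1[of x] by (simp add: conv_def)
    also have "\<dots> = (\<integral>y. f y * \<rho> (x - y) - f x * \<rho> (x - y) \<partial>lborel)"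
      using int by (intro Bochner_Integration.integral_diff[symmetric] conv_integrable[OF f \<rho>(1,2)]) auto
    finally have "ennreal \<bar>conv f \<rho> x - f x\<bar> \<le> (\<integral>\<^sup>+y. ennreal (norm (f y * \<rho> (x - y) - f x * \<rho> (x - y))) \<partial>lborel)"
      using int integral_norm_bound_ennreal[of lborel "\<lambda>y. f y * \<rho> (x - y) - f x * \<rho> (x - y)"] conv_integrable[OF f \<rho>(1,2)] by auto
    also have "\<dots> = (\<integral>\<^sup>+y. ennreal (\<rho> (x - y)) * ennreal \<bar>f (x + (- (x - y))) - f x\<bar> \<partial>lborel)"
      using \<rho>(3) by (intro nn_integral_cong) (simp add: ennreal_mult[symmetric] left_diff_distrib[symmetric] abs_mult mult.commute)
    also have "\<dots> = (\<integral>\<^sup>+w. ennreal (\<rho> w) * ennreal \<bar>f (x + (- w)) - f x\<bar> \<partial>lborel)"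
      by (rule nn_integral_lborel_reflect[of "\<lambda>w. ennreal (\<rho> w) * ennreal \<bar>f (x + (- w)) - f x\<bar>"]) measurable
    finally show ?thesis .
  qed
  have "(\<integral>\<^sup>+x. ennreal \<bar>conv f \<rho> x - f x\<bar> \<partial>lborel) \<le> (\<integral>\<^sup>+x. (\<integral>\<^sup>+w. ennreal (\<rho> w) * ennreal \<bar>f (x + (- w)) - f x\<bar> \<partial>lborel) \<partial>lborel)"
    by (intro nn_integral_mono pt)
  also have "\<dots> = (\<integral>\<^sup>+w. (\<integral>\<^sup>+x. ennreal (\<rho> w) * ennreal \<bar>f (x + (- w)) - f x\<bar> \<partial>lborel) \<partial>lborel)"
    by (rule lborel_pair.Fubini') measurable
  also have "\<dots> = (\<integral>\<^sup>+w. ennreal (\<rho> w) * transl_diff f (- w) \<partial>lborel)"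
    unfolding transl_diff_def by (intro nn_integral_cong nn_integral_cmult) measurable
  also have "\<dots> \<le> (\<integral>\<^sup>+w. ennreal (\<rho> w) * c \<partial>lborel)"
    using bound by (intro nn_integral_mono) (metis ennreal_0 mult_left_mono mult_zero_left order_refl zero_le)
  also have "\<dots> = c" by (subst nn_integral_multc) (auto simp: one)
  finally show ?thesis .
qed

section \<open>The Gagliardo-Nirenberg-Sobolev bound\<close>

text \<open>The fundamental theorem of calculus, started at a point of the line outside the
  support.\<close>

lemma abs_le_line_int:
  fixes v vb :: "'a::euclidean_space \<Rightarrow> real"
  assumes der: "\<And>x t. ((\<lambda>t. v (x + t *\<^sub>R b)) has_real_derivative vb (x + t *\<^sub>R b)) (at t)"
    and cont: "continuous_on UNIV vb"
    and supp: "\<And>x. R < norm x \<Longrightarrow> v x = 0"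
    and b: "norm b = 1"
  shows "ennreal \<bar>v x\<bar> \<le> line_int b (\<lambda>y. ennreal \<bar>vb y\<bar>) x"
proof -
  \<comment> \<open>Then x - T b has norm at least T - |x| = |R| + 1, which exceeds R.\<close>
  define T where "T = \<bar>R\<bar> + norm x + 1"
  have "T \<ge> 0" by (simp add: T_def)
  have "norm (x + (- T) *\<^sub>R b) \<ge> norm ((- T) *\<^sub>R b) - norm x"
    using norm_triangle_ineq2[of "- (T *\<^sub>R b)" "- x"] by (simp add: norm_minus_commute)
  then have "v (x + (- T) *\<^sub>R b) = 0" using \<open>T \<ge> 0\<close> b by (intro supp) (simp add: T_def)
  moreover have contl: "continuous_on UNIV (\<lambda>t. vb (x + t *\<^sub>R b))"
    by (intro continuous_on_compose2[OF cont] continuous_intros) auto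
  have "(\<integral>t. indicator {-T..0} t *\<^sub>R vb (x + t *\<^sub>R b) \<partial>lborel) = v (x + 0 *\<^sub>R b) - v (x + (- T) *\<^sub>R b)"
  proof (rule integral_FTC_atLeastAtMost)
    show "((\<lambda>t. v (x + t *\<^sub>R b)) has_vector_derivative vb (x + t *\<^sub>R b)) (at t within {- T..0})" for t
      using der[of x t] by (simp add: has_real_derivative_iff_has_vector_derivative has_vector_derivative_at_within)
    show "continuous_on {- T..0} (\<lambda>t. vb (x + t *\<^sub>R b))" using contl by (rule continuous_on_subset) simp
  qed (use \<open>T \<ge> 0\<close> in simp)
  ultimately have eq: "v x = (\<integral>t. indicator {-T..0} t *\<^sub>R vb (x + t *\<^sub>R b) \<partial>lborel)"
    by simp
  have "integrable lborel (\<lambda>t. indicator {-T..0} t *\<^sub>R vb (x + t *\<^sub>R b))"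
    using continuous_on_subset[OF contl] by (intro borel_integrable_compact) auto
  from integral_norm_bound_ennreal[OF this] have "ennreal \<bar>v x\<bar> \<le> (\<integral>\<^sup>+t. ennreal (norm (indicator {-T..0} t *\<^sub>R vb (x + t *\<^sub>R b))) \<partial>lborel)"
    unfolding eq real_norm_def .
  also have "\<dots> \<le> line_int b (\<lambda>y. ennreal \<bar>vb y\<bar>) x"
    unfolding line_int_def by (intro nn_integral_mono) (auto simp: indicator_def)
  finally show ?thesis .
qed

text \<open>The conclusion of the Gagliardo-Nirenberg inequality with J in the role of the L^1 norm
  of the gradient. In dimension one the exponent N/(N-1) degenerates and the bound becomes a
  supremum; a common name lets the approximation arguments treat both cases at once. The constant is
  that of \<open>loomis_whitney\<close> with n = N - 1.\<close>

definition sob_bound :: "('a::euclidean_space \<Rightarrow> real) \<Rightarrow> real \<Rightarrow> bool" where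
  "sob_bound v J \<longleftrightarrow>
    (if DIM('a) = 1 then AE x in lborel. \<bar>v x\<bar> \<le> J
     else (\<integral>\<^sup>+x. ennreal (\<bar>v x\<bar> powr (DIM('a) / (DIM('a) - 1))) \<partial>lborel)
       \<le> ennreal ((DIM('a) - 1) ^ DIM('a) * J powr (DIM('a) / (DIM('a) - 1))))"

lemma eroot_ennreal_powr:
  assumes "a \<ge> 0" "n > 0"
  shows "eroot n (ennreal a) ^ Suc n = ennreal (a powr (Suc n / n))"
proof -
  have "eroot n (ennreal a) = ennreal (a powr (1 / n))"
    using assms by (cases "a = 0") (simp_all add: eroot_def root_powr_inverse)
  then have "eroot n (ennreal a) ^ Suc n = ennreal ((a powr (1 / n)) ^ Suc n)"
    by (simp add: ennreal_power del: power_Suc)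
  also have "(a powr (1 / n)) ^ Suc n = a powr (Suc n / n)"
    using assms by (cases "a = 0") (auto simp: powr_realpow[symmetric] powr_powr add_divide_distrib powr_add)
  finally show ?thesis .
qed

text \<open>|v|^(N/(N-1)) is a product of N copies of |v|^(1/(N-1)), one for each coordinate
  direction, and along each of them |v| is at most the line integral of the common majorant
  \<open>H\<close>. Loomis-Whitney integrates this product.\<close>

lemma sob_bound_C1:
  fixes v H :: "'a::euclidean_space \<Rightarrow> real" and vb :: "'a \<Rightarrow> 'a \<Rightarrow> real"
  assumes der: "\<And>b x t. b \<in> Basis \<Longrightarrow> ((\<lambda>t. v (x + t *\<^sub>R b)) has_real_derivative vb b (x + t *\<^sub>R b)) (at t)"
    and cont: "\<And>b. b \<in> Basis \<Longrightarrow> continuous_on UNIV (vb b)"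
    and supp: "\<And>x. R < norm x \<Longrightarrow> v x = 0"
    and H: "\<And>b x. b \<in> Basis \<Longrightarrow> \<bar>vb b x\<bar> \<le> H x" "(\<integral>\<^sup>+x. ennreal (H x) \<partial>lborel) \<le> ennreal J" "J \<ge> 0"
    and [measurable]: "H \<in> borel_measurable borel"
  shows "sob_bound v J"
proof -
  have le: "ennreal \<bar>v x\<bar> \<le> line_int b (\<lambda>y. ennreal (H y)) x" if "b \<in> Basis" for b x
  proof -
    have "ennreal \<bar>v x\<bar> \<le> line_int b (\<lambda>y. ennreal \<bar>vb b y\<bar>) x"
      using that by (intro abs_le_line_int[OF der cont supp]) auto
    also have "\<dots> \<le> line_int b (\<lambda>y. ennreal (H y)) x"
      using that H by (intro line_int_mono ennreal_leI) auto
    finally show ?thesis .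
  qed
  show ?thesis
  proof (cases "DIM('a) = 1")
    case True
    then obtain b :: 'a where b: "Basis = {b}" using card_1_singletonE by blast
    have "ennreal \<bar>v x\<bar> \<le> ennreal J" for x
    proof -
      have "ennreal \<bar>v x\<bar> \<le> foldr line_int [b] (\<lambda>y. ennreal (H y)) x" using le[of b x] by (simp add: b)
      also have "\<dots> = (\<integral>\<^sup>+x. ennreal (H x) \<partial>lborel)" by (rule foldr_line_int_Basis) (auto simp: b)
      finally show ?thesis using H by order
    qed
    then show ?thesis using True H(3) by (simp add: sob_bound_def)
  next
    case False
    define n where "n = DIM('a) - 1"
    have n: "DIM('a) = Suc n" "n > 0" using False DIM_positive[where 'a='a] unfolding n_def by linarith+
    have "(\<integral>\<^sup>+x. ennreal (\<bar>v x\<bar> powr (Suc n / n)) \<partial>lborel)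
        \<le> (\<integral>\<^sup>+x. (\<Prod>b\<in>Basis. eroot n (line_int b (\<lambda>y. ennreal (H y)) x)) \<partial>lborel)"
    proof (intro nn_integral_mono)
      fix x
      have "ennreal (\<bar>v x\<bar> powr (Suc n / n)) = (\<Prod>b\<in>(Basis::'a set). eroot n (ennreal \<bar>v x\<bar>))"
        by (simp only: prod_constant n(1) eroot_ennreal_powr[OF abs_ge_zero n(2)])
      also have "\<dots> \<le> (\<Prod>b\<in>Basis. eroot n (line_int b (\<lambda>y. ennreal (H y)) x))"
        using n le by (intro prod_mono_ennreal eroot_mono) auto
      finally show "ennreal (\<bar>v x\<bar> powr (Suc n / n)) \<le> (\<Prod>b\<in>Basis. eroot n (line_int b (\<lambda>y. ennreal (H y)) x))" .
    qed
    also have "\<dots> \<le> of_nat n ^ Suc n * (\<Prod>b\<in>(Basis::'a set). eroot n (\<integral>\<^sup>+x. ennreal (H x) \<partial>lborel))"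
      by (rule loomis_whitney[OF n]) measurable
    also have "\<dots> \<le> of_nat n ^ Suc n * (\<Prod>b\<in>(Basis::'a set). eroot n (ennreal J))"
      using n H by (intro mult_left_mono prod_mono_ennreal eroot_mono) auto
    also have "\<dots> = of_nat n ^ Suc n * ennreal (J powr (Suc n / n))"
      by (simp only: prod_constant n(1) eroot_ennreal_powr[OF H(3) n(2)])
    also have "\<dots> = ennreal (n ^ Suc n * J powr (Suc n / n))"
      by (simp add: ennreal_mult ennreal_of_nat_eq_real_of_nat ennreal_power)
    finally show ?thesis using n by (simp add: sob_bound_def)
  qed
qed

text \<open>Fatou's lemma in dimension at least two. In dimension one the pointwise bounds pass to
  the limit off a countable union of null sets.\<close>

lemma sob_bound_limit:
  fixes v :: "'a::euclidean_space \<Rightarrow> real" and w :: "nat \<Rightarrow> 'a \<Rightarrow> real"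
  assumes ev: "eventually (\<lambda>k. sob_bound (w k) J) sequentially"
    and lim: "AE x in lborel. (\<lambda>k. w k x) \<longlonglongrightarrow> v x"
    and [measurable]: "\<And>k. w k \<in> borel_measurable borel"
  shows "sob_bound v J"
proof -
  obtain k0 where k0: "\<And>k. sob_bound (w (k + k0)) J"
    using ev unfolding eventually_sequentially by (metis le_add2)
  have lim': "AE x in lborel. (\<lambda>k. w (k + k0) x) \<longlonglongrightarrow> v x"
    using lim by eventually_elim (rule LIMSEQ_ignore_initial_segment)
  show ?thesis
  proof (cases "DIM('a) = 1")
    case True
    have "AE x in lborel. \<forall>k. \<bar>w (k + k0) x\<bar> \<le> J"
      using k0 True by (simp add: sob_bound_def AE_all_countable)
    with lim' have "AE x in lborel. \<bar>v x\<bar> \<le> J"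
      by eventually_elim (intro LIMSEQ_le_const2[OF tendsto_rabs], auto)
    then show ?thesis using True by (simp add: sob_bound_def)
  next
    case False
    define \<kappa> where "\<kappa> = DIM('a) / (DIM('a) - 1)"
    have "\<kappa> > 0" using False DIM_positive[where 'a='a] by (simp add: \<kappa>_def Suc_lessI)
    have "AE x in lborel. (\<lambda>k. ennreal (\<bar>w (k + k0) x\<bar> powr \<kappa>)) \<longlonglongrightarrow> ennreal (\<bar>v x\<bar> powr \<kappa>)"
      using lim' by eventually_elim (use \<open>\<kappa> > 0\<close> in \<open>intro tendsto_ennrealI tendsto_powr' tendsto_rabs tendsto_const, auto\<close>)
    then have "AE x in lborel. ennreal (\<bar>v x\<bar> powr \<kappa>) = liminf (\<lambda>k. ennreal (\<bar>w (k + k0) x\<bar> powr \<kappa>))"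
      by eventually_elim (rule lim_imp_Liminf[OF sequentially_bot, symmetric])
    then have "(\<integral>\<^sup>+x. ennreal (\<bar>v x\<bar> powr \<kappa>) \<partial>lborel) = (\<integral>\<^sup>+x. liminf (\<lambda>k. ennreal (\<bar>w (k + k0) x\<bar> powr \<kappa>)) \<partial>lborel)"
      by (rule nn_integral_cong_AE)
    also have "\<dots> \<le> liminf (\<lambda>k. \<integral>\<^sup>+x. ennreal (\<bar>w (k + k0) x\<bar> powr \<kappa>) \<partial>lborel)"
      by (rule nn_integral_liminf) measurable
    also have "\<dots> \<le> liminf (\<lambda>k. ennreal ((DIM('a) - 1) ^ DIM('a) * J powr \<kappa>))"
      using k0 False by (intro Liminf_mono always_eventually) (auto simp: sob_bound_def \<kappa>_def)
    also have "\<dots> = ennreal ((DIM('a) - 1) ^ DIM('a) * J powr \<kappa>)"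
      by (simp add: Liminf_const)
    finally show ?thesis using False by (simp add: sob_bound_def \<kappa>_def)
  qed
qed

section \<open>Regularising a weakly differentiable function\<close>

definition mollifier :: "real \<Rightarrow> ('a::euclidean_space \<Rightarrow> real) \<Rightarrow> bool" where
  "mollifier \<delta> \<rho> \<longleftrightarrow> Cinf_on UNIV \<rho> \<and> (\<forall>x. \<rho> x \<ge> 0) \<and> (\<forall>x. \<rho> x \<noteq> 0 \<longrightarrow> norm x \<le> \<delta>)
     \<and> integrable lborel \<rho> \<and> (\<integral>x. \<rho> x \<partial>lborel) = 1"

lemma bounded_of_compact_support:
  fixes h :: "'a::euclidean_space \<Rightarrow> real"
  assumes "continuous_on UNIV h" "\<And>x. \<delta> < norm x \<Longrightarrow> h x = 0"
  shows "\<exists>M. \<forall>x. \<bar>h x\<bar> \<le> M"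
proof -
  have "compact (h ` cball 0 \<delta>)"
    using assms(1) continuous_on_subset by (intro compact_continuous_image) auto
  then obtain M where M: "\<And>x. x \<in> cball 0 \<delta> \<Longrightarrow> \<bar>h x\<bar> \<le> M"
    using compact_imp_bounded bounded_iff by (metis imageI real_norm_def)
  have "\<bar>h x\<bar> \<le> max M 0" for x
  proof (cases "norm x \<le> \<delta>")
    case True
    then show ?thesis using M[of x] by simp
  next
    case False
    then show ?thesis using assms(2)[of x] by simp
  qed
  then show ?thesis by blast
qed

lemma has_derivative_zero_outside:
  fixes F :: "'a::euclidean_space \<Rightarrow> real"
  assumes "(F has_derivative F') (at x)" "\<And>x. R < norm x \<Longrightarrow> F x = 0" "R < norm x"
  shows "F' = (\<lambda>v. 0)"
proof -
  have "open {x::'a. R < norm x}" by (intro open_Collect_less continuous_intros)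
  then have "(F has_derivative (\<lambda>v. 0)) (at x)"
    by (rule has_derivative_transform_within_open[OF has_derivative_const[of 0]]) (simp_all add: assms)
  then show ?thesis using assms(1) has_derivative_unique by blast
qed

lemma mollifier_derivative:
  assumes "mollifier \<delta> (\<rho> :: 'a::euclidean_space \<Rightarrow> real)"
  shows "continuous_on UNIV \<rho> \<and> (\<exists>M. \<forall>x. \<bar>\<rho> x\<bar> \<le> M) \<and>
    (\<exists>\<rho>'. (\<forall>x. (\<rho> has_derivative \<rho>' x) (at x)) \<and> (\<forall>b. continuous_on UNIV (\<lambda>x. \<rho>' x b)) \<and>
     (\<forall>x b. \<delta> < norm x \<longrightarrow> \<rho>' x b = 0) \<and> (\<forall>b. \<exists>M. \<forall>x. \<bar>\<rho>' x b\<bar> \<le> M))"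
proof -
  have C: "Cinf_on UNIV \<rho>" and supp: "\<And>x. \<delta> < norm x \<Longrightarrow> \<rho> x = 0"
    using assms unfolding mollifier_def by force+
  have "Ck_on 0 UNIV \<rho>" using C unfolding Cinf_on_def by blast
  then have cont: "continuous_on UNIV \<rho>" by simp
  obtain \<rho>' where \<rho>': "\<And>x. (\<rho> has_derivative \<rho>' x) (at x)" "\<And>v. continuous_on UNIV (\<lambda>x. \<rho>' x v)"
    using Cinf_on_has_continuous_derivative[OF C] by blast
  have "\<rho>' x b = 0" if "\<delta> < norm x" for x b
    using has_derivative_zero_outside[OF \<rho>'(1) supp that] by simp
  then have "\<forall>x b. \<delta> < norm x \<longrightarrow> \<rho>' x b = 0" "\<forall>b. \<exists>M. \<forall>x. \<bar>\<rho>' x b\<bar> \<le> M"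
    using bounded_of_compact_support[OF \<rho>'(2)] by blast+
  then show ?thesis
    using cont \<rho>' bounded_of_compact_support[OF cont supp] by blast
qed

text \<open>A finite set is treated at once so that one kernel serves a function together with all
  its weak partial derivatives.\<close>

lemma mollifier_approx:
  fixes F :: "('a::euclidean_space \<Rightarrow> real) set"
  assumes "finite F" "\<And>f. f \<in> F \<Longrightarrow> integrable lborel f" "0 < e" "0 < r"
  shows "\<exists>\<delta> \<rho>. mollifier \<delta> \<rho> \<and> \<delta> < r \<and>
     (\<forall>f\<in>F. (\<integral>\<^sup>+x. ennreal \<bar>conv f \<rho> x - f x\<bar> \<partial>lborel) \<le> ennreal e)"
proof -
  have "eventually (\<lambda>w. \<forall>f\<in>F. transl_diff f w < ennreal e) (at 0)"
    using assms by (intro eventually_ball_finite ballI order_tendstoD(2)[OF transl_diff_tendsto_0]) auto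
  then obtain d where d: "d > 0" "\<And>w f. w \<noteq> 0 \<Longrightarrow> norm w < d \<Longrightarrow> f \<in> F \<Longrightarrow> transl_diff f w < ennreal e"
    unfolding eventually_at by (auto simp: dist_norm)
  define \<delta> where "\<delta> = min d r / 2"
  have \<delta>: "0 < \<delta>" "\<delta> < d" "\<delta> < r" using d assms by (auto simp: \<delta>_def)
  obtain \<rho> :: "'a \<Rightarrow> real" where \<rho>: "mollifier \<delta> \<rho>"
    using mollifier_exists[OF \<delta>(1)] unfolding mollifier_def by blast
  obtain M where M: "continuous_on UNIV \<rho>" "\<And>x. \<bar>\<rho> x\<bar> \<le> M" using mollifier_derivative[OF \<rho>] by blast
  have "(\<integral>\<^sup>+x. ennreal \<bar>conv f \<rho> x - f x\<bar> \<partial>lborel) \<le> ennreal e" if "f \<in> F" for f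
  proof (rule nn_integral_conv_diff_le[OF assms(2)[OF that] M])
    fix w assume "\<rho> w \<noteq> 0"
    then have "norm w \<le> \<delta>" using \<rho> by (auto simp: mollifier_def)
    show "transl_diff f (- w) \<le> ennreal e"
    proof (cases "w = 0")
      case True
      then show ?thesis by (simp add: transl_diff_def)
    next
      case False
      then show ?thesis using d(2)[of "- w" f] that \<open>norm w \<le> \<delta>\<close> \<delta> by auto
    qed
  qed (use \<rho> in \<open>auto simp: mollifier_def\<close>)
  then show ?thesis using \<rho> \<delta> by blast
qed

definition annulus :: "real \<Rightarrow> real \<Rightarrow> 'a::euclidean_space set" where
  "annulus r R = {x. r \<le> norm x \<and> norm x \<le> R}"

lemma annulus_borel [measurable]: "annulus r R \<in> sets borel"
  unfolding annulus_def by measurable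

text \<open>The counterpart of \<open>weak_grad_punct\<close> for Borel representatives.\<close>
definition wgrad :: "('a::euclidean_space \<Rightarrow> real) \<Rightarrow> ('a \<Rightarrow> 'a) \<Rightarrow> bool" where
  "wgrad u g \<longleftrightarrow> u \<in> borel_measurable borel \<and> g \<in> borel_measurable borel \<and>
     (\<forall>r R. 0 < r \<longrightarrow> integrable lborel (\<lambda>x. indicator (annulus r R) x * u x)) \<and>
     (\<forall>r R. \<forall>i\<in>Basis. 0 < r \<longrightarrow> integrable lborel (\<lambda>x. indicator (annulus r R) x * (g x \<bullet> i))) \<and>
     (\<forall>\<phi>. test_fun_punct \<phi> \<longrightarrow> (\<forall>i\<in>Basis.
        (\<integral>x. u x * frechet_derivative \<phi> (at x) i \<partial>lborel) = - (\<integral>x. (g x \<bullet> i) * \<phi> x \<partial>lborel)))"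

text \<open>The weak formulation is tested with y \<mapsto> \<rho>(z - y). As \<open>u\<close> is
  integrable only away from 0, it is cut off to an annulus wider than the one containing
  \<open>z\<close>; the kernel has radius below r/2 and never sees the cut.\<close>

lemma conv_weak_derivative:
  fixes u :: "'a::euclidean_space \<Rightarrow> real"
  assumes W: "wgrad u g" and \<rho>: "mollifier \<delta> \<rho>" "\<And>x. (\<rho> has_derivative \<rho>' x) (at x)"
    and \<rho>'0: "\<And>x b. \<delta> < norm x \<Longrightarrow> \<rho>' x b = 0"
    and r: "0 < r" "\<delta> < r / 2" and z: "r \<le> norm z" "norm z \<le> R" and b: "b \<in> Basis"
  shows "conv (\<lambda>x. indicator (annulus (r / 2) (R + r)) x * u x) (\<lambda>x. \<rho>' x b) z
       = conv (\<lambda>x. indicator (annulus (r / 2) (R + r)) x * (g x \<bullet> b)) \<rho> z"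
proof -
  have supp: "\<And>x. \<rho> x \<noteq> 0 \<Longrightarrow> norm x \<le> \<delta>" and C: "Cinf_on UNIV \<rho>" using \<rho> by (auto simp: mollifier_def)
  have far: "\<delta> < norm (z - y)" if "y \<notin> annulus (r / 2) (R + r)" for y
    using that norm_triangle_ineq2[of z y] norm_triangle_ineq2[of y z] r z
    by (auto simp: annulus_def norm_minus_commute not_le)
  have "test_fun_punct (\<lambda>y. \<rho> (z - y))"
    using r z by (intro test_fun_punct_reflect[OF C, of \<delta>] supp) auto
  then have *: "(\<integral>y. u y * frechet_derivative (\<lambda>y. \<rho> (z - y)) (at y) b \<partial>lborel) = - (\<integral>y. (g y \<bullet> b) * \<rho> (z - y) \<partial>lborel)"
    using W b unfolding wgrad_def by blast
  have fd: "frechet_derivative (\<lambda>y. \<rho> (z - y)) (at y) b = - \<rho>' (z - y) b" for y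
  proof -
    have "((\<lambda>y. \<rho> (z - y)) has_derivative (\<lambda>v. \<rho>' (z - y) (- v))) (at y)"
      by (rule has_derivative_compose[of "\<lambda>y. z - y" "\<lambda>v. - v" y UNIV \<rho> "\<rho>' (z - y)"])
        (auto intro!: derivative_eq_intros \<rho>)
    then have "frechet_derivative (\<lambda>y. \<rho> (z - y)) (at y) b = \<rho>' (z - y) (- b)"
      by (simp add: frechet_derivative_at[symmetric])
    then show ?thesis using linear_neg[OF has_derivative_linear[OF \<rho>(2)]] by simp
  qed
  have "(\<integral>y. u y * \<rho>' (z - y) b \<partial>lborel) = (\<integral>y. (g y \<bullet> b) * \<rho> (z - y) \<partial>lborel)"
    using * unfolding fd by simp
  moreover have "conv (\<lambda>x. indicator (annulus (r / 2) (R + r)) x * u x) (\<lambda>x. \<rho>' x b) z = (\<integral>y. u y * \<rho>' (z - y) b \<partial>lborel)"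
    unfolding conv_def by (intro Bochner_Integration.integral_cong refl) (use far \<rho>'0 in \<open>force simp: indicator_def\<close>)
  moreover have "conv (\<lambda>x. indicator (annulus (r / 2) (R + r)) x * (g x \<bullet> b)) \<rho> z = (\<integral>y. (g y \<bullet> b) * \<rho> (z - y) \<partial>lborel)"
    unfolding conv_def by (intro Bochner_Integration.integral_cong refl) (use far supp in \<open>force simp: indicator_def\<close>)
  ultimately show ?thesis by simp
qed

text \<open>The smooth bound is applied to \<zeta> \<Phi>(U_k) with U_k a mollification of the
  cut-off \<open>u\<close>, where the classical chain rule is available. The bounds \<open>B\<close>
  and \<open>Z\<close> serve as majorants only and do not enter the conclusion.\<close>

lemma sob_bound_weak:
  fixes u :: "'a::euclidean_space \<Rightarrow> real"
  assumes W: "wgrad u g"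
    and \<Phi>: "\<And>t. (\<Phi> has_real_derivative \<Phi>' t) (at t)" "continuous_on UNIV \<Phi>'" "\<And>t. 0 \<le> \<Phi> t" "\<And>t. \<Phi> t \<le> B" "\<And>t. \<bar>\<Phi>' t\<bar> \<le> B"
    and \<zeta>: "\<And>x. (\<zeta> has_derivative \<zeta>' x) (at x)" "\<And>b. continuous_on UNIV (\<lambda>x. \<zeta>' x b)"
      "\<And>x. 0 \<le> \<zeta> x" "\<And>x. \<zeta> x \<le> Z" "\<And>x b. b \<in> Basis \<Longrightarrow> \<bar>\<zeta>' x b\<bar> \<le> Zd x" "\<And>x. Zd x \<le> Z"
    and supp: "0 < r" "\<And>x. \<zeta> x \<noteq> 0 \<Longrightarrow> x \<in> annulus r R" "\<And>x. Zd x \<noteq> 0 \<Longrightarrow> x \<in> annulus r R"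
    and [measurable]: "Zd \<in> borel_measurable borel"
    and J: "(\<integral>\<^sup>+x. ennreal (\<zeta> x * \<bar>\<Phi>' (u x)\<bar> * (\<Sum>b\<in>Basis. \<bar>g x \<bullet> b\<bar>) + Zd x * \<Phi> (u x)) \<partial>lborel) < ennreal J"
  shows "sob_bound (\<lambda>x. \<zeta> x * \<Phi> (u x)) J"
proof -
  define A :: "'a set" where "A = annulus (r / 2) (R + r)"
  have A[measurable]: "A \<in> sets borel" by (simp add: A_def)
  have AA: "x \<in> annulus r R \<Longrightarrow> x \<in> A" for x using supp(1) by (auto simp: A_def annulus_def)
  define f where "f x = indicator A x * u x" for x
  define fb where "fb b x = indicator A x * (g x \<bullet> b)" for b x
  have [measurable]: "u \<in> borel_measurable borel" "g \<in> borel_measurable borel" using W by (auto simp: wgrad_def)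
  have f: "integrable lborel f" using W supp(1) by (auto simp: wgrad_def f_def[abs_def] A_def)
  have fb: "integrable lborel (fb b)" if "b \<in> Basis" for b
    using W supp(1) that by (auto simp: wgrad_def fb_def[abs_def] A_def)
  have [measurable]: "f \<in> borel_measurable borel" "fb b \<in> borel_measurable borel" for b
    unfolding f_def fb_def[abs_def] by measurable
  have contz: "continuous_on UNIV \<zeta>" by (intro continuous_at_imp_continuous_on ballI has_derivative_continuous[OF \<zeta>(1)])
  have contP: "continuous_on UNIV \<Phi>" by (intro continuous_at_imp_continuous_on ballI DERIV_isCont[OF \<Phi>(1)])
  have [measurable]: "\<zeta> \<in> borel_measurable borel" "\<Phi> \<in> borel_measurable borel" "\<Phi>' \<in> borel_measurable borel"
    using contz contP \<Phi>(2) by (auto intro: borel_measurable_continuous_onI)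
  have Zd0: "0 \<le> Zd x" for x using \<zeta>(5)[OF SOME_Basis, of x] by linarith
  have B0: "0 \<le> B" using \<Phi>(3,4)[of 0] by linarith
  have Z0: "0 \<le> Z" using \<zeta>(3,4)[of 0] by linarith
  have J0: "0 < J" using J le_less_trans[OF zero_le J] by simp
  have "\<forall>k. \<exists>\<delta> \<rho>. mollifier \<delta> \<rho> \<and> \<delta> < r / 2 \<and>
     (\<forall>f\<in>insert f (fb ` Basis). (\<integral>\<^sup>+x. ennreal \<bar>conv f \<rho> x - f x\<bar> \<partial>lborel) \<le> ennreal (1 / Suc k))"
    using f fb supp(1) by (intro allI mollifier_approx) auto
  from choice[OF this] obtain \<delta> where "\<forall>k. \<exists>\<rho>. mollifier (\<delta> k) \<rho> \<and> \<delta> k < r / 2 \<and>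
     (\<forall>f\<in>insert f (fb ` Basis). (\<integral>\<^sup>+x. ennreal \<bar>conv f \<rho> x - f x\<bar> \<partial>lborel) \<le> ennreal (1 / Suc k))"
    by blast
  from choice[OF this] obtain \<rho> where \<rho>: "\<And>k. mollifier (\<delta> k) (\<rho> k) \<and> \<delta> k < r / 2 \<and>
     (\<forall>f\<in>insert f (fb ` Basis). (\<integral>\<^sup>+x. ennreal \<bar>conv f (\<rho> k) x - f x\<bar> \<partial>lborel) \<le> ennreal (1 / Suc k))"
    by blast
  have m: "\<And>k. mollifier (\<delta> k) (\<rho> k)" "\<And>k. \<delta> k < r / 2"
    and ap: "\<And>k. (\<integral>\<^sup>+x. ennreal \<bar>conv f (\<rho> k) x - f x\<bar> \<partial>lborel) \<le> ennreal (1 / Suc k)"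
      "\<And>k b. b \<in> Basis \<Longrightarrow> (\<integral>\<^sup>+x. ennreal \<bar>conv (fb b) (\<rho> k) x - fb b x\<bar> \<partial>lborel) \<le> ennreal (1 / Suc k)"
    using \<rho> by blast+
  have "\<forall>k. \<exists>\<rho>'. continuous_on UNIV (\<rho> k) \<and> (\<exists>M. \<forall>x. \<bar>\<rho> k x\<bar> \<le> M) \<and>
    ((\<forall>x. (\<rho> k has_derivative \<rho>' x) (at x)) \<and> (\<forall>b. continuous_on UNIV (\<lambda>x. \<rho>' x b)) \<and>
     (\<forall>x b. \<delta> k < norm x \<longrightarrow> \<rho>' x b = 0) \<and> (\<forall>b. \<exists>M. \<forall>x. \<bar>\<rho>' x b\<bar> \<le> M))"
    using mollifier_derivative[OF m(1)] by blast
  from choice[OF this] obtain \<rho>' where contr: "\<And>k. continuous_on UNIV (\<rho> k)" and bdr: "\<And>k. \<exists>M. \<forall>x. \<bar>\<rho> k x\<bar> \<le> M"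
    and \<rho>': "\<And>k x. (\<rho> k has_derivative \<rho>' k x) (at x)" "\<And>k b. continuous_on UNIV (\<lambda>x. \<rho>' k x b)"
     "\<And>k x b. \<delta> k < norm x \<Longrightarrow> \<rho>' k x b = 0" "\<And>k b. \<exists>M. \<forall>x. \<bar>\<rho>' k x b\<bar> \<le> M"
    by blast
  define U where "U k = conv f (\<rho> k)" for k
  define w where "w k b = conv (fb b) (\<rho> k)" for k b
  have contU: "continuous_on UNIV (U k)" for k
    using continuous_conv[OF f contr] bdr[of k] unfolding U_def by blast
  have contw: "continuous_on UNIV (w k b)" if "b \<in> Basis" for k b
    using continuous_conv[OF fb[OF that] contr] bdr[of k] unfolding w_def by blast
  have contU': "continuous_on UNIV (conv f (\<lambda>x. \<rho>' k x b))" for k b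
    using continuous_conv[OF f \<rho>'(2)] \<rho>'(4)[of k b] by blast
  have [measurable]: "U k \<in> borel_measurable borel" for k
    using contU by (rule borel_measurable_continuous_onI)
  have [measurable]: "b \<in> Basis \<Longrightarrow> w k b \<in> borel_measurable borel" for k b
    using contw by (rule borel_measurable_continuous_onI)
  \<comment> \<open>\<open>P\<close> keeps the gradient unmollified, so that a fixed integrable
    function dominates it for all k; \<open>Q\<close> is the price, and it tends to zero because the
    mollified partials converge in L^1.\<close>
  define P where "P k x = \<zeta> x * \<bar>\<Phi>' (U k x)\<bar> * (\<Sum>b\<in>Basis. \<bar>fb b x\<bar>) + Zd x * \<Phi> (U k x)" for k x
  define Q where "Q k x = Z * B * (\<Sum>b\<in>Basis. \<bar>w k b x - fb b x\<bar>)" for k x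
  have [measurable]: "P k \<in> borel_measurable borel" "Q k \<in> borel_measurable borel" for k
    unfolding P_def[abs_def] Q_def[abs_def] by measurable
  have P0: "0 \<le> P k x" for k x unfolding P_def using \<zeta>(3) Zd0 \<Phi>(3) by (intro add_nonneg_nonneg mult_nonneg_nonneg sum_nonneg) auto
  have Q0: "0 \<le> Q k x" for k x unfolding Q_def using Z0 B0 by (intro mult_nonneg_nonneg sum_nonneg) auto
  have sob: "sob_bound (\<lambda>x. \<zeta> x * \<Phi> (U k x)) J"
    if k: "(\<integral>\<^sup>+x. ennreal (P k x) \<partial>lborel) + (\<integral>\<^sup>+x. ennreal (Q k x) \<partial>lborel) < ennreal J" for k
  proof (rule sob_bound_C1[where R=R and H="\<lambda>x. P k x + Q k x" and
        vb="\<lambda>b x. \<zeta>' x b * \<Phi> (U k x) + \<zeta> x * (\<Phi>' (U k x) * conv f (\<lambda>x. \<rho>' k x b) x)"])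
    fix b x t assume b: "b \<in> (Basis :: 'a set)"
    obtain M0 M where "\<And>x. \<bar>\<rho> k x\<bar> \<le> M0" "\<And>x. \<bar>\<rho>' k x b\<bar> \<le> M" using bdr \<rho>'(4) by metis
    then have dU: "((\<lambda>t. U k (x + t *\<^sub>R b)) has_real_derivative conv f (\<lambda>x. \<rho>' k x b) (x + t *\<^sub>R b)) (at t)"
      unfolding U_def by (intro has_real_derivative_conv[OF f contr _ \<rho>'(1,2)]) auto
    have dz: "((\<lambda>t. \<zeta> (x + t *\<^sub>R b)) has_real_derivative \<zeta>' (x + t *\<^sub>R b) b) (at t)"
    proof -
      have "((\<lambda>s. x + s *\<^sub>R b) has_derivative (\<lambda>s. s *\<^sub>R b)) (at t)"
        by (auto intro!: derivative_eq_intros)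
      from has_derivative_compose[OF this \<zeta>(1)]
      have "((\<lambda>s. \<zeta> (x + s *\<^sub>R b)) has_derivative (\<lambda>s. \<zeta>' (x + t *\<^sub>R b) (s *\<^sub>R b))) (at t)" .
      moreover have "\<zeta>' (x + t *\<^sub>R b) (s *\<^sub>R b) = \<zeta>' (x + t *\<^sub>R b) b * s" for s
        using linear_scale[OF has_derivative_linear[OF \<zeta>(1)]] by (simp add: mult.commute)
      ultimately show ?thesis by (simp add: has_field_derivative_def mult_commute_abs)
    qed
    from DERIV_mult[OF dz DERIV_chain2[OF \<Phi>(1) dU]]
    show "((\<lambda>t. \<zeta> (x + t *\<^sub>R b) * \<Phi> (U k (x + t *\<^sub>R b))) has_real_derivative
        \<zeta>' (x + t *\<^sub>R b) b * \<Phi> (U k (x + t *\<^sub>R b)) + \<zeta> (x + t *\<^sub>R b) *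
          (\<Phi>' (U k (x + t *\<^sub>R b)) * conv f (\<lambda>x. \<rho>' k x b) (x + t *\<^sub>R b))) (at t)"
      by (rule DERIV_cong) (simp add: algebra_simps)
  next
    fix b :: 'a
    show "continuous_on UNIV (\<lambda>x. \<zeta>' x b * \<Phi> (U k x) + \<zeta> x * (\<Phi>' (U k x) * conv f (\<lambda>x. \<rho>' k x b) x))"
      by (intro continuous_intros \<zeta>(2) contz contU' continuous_on_compose2[OF contP contU] continuous_on_compose2[OF \<Phi>(2) contU]) auto
  next
    fix x :: 'a assume "R < norm x"
    then show "\<zeta> x * \<Phi> (U k x) = 0" using supp(2)[of x] by (auto simp: annulus_def)
  next
    fix b x assume b: "b \<in> (Basis :: 'a set)"
    have 1: "\<bar>\<zeta>' x b * \<Phi> (U k x)\<bar> \<le> Zd x * \<Phi> (U k x)"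
      using \<zeta>(5)[OF b, of x] \<Phi>(3) by (simp add: abs_mult mult_right_mono)
    have 2: "\<bar>\<zeta> x * (\<Phi>' (U k x) * conv f (\<lambda>x. \<rho>' k x b) x)\<bar>
        \<le> \<zeta> x * \<bar>\<Phi>' (U k x)\<bar> * (\<Sum>b\<in>Basis. \<bar>fb b x\<bar>) + Q k x"
    proof (cases "\<zeta> x = 0")
      case True
      then show ?thesis using Q0 by simp
    next
      case False
      then have "r \<le> norm x" "norm x \<le> R" using supp(2) by (auto simp: annulus_def)
      then have eq: "conv f (\<lambda>x. \<rho>' k x b) x = w k b x"
        using conv_weak_derivative[OF W m(1)[of k] \<rho>'(1)[where k=k] \<rho>'(3)[where k=k] supp(1) m(2)[of k] \<open>r \<le> norm x\<close> \<open>norm x \<le> R\<close> b]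
        unfolding w_def f_def fb_def A_def by simp
      have "\<bar>\<zeta> x * (\<Phi>' (U k x) * w k b x)\<bar> \<le> \<zeta> x * \<bar>\<Phi>' (U k x)\<bar> * \<bar>fb b x\<bar> + \<zeta> x * \<bar>\<Phi>' (U k x)\<bar> * \<bar>w k b x - fb b x\<bar>"
        using \<zeta>(3)[of x] by (simp add: abs_mult mult.assoc distrib_left[symmetric] mult_left_mono)
      also have "\<dots> \<le> \<zeta> x * \<bar>\<Phi>' (U k x)\<bar> * (\<Sum>b\<in>Basis. \<bar>fb b x\<bar>) + Q k x"
        unfolding Q_def using \<zeta>(3)[of x] Z0 B0 \<zeta>(4) \<Phi>(5) b
        by (intro add_mono mult_mono member_le_sum[of b Basis "\<lambda>b. \<bar>fb b x\<bar>"] member_le_sum[of b Basis "\<lambda>b. \<bar>w k b x - fb b x\<bar>"]) auto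
      finally show ?thesis unfolding eq .
    qed
    show "\<bar>\<zeta>' x b * \<Phi> (U k x) + \<zeta> x * (\<Phi>' (U k x) * conv f (\<lambda>x. \<rho>' k x b) x)\<bar> \<le> P k x + Q k x"
      using 1 2 unfolding P_def by linarith
  next
    have "(\<integral>\<^sup>+x. ennreal (P k x + Q k x) \<partial>lborel) = (\<integral>\<^sup>+x. ennreal (P k x) \<partial>lborel) + (\<integral>\<^sup>+x. ennreal (Q k x) \<partial>lborel)"
      using P0 Q0 by (simp add: ennreal_plus nn_integral_add)
    then show "(\<integral>\<^sup>+x. ennreal (P k x + Q k x) \<partial>lborel) \<le> ennreal J" using k by simp
  qed (use J0 in auto)
  have intU: "integrable lborel (\<lambda>x. U k x - f x)" for k
  proof (rule integrableI_bounded)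
    have "(\<integral>\<^sup>+x. ennreal (norm (U k x - f x)) \<partial>lborel) \<le> ennreal (1 / Suc k)" using ap(1)[of k] by (simp add: U_def)
    then show "(\<integral>\<^sup>+x. ennreal (norm (U k x - f x)) \<partial>lborel) < \<infinity>" using le_less_trans ennreal_less_top by fastforce
  qed measurable
  have "(\<lambda>k. \<integral>x. norm (U k x - f x) \<partial>lborel) \<longlonglongrightarrow> 0"
  proof (rule tendsto_sandwich[OF _ _ tendsto_const LIMSEQ_inverse_real_of_nat])
    show "eventually (\<lambda>k. (\<integral>x. norm (U k x - f x) \<partial>lborel) \<le> inverse (real (Suc k))) sequentially"
    proof (intro always_eventually allI)
      fix k
      have "ennreal (\<integral>x. norm (U k x - f x) \<partial>lborel) \<le> ennreal (1 / Suc k)"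
        using ap(1)[of k] intU[of k] by (subst nn_integral_eq_integral[symmetric]) (auto simp: U_def)
      then show "(\<integral>x. norm (U k x - f x) \<partial>lborel) \<le> inverse (real (Suc k))" by (simp add: divide_inverse del: of_nat_Suc)
    qed
  qed simp
  \<comment> \<open>L^1 convergence gives pointwise convergence only along a subsequence; all later
    limits run along it.\<close>
  from tendsto_L1_AE_subseq[OF intU this]
  obtain s where s: "strict_mono s" "AE x in lborel. (\<lambda>k. U (s k) x - f x) \<longlonglongrightarrow> 0" by blast
  have ae: "AE x in lborel. (\<lambda>k. U (s k) x) \<longlonglongrightarrow> f x"
    using s(2) by eventually_elim (simp add: LIM_zero_iff)
  have isC: "isCont \<Phi> t" "isCont \<Phi>' t" for t
    using contP \<Phi>(2) by (auto simp: continuous_on_eq_continuous_at)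
  have limP: "(\<lambda>k. \<integral>\<^sup>+x. ennreal (P (s k) x) \<partial>lborel) \<longlonglongrightarrow>
     (\<integral>\<^sup>+x. ennreal (\<zeta> x * \<bar>\<Phi>' (f x)\<bar> * (\<Sum>b\<in>Basis. \<bar>fb b x\<bar>) + Zd x * \<Phi> (f x)) \<partial>lborel)"
  proof (rule nn_integral_dominated_convergence[where w="\<lambda>x. ennreal (Z * B * (\<Sum>b\<in>Basis. \<bar>fb b x\<bar>) + Z * B * indicator A x)"])
    have "emeasure lborel A < \<infinity>"
    proof -
      have "emeasure lborel A \<le> emeasure lborel (cball (0::'a) (R + r))"
        by (intro emeasure_mono) (auto simp: A_def annulus_def)
      then show ?thesis using emeasure_lborel_cball_finite le_less_trans by blast
    qed
    then have "integrable lborel (indicator A :: 'a \<Rightarrow> real)" by (simp add: integrable_indicator_iff)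
    then have "integrable lborel (\<lambda>x. Z * B * (\<Sum>b\<in>Basis. \<bar>fb b x\<bar>) + Z * B * indicator A x)"
      using fb by (intro Bochner_Integration.integrable_add integrable_mult_right Bochner_Integration.integrable_sum integrable_abs) auto
    then show "(\<integral>\<^sup>+x. ennreal (Z * B * (\<Sum>b\<in>Basis. \<bar>fb b x\<bar>) + Z * B * indicator A x) \<partial>lborel) < \<infinity>"
      using Z0 B0 by (subst nn_integral_eq_integral) (auto intro!: sum_nonneg)
    show "AE x in lborel. (\<lambda>k. ennreal (P (s k) x)) \<longlonglongrightarrow> ennreal (\<zeta> x * \<bar>\<Phi>' (f x)\<bar> * (\<Sum>b\<in>Basis. \<bar>fb b x\<bar>) + Zd x * \<Phi> (f x))"
      using ae unfolding P_def
      by eventually_elim (intro tendsto_ennrealI tendsto_intros isCont_tendsto_compose[OF isC(1)] isCont_tendsto_compose[OF isC(2)])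
    show "AE x in lborel. ennreal (P (s k) x) \<le> ennreal (Z * B * (\<Sum>b\<in>Basis. \<bar>fb b x\<bar>) + Z * B * indicator A x)" for k
    proof (intro always_eventually allI ennreal_leI)
      fix x
      have "Zd x * \<Phi> (U (s k) x) \<le> Z * B * indicator A x"
      proof (cases "Zd x = 0")
        case False
        then have "x \<in> A" using supp(3) AA by blast
        then show ?thesis using \<zeta>(6) \<Phi>(3,4) Zd0 Z0 by (auto intro!: mult_mono)
      qed (use Z0 B0 in auto)
      moreover have "\<zeta> x * \<bar>\<Phi>' (U (s k) x)\<bar> * (\<Sum>b\<in>Basis. \<bar>fb b x\<bar>) \<le> Z * B * (\<Sum>b\<in>Basis. \<bar>fb b x\<bar>)"
        using \<zeta>(3,4) \<Phi>(5) Z0 B0 by (intro mult_right_mono mult_mono) (auto intro!: sum_nonneg)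
      ultimately show "P (s k) x \<le> Z * B * (\<Sum>b\<in>Basis. \<bar>fb b x\<bar>) + Z * B * indicator A x"
        unfolding P_def by linarith
    qed
  qed measurable
  have limQ: "(\<lambda>k. \<integral>\<^sup>+x. ennreal (Q (s k) x) \<partial>lborel) \<longlonglongrightarrow> 0"
  proof (rule tendsto_sandwich[OF _ _ tendsto_const])
    show "eventually (\<lambda>k. (\<integral>\<^sup>+x. ennreal (Q (s k) x) \<partial>lborel) \<le> ennreal (Z * B * DIM('a) * (1 / Suc (s k)))) sequentially"
    proof (intro always_eventually allI)
      fix k
      have "(\<integral>\<^sup>+x. ennreal (Q (s k) x) \<partial>lborel) = (\<integral>\<^sup>+x. ennreal (Z * B) * (\<Sum>b\<in>Basis. ennreal \<bar>w (s k) b x - fb b x\<bar>) \<partial>lborel)"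
        unfolding Q_def using Z0 B0 by (intro nn_integral_cong) (simp add: ennreal_mult sum_nonneg sum_ennreal)
      also have "\<dots> = ennreal (Z * B) * (\<Sum>b\<in>Basis. (\<integral>\<^sup>+x. ennreal \<bar>w (s k) b x - fb b x\<bar> \<partial>lborel))"
        by (subst nn_integral_cmult, measurable) (subst nn_integral_sum, auto)
      also have "\<dots> \<le> ennreal (Z * B) * (\<Sum>b\<in>(Basis::'a set). ennreal (1 / Suc (s k)))"
        using ap(2) unfolding w_def by (intro mult_left_mono sum_mono) auto
      also have "\<dots> = ennreal (Z * B * DIM('a) * (1 / Suc (s k)))"
        using Z0 B0 by (simp add: ennreal_of_nat_eq_real_of_nat ennreal_mult[symmetric] mult.assoc del: of_nat_Suc)
      finally show "(\<integral>\<^sup>+x. ennreal (Q (s k) x) \<partial>lborel) \<le> ennreal (Z * B * DIM('a) * (1 / Suc (s k)))" .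
    qed
    have "(\<lambda>k. ennreal (Z * B * DIM('a) * (1 / Suc (s k)))) \<longlonglongrightarrow> ennreal (Z * B * DIM('a) * 0)"
      using LIMSEQ_subseq_LIMSEQ[OF LIMSEQ_inverse_real_of_nat s(1)]
      by (intro tendsto_ennrealI tendsto_intros) (simp add: o_def divide_inverse)
    then show "(\<lambda>k. ennreal (Z * B * DIM('a) * (1 / Suc (s k)))) \<longlonglongrightarrow> 0" by simp
  qed simp
  have "(\<integral>\<^sup>+x. ennreal (\<zeta> x * \<bar>\<Phi>' (f x)\<bar> * (\<Sum>b\<in>Basis. \<bar>fb b x\<bar>) + Zd x * \<Phi> (f x)) \<partial>lborel)
     = (\<integral>\<^sup>+x. ennreal (\<zeta> x * \<bar>\<Phi>' (u x)\<bar> * (\<Sum>b\<in>Basis. \<bar>g x \<bullet> b\<bar>) + Zd x * \<Phi> (u x)) \<partial>lborel)"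
  proof (intro nn_integral_cong)
    fix x
    show "ennreal (\<zeta> x * \<bar>\<Phi>' (f x)\<bar> * (\<Sum>b\<in>Basis. \<bar>fb b x\<bar>) + Zd x * \<Phi> (f x))
       = ennreal (\<zeta> x * \<bar>\<Phi>' (u x)\<bar> * (\<Sum>b\<in>Basis. \<bar>g x \<bullet> b\<bar>) + Zd x * \<Phi> (u x))"
    proof (cases "x \<in> A")
      case True
      then show ?thesis by (simp add: f_def fb_def)
    next
      case False
      then have "\<zeta> x = 0" "Zd x = 0" using supp AA by blast+
      then show ?thesis by simp
    qed
  qed
  \<comment> \<open>The hypothesis on J is strict, so it survives for all late approximants although
    they only converge to the limit integrand.\<close>
  then have "eventually (\<lambda>k. (\<integral>\<^sup>+x. ennreal (P (s k) x) \<partial>lborel) + (\<integral>\<^sup>+x. ennreal (Q (s k) x) \<partial>lborel) < ennreal J) sequentially"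
    using order_tendstoD(2)[OF tendsto_add[OF limP limQ], of "ennreal J"] J by simp
  then have "eventually (\<lambda>k. sob_bound (\<lambda>x. \<zeta> x * \<Phi> (U (s k) x)) J) sequentially"
    by eventually_elim (rule sob)
  then show ?thesis
  proof (rule sob_bound_limit)
    show "AE x in lborel. (\<lambda>k. \<zeta> x * \<Phi> (U (s k) x)) \<longlonglongrightarrow> \<zeta> x * \<Phi> (u x)"
      using ae
    proof eventually_elim
      case (elim x)
      have "\<zeta> x * \<Phi> (f x) = \<zeta> x * \<Phi> (u x)"
        using supp(2)[of x] AA[of x] by (cases "x \<in> A") (auto simp: f_def)
      moreover have "(\<lambda>k. \<zeta> x * \<Phi> (U (s k) x)) \<longlonglongrightarrow> \<zeta> x * \<Phi> (f x)"
        by (intro tendsto_intros isCont_tendsto_compose[OF isC(1)] elim)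
      ultimately show ?case by (simp only:)
    qed
  qed measurable
qed

section \<open>Radial cutoffs\<close>

text \<open>A cutoff of class C^1 is enough for \<open>sob_bound_weak\<close>, and this explicit one
  has a derivative bounded by 4. The same profile reappears in both families of
  counterexamples.\<close>

definition chi :: "real \<Rightarrow> real" where "chi t = (max 0 (1 - t\<^sup>2))\<^sup>2"

definition chi' :: "real \<Rightarrow> real" where "chi' t = - 4 * t * max 0 (1 - t\<^sup>2)"

text \<open>Squaring removes the corner of the positive part. This is the only nonsmooth calculus in
  the cutoffs, the truncations and the bumps.\<close>

lemma has_real_derivative_max0_power2:
  "((\<lambda>s::real. (max 0 s)\<^sup>2) has_real_derivative 2 * max 0 s) (at s)"
proof -
  consider "s > 0" | "s < 0" | "s = 0" by linarith
  then show ?thesis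
  proof cases
    case 1
    have "((\<lambda>s::real. s\<^sup>2) has_real_derivative 2 * max 0 s) (at s)"
      using 1 by (auto intro!: derivative_eq_intros)
    then show ?thesis
      by (rule has_field_derivative_transform_within_open[of _ _ _ "{0<..}"]) (use 1 in auto)
  next
    case 2
    have "((\<lambda>s::real. 0) has_real_derivative 2 * max 0 s) (at s)"
      using 2 by (auto intro!: derivative_eq_intros)
    then show ?thesis
      by (rule has_field_derivative_transform_within_open[of _ _ _ "{..<0}"]) (use 2 in auto)
  next
    case 3
    have "((\<lambda>h::real. ((max 0 (0 + h))\<^sup>2 - (max 0 0)\<^sup>2) / h) \<longlongrightarrow> 0) (at 0)"
    proof (rule Lim_null_comparison)
      show "eventually (\<lambda>h::real. norm (((max 0 (0 + h))\<^sup>2 - (max 0 0)\<^sup>2) / h) \<le> \<bar>h\<bar>) (at 0)"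
        by (intro always_eventually) (auto simp: max_def power2_eq_square)
      show "((\<lambda>h::real. \<bar>h\<bar>) \<longlongrightarrow> 0) (at 0)"
        by (auto intro!: tendsto_eq_intros)
    qed
    then show ?thesis using 3 by (simp add: DERIV_def)
  qed
qed

lemma has_real_derivative_chi: "(chi has_real_derivative chi' t) (at t)"
proof -
  have "((\<lambda>t. 1 - t\<^sup>2) has_real_derivative - 2 * t) (at t)"
    by (auto intro!: derivative_eq_intros)
  from DERIV_chain2[OF has_real_derivative_max0_power2 this]
  show ?thesis unfolding chi_def chi'_def by (rule DERIV_cong) simp
qed

lemma continuous_chi': "continuous_on UNIV chi'"
  unfolding chi'_def by (intro continuous_intros)

lemma chi_nonneg: "0 \<le> chi t" and chi_le_1: "chi t \<le> 1"
  by (auto simp: chi_def abs_square_le_1)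

lemma chi_0 [simp]: "chi 0 = 1"
  by (simp add: chi_def)

lemma chi_outside:
  assumes "1 \<le> \<bar>t\<bar>"
  shows "chi t = 0" "chi' t = 0"
proof -
  have "1 \<le> t\<^sup>2" using assms by (simp add: abs_le_square_iff[of 1 t, simplified])
  then show "chi t = 0" "chi' t = 0" by (auto simp: chi_def chi'_def)
qed

lemma abs_chi'_le: "\<bar>chi' t\<bar> \<le> 4"
proof (cases "1 \<le> \<bar>t\<bar>")
  case False
  then have "\<bar>t\<bar> * max 0 (1 - t\<^sup>2) \<le> 1 * 1" by (intro mult_mono) auto
  then show ?thesis by (simp add: chi'_def abs_mult)
qed (simp add: chi_outside)

text \<open>The origin is treated separately because \<open>ln 0 = 0\<close>.\<close>
definition rad :: "(real \<Rightarrow> real) \<Rightarrow> 'a::euclidean_space \<Rightarrow> real" where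
  "rad z x = (if x = 0 then 0 else z (ln (norm x)))"

text \<open>The gradient of z(ln |x|). Its length times |x| is |z'(ln |x|)|, the derivative along
  the axis of the cylinder.\<close>

definition rad_grad :: "(real \<Rightarrow> real) \<Rightarrow> 'a::euclidean_space \<Rightarrow> 'a" where
  "rad_grad z' x = (if x = 0 then 0 else (z' (ln (norm x)) / (norm x)\<^sup>2) *\<^sub>R x)"

lemma annulus_iff_ln: "x \<noteq> 0 \<Longrightarrow> x \<in> annulus (exp (- n)) (exp n) \<longleftrightarrow> \<bar>ln (norm x)\<bar> \<le> n"
  by (auto simp: annulus_def abs_le_iff ln_ge_iff[symmetric] minus_le_iff)
    (metis exp_le_cancel_iff exp_ln zero_less_norm_iff)+

lemma norm_rad_grad: "norm (rad_grad z' x) = (if x = 0 then 0 else \<bar>z' (ln (norm x))\<bar> / norm x)"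
  by (simp add: rad_grad_def power2_eq_square)

context
  fixes z z' :: "real \<Rightarrow> real" and n :: real
  assumes z: "\<And>t. (z has_real_derivative z' t) (at t)" "continuous_on UNIV z'"
    and out: "\<And>t. n \<le> \<bar>t\<bar> \<Longrightarrow> z t = 0" "\<And>t. n \<le> \<bar>t\<bar> \<Longrightarrow> z' t = 0"
begin

lemma rad_outside:
  assumes "x \<notin> annulus (exp (- n)) (exp n)"
  shows "rad z x = 0" "rad_grad z' x = 0"
  using assms annulus_iff_ln[of x n] out[of "ln (norm x)"] by (auto simp: rad_def rad_grad_def)

lemma rad_near_0:
  assumes "norm x < exp (- n)"
  shows "rad z x = 0" "rad_grad z' x = 0"
  using assms by (auto intro!: rad_outside simp: annulus_def)

lemma has_derivative_rad: "(rad z has_derivative (\<lambda>v. rad_grad z' x \<bullet> v)) (at (x::'a::euclidean_space))"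
proof (cases "x = 0")
  case True
  have "((\<lambda>x. 0) has_derivative (\<lambda>v. rad_grad z' x \<bullet> v)) (at x)"
    using True by (simp add: rad_grad_def)
  then show ?thesis
    by (rule has_derivative_transform_within_open[where s="ball 0 (exp (- n))"]) (use True rad_near_0 in auto)
next
  case False
  have "((\<lambda>x. ln (norm x)) has_derivative (\<lambda>v. (sgn x \<bullet> v) / norm x)) (at x)"
  proof -
    have 1: "(norm has_derivative (\<lambda>v. sgn x \<bullet> v)) (at x)"
      using has_derivative_norm[OF False] by (simp add: inner_commute)
    have 2: "(ln has_derivative (\<lambda>h. inverse (norm x) * h)) (at (norm x))"
      using DERIV_ln[of "norm x"] False by (simp add: has_field_derivative_def)
    show ?thesis using has_derivative_compose[OF 1 2] by (simp add: divide_inverse mult.commute)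
  qed
  from has_derivative_compose[OF this z(1)[unfolded has_field_derivative_def]]
  have "((\<lambda>x. z (ln (norm x))) has_derivative (\<lambda>v. rad_grad z' x \<bullet> v)) (at x)"
    using False by (simp add: rad_grad_def sgn_div_norm power2_eq_square divide_inverse mult_ac)
  then show ?thesis
    by (rule has_derivative_transform_within_open[where s="- {0}"]) (use False in \<open>auto simp: rad_def\<close>)
qed

lemma continuous_rad_grad: "continuous_on UNIV (rad_grad z' :: 'a::euclidean_space \<Rightarrow> 'a)"
proof (intro continuous_at_imp_continuous_on ballI)
  fix x :: 'a
  show "isCont (rad_grad z') x"
  proof (cases "x = 0")
    case True
    have "eventually (\<lambda>y::'a. rad_grad z' y = 0) (nhds x)"
    proof -
      have "eventually (\<lambda>y. y \<in> ball 0 (exp (- n))) (nhds x)" using True by (intro eventually_nhds_in_open) auto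
      then show ?thesis by eventually_elim (use rad_near_0 in auto)
    qed
    then show ?thesis by (subst isCont_cong) auto
  next
    case False
    have "eventually (\<lambda>y::'a. rad_grad z' y = (z' (ln (norm y)) / (norm y)\<^sup>2) *\<^sub>R y) (nhds x)"
    proof -
      have "eventually (\<lambda>y. y \<in> - {0}) (nhds x)" using False by (intro eventually_nhds_in_open) auto
      then show ?thesis by eventually_elim (auto simp: rad_grad_def)
    qed
    moreover have "isCont z' t" for t using z(2) by (simp add: continuous_on_eq_continuous_at)
    then have "isCont (\<lambda>y. z' (ln (norm y))) x"
      using False by (intro isCont_o2[where f="\<lambda>y. ln (norm y)" and g=z'] continuous_intros) auto
    then have "isCont (\<lambda>y. (z' (ln (norm y)) / (norm y)\<^sup>2) *\<^sub>R y) x"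
      using False by (intro continuous_intros) auto
    ultimately show ?thesis by (subst isCont_cong)
  qed
qed

end

section \<open>The cut-off weight\<close>

lemma sum_abs_inner_Basis_le: "(\<Sum>b\<in>Basis. \<bar>y \<bullet> b\<bar>) \<le> DIM('a) * norm (y::'a::euclidean_space)"
  by (intro sum_bounded_above) (auto simp: Basis_le_norm)

text \<open>In the variable t = ln |x| the exponential is the weight |x|^(1-N). The cutoff is
  stretched over |t| < n + 1 so that its own derivative stays bounded as it exhausts the
  line.\<close>

definition cutoff :: "nat \<Rightarrow> nat \<Rightarrow> real \<Rightarrow> real" where
  "cutoff N n t = exp ((1 - real N) * t) * chi (t / Suc n)"

definition cutoff' :: "nat \<Rightarrow> nat \<Rightarrow> real \<Rightarrow> real" where
  "cutoff' N n t = exp ((1 - real N) * t) * ((1 - real N) * chi (t / Suc n) + chi' (t / Suc n) / Suc n)"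

lemma has_real_derivative_cutoff: "(cutoff N n has_real_derivative cutoff' N n t) (at t)"
proof -
  have 1: "((\<lambda>t. t / Suc n) has_real_derivative 1 / Suc n) (at t)"
    by (auto intro!: derivative_eq_intros)
  have 2: "((\<lambda>t. exp ((1 - real N) * t)) has_real_derivative exp ((1 - real N) * t) * (1 - real N)) (at t)"
    by (auto intro!: derivative_eq_intros)
  from DERIV_mult[OF 2 DERIV_chain2[OF has_real_derivative_chi 1]]
  show ?thesis unfolding cutoff_def[abs_def] cutoff'_def by (rule DERIV_cong) (simp add: algebra_simps)
qed

lemma cutoff_outside:
  assumes "real (Suc n) \<le> \<bar>t\<bar>"
  shows "cutoff N n t = 0" "cutoff' N n t = 0"
proof -
  have "1 \<le> \<bar>t / Suc n\<bar>" using assms by simp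
  then show "cutoff N n t = 0" "cutoff' N n t = 0" unfolding cutoff_def cutoff'_def using chi_outside by auto
qed

lemma continuous_cutoff': "continuous_on UNIV (cutoff' N n)"
proof -
  have 1: "continuous_on UNIV (\<lambda>t. t / real (Suc n))" by (intro continuous_intros) auto
  have "continuous_on UNIV chi" by (intro continuous_at_imp_continuous_on ballI DERIV_isCont[OF has_real_derivative_chi])
  then have 2: "continuous_on UNIV (\<lambda>t. chi (t / real (Suc n)))"
    by (rule continuous_on_compose2[OF _ 1]) simp
  have 3: "continuous_on UNIV (\<lambda>t. chi' (t / real (Suc n)))"
    by (rule continuous_on_compose2[OF continuous_chi' 1]) simp
  show ?thesis unfolding cutoff'_def by (intro continuous_intros 2 3) auto
qed

text \<open>N + 3 is N - 1 from the exponential plus 4 from \<open>chi'\<close>, whose factor 1/(n +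
  1) is dropped. Uniformity in n is what matters.\<close>

lemma cutoff_bounds:
  assumes "N \<ge> 1"
  shows "0 \<le> cutoff N n t" "cutoff N n t \<le> exp ((1 - real N) * t)" "\<bar>cutoff' N n t\<bar> \<le> exp ((1 - real N) * t) * (N + 3)"
proof -
  show "0 \<le> cutoff N n t" "cutoff N n t \<le> exp ((1 - real N) * t)"
    by (simp_all add: cutoff_def chi_nonneg chi_le_1)
  have "\<bar>(1 - real N) * chi (t / Suc n)\<bar> \<le> (real N - 1) * 1"
    unfolding abs_mult using assms chi_nonneg chi_le_1 by (intro mult_mono) auto
  moreover have "\<bar>chi' (t / Suc n) / Suc n\<bar> \<le> 4 / 1"
    unfolding abs_divide by (intro frac_le abs_chi'_le) auto
  ultimately have "\<bar>(1 - real N) * chi (t / Suc n) + chi' (t / Suc n) / Suc n\<bar> \<le> (real N - 1) * 1 + 4 / 1"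
    by (rule order_trans[OF abs_triangle_ineq add_mono])
  then have "\<bar>(1 - real N) * chi (t / Suc n) + chi' (t / Suc n) / Suc n\<bar> \<le> N + 3" by simp
  then show "\<bar>cutoff' N n t\<bar> \<le> exp ((1 - real N) * t) * (N + 3)"
    by (simp add: cutoff'_def abs_mult)
qed

lemma exp_mult_ln_norm: "x \<noteq> 0 \<Longrightarrow> exp (a * ln (norm x)) = norm x powr a"
  by (simp add: powr_def)

lemma norm_powr_diff: "x \<noteq> 0 \<Longrightarrow> norm x powr (1 - a) / norm x = norm x powr (- a)"
  by (simp add: powr_diff powr_minus divide_inverse)

text \<open>Differentiating the weight costs at most (N + 3) |x|^(-N), which becomes the zero order
  term. The same constant covers the passage from the sum of the |g \<bullet> b| to N |g|, and the
  limit n \<rightarrow> \<infinity> removes the cutoff.\<close>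

lemma sob_bound_weighted:
  fixes u :: "'a::euclidean_space \<Rightarrow> real"
  defines "N \<equiv> real DIM('a)"
  assumes W: "wgrad u g"
    and \<Phi>: "\<And>t. (\<Phi> has_real_derivative \<Phi>' t) (at t)" "continuous_on UNIV \<Phi>'" "\<And>t. 0 \<le> \<Phi> t" "\<And>t. \<Phi> t \<le> B" "\<And>t. \<bar>\<Phi>' t\<bar> \<le> B"
    and J: "(\<integral>\<^sup>+x. ennreal ((\<bar>\<Phi>' (u x)\<bar> * norm x * norm (g x) + \<Phi> (u x)) * norm x powr (- N)) \<partial>lborel) < ennreal J"
  shows "sob_bound (\<lambda>x. norm x powr (1 - N) * \<Phi> (u x)) ((N + 3) * J)"
proof -
  have N1: "1 \<le> DIM('a)" "1 \<le> N" using DIM_positive[where 'a='a] unfolding N_def by linarith+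
  have [measurable]: "u \<in> borel_measurable borel" "g \<in> borel_measurable borel" using W by (auto simp: wgrad_def)
  have [measurable]: "\<Phi> \<in> borel_measurable borel" "\<Phi>' \<in> borel_measurable borel"
    using \<Phi>(2) by (auto intro!: borel_measurable_continuous_onI continuous_at_imp_continuous_on DERIV_isCont[OF \<Phi>(1)])
  define \<zeta> :: "nat \<Rightarrow> 'a \<Rightarrow> real" where "\<zeta> n = rad (cutoff DIM('a) n)" for n
  define G :: "nat \<Rightarrow> 'a \<Rightarrow> 'a" where "G n = rad_grad (cutoff' DIM('a) n)" for n
  note rd = has_derivative_rad[OF has_real_derivative_cutoff continuous_cutoff' cutoff_outside]
    continuous_rad_grad[OF has_real_derivative_cutoff continuous_cutoff' cutoff_outside]
    rad_outside[OF has_real_derivative_cutoff continuous_cutoff' cutoff_outside]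
  have off: "\<zeta> n x = 0" "G n x = 0" if "x \<notin> annulus (exp (- real (Suc n))) (exp (real (Suc n)))" for n x
    using that unfolding \<zeta>_def G_def by (blast intro: rd(3,4))+
  have \<zeta>le: "\<zeta> n x \<le> norm x powr (1 - N)" for n x
    using cutoff_bounds(2)[OF N1(1), of n "ln (norm x)"] exp_mult_ln_norm[of x "1 - N"]
    by (cases "x = 0") (simp_all add: \<zeta>_def rad_def N_def)
  have Gle: "norm (G n x) \<le> (N + 3) * norm x powr (- N)" for n x
  proof (cases "x = 0")
    case False
    have "norm (G n x) \<le> norm x powr (1 - N) * (N + 3) / norm x"
      unfolding G_def norm_rad_grad using False cutoff_bounds(3)[OF N1(1), of n "ln (norm x)"]
      by (simp add: exp_mult_ln_norm N_def divide_right_mono)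
    then show ?thesis using norm_powr_diff[OF False, of N] by (metis mult.commute times_divide_eq_right)
  qed (simp add: G_def rad_grad_def)
  have cG: "continuous_on UNIV (G n)" for n unfolding G_def by (rule rd)
  then have [measurable]: "G n \<in> borel_measurable borel" for n by (rule borel_measurable_continuous_onI)
  have d\<zeta>: "(\<zeta> n has_derivative (\<lambda>v. G n x \<bullet> v)) (at x)" for n x unfolding \<zeta>_def G_def by (rule rd)
  then have [measurable]: "\<zeta> n \<in> borel_measurable borel" for n
    by (intro borel_measurable_continuous_onI continuous_at_imp_continuous_on ballI has_derivative_continuous)
  have \<zeta>0: "0 \<le> \<zeta> n x" for n x using cutoff_bounds[OF N1(1)] by (simp add: \<zeta>_def rad_def)
  have sob: "sob_bound (\<lambda>x. \<zeta> n x * \<Phi> (u x)) ((N + 3) * J)" for n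
  \<comment> \<open>This \<open>Z\<close> grows exponentially with n, which is harmless as the
    resulting bound does not contain it.\<close>
  proof (rule sob_bound_weak[OF W \<Phi> d\<zeta>, where r="exp (- real (Suc n))" and R="exp (real (Suc n))"
        and Zd="\<lambda>x. norm (G n x)" and Z="(N + 3) * exp (N * Suc n)"])
    fix b :: 'a show "continuous_on UNIV (\<lambda>x. G n x \<bullet> b)" by (intro continuous_intros cG)
  next
    fix x show "0 \<le> \<zeta> n x" by (rule \<zeta>0)
  next
    have pw: "norm x powr (- a) \<le> exp (N * Suc n)" if "x \<in> annulus (exp (- real (Suc n))) (exp (real (Suc n)))" "0 \<le> a" "a \<le> N" for x :: 'a and a
    proof -
      have "x \<noteq> 0" using that(1) by (auto simp: annulus_def not_le)
      then have "- ln (norm x) \<le> Suc n" using annulus_iff_ln[of x "Suc n"] that(1) by linarith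
      then have "a * (- ln (norm x)) \<le> a * Suc n" using that by (intro mult_left_mono) auto
      also have "\<dots> \<le> N * Suc n" using that by (intro mult_right_mono) auto
      finally show ?thesis using \<open>x \<noteq> 0\<close> by (simp add: powr_def)
    qed
    fix x
    show "\<zeta> n x \<le> (N + 3) * exp (N * Suc n)"
    proof (cases "x \<in> annulus (exp (- real (Suc n))) (exp (real (Suc n)))")
      case True
      have "\<zeta> n x \<le> norm x powr (- (N - 1))" using \<zeta>le by simp
      also have "\<dots> \<le> exp (N * Suc n)" using N1 by (intro pw True) auto
      also have "\<dots> \<le> (N + 3) * exp (N * Suc n)" using N1 using mult_right_mono[of 1 "N + 3" "exp (N * Suc n)"] by simp
      finally show ?thesis .
    next
      case False
      then show ?thesis using off(1)[OF False] N1 by simp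
    qed
    show "norm (G n x) \<le> (N + 3) * exp (N * Suc n)"
    proof (cases "x \<in> annulus (exp (- real (Suc n))) (exp (real (Suc n)))")
      case True
      have "norm (G n x) \<le> (N + 3) * norm x powr (- N)" by (rule Gle)
      also have "\<dots> \<le> (N + 3) * exp (N * Suc n)" using N1 by (intro mult_left_mono pw True) auto
      finally show ?thesis .
    next
      case False
      then show ?thesis using off(2)[OF False] N1 by simp
    qed
    show "x \<in> annulus (exp (- real (Suc n))) (exp (real (Suc n)))" if "\<zeta> n x \<noteq> 0"
      using that off(1) by blast
    show "x \<in> annulus (exp (- real (Suc n))) (exp (real (Suc n)))" if "norm (G n x) \<noteq> 0"
      using that off(2) by force
  next
    fix x b assume "b \<in> (Basis :: 'a set)"
    then show "\<bar>G n x \<bullet> b\<bar> \<le> norm (G n x)" by (rule Basis_le_norm)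
  next
    have "(\<integral>\<^sup>+x. ennreal (\<zeta> n x * \<bar>\<Phi>' (u x)\<bar> * (\<Sum>b\<in>Basis. \<bar>g x \<bullet> b\<bar>) + norm (G n x) * \<Phi> (u x)) \<partial>lborel)
       \<le> (\<integral>\<^sup>+x. ennreal (N + 3) * ennreal ((\<bar>\<Phi>' (u x)\<bar> * norm x * norm (g x) + \<Phi> (u x)) * norm x powr (- N)) \<partial>lborel)"
    proof (intro nn_integral_mono)
      fix x
      have "\<zeta> n x * \<bar>\<Phi>' (u x)\<bar> * (\<Sum>b\<in>Basis. \<bar>g x \<bullet> b\<bar>) \<le> (norm x * norm x powr (- N)) * \<bar>\<Phi>' (u x)\<bar> * (N * norm (g x))"
      proof (cases "x = 0")
        case False
        then have "norm x powr (1 - N) = norm x * norm x powr (- N)"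
          using norm_powr_diff[OF False, of N] by (simp add: field_simps)
        then show ?thesis using \<zeta>le[of n x] \<zeta>0 sum_abs_inner_Basis_le[of "g x"] N1
          by (intro mult_mono) (auto simp: N_def intro!: sum_nonneg mult_nonneg_nonneg)
      qed (simp add: \<zeta>_def rad_def)
      also have "\<dots> \<le> (N + 3) * (\<bar>\<Phi>' (u x)\<bar> * norm x * norm (g x) * norm x powr (- N))"
        using N1 by (simp add: algebra_simps)
      finally have "\<zeta> n x * \<bar>\<Phi>' (u x)\<bar> * (\<Sum>b\<in>Basis. \<bar>g x \<bullet> b\<bar>)
        \<le> (N + 3) * (\<bar>\<Phi>' (u x)\<bar> * norm x * norm (g x) * norm x powr (- N))" .
      moreover have "norm (G n x) * \<Phi> (u x) \<le> (N + 3) * norm x powr (- N) * \<Phi> (u x)"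
        using \<Phi>(3) by (intro mult_right_mono Gle)
      ultimately have "\<zeta> n x * \<bar>\<Phi>' (u x)\<bar> * (\<Sum>b\<in>Basis. \<bar>g x \<bullet> b\<bar>) + norm (G n x) * \<Phi> (u x)
        \<le> (N + 3) * ((\<bar>\<Phi>' (u x)\<bar> * norm x * norm (g x) + \<Phi> (u x)) * norm x powr (- N))"
        by (simp add: algebra_simps)
      then show "ennreal (\<zeta> n x * \<bar>\<Phi>' (u x)\<bar> * (\<Sum>b\<in>Basis. \<bar>g x \<bullet> b\<bar>) + norm (G n x) * \<Phi> (u x))
        \<le> ennreal (N + 3) * ennreal ((\<bar>\<Phi>' (u x)\<bar> * norm x * norm (g x) + \<Phi> (u x)) * norm x powr (- N))"
        using N1 by (subst ennreal_mult'[symmetric]) (auto intro!: ennreal_leI)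
    qed
    also have "\<dots> = ennreal (N + 3) * (\<integral>\<^sup>+x. ennreal ((\<bar>\<Phi>' (u x)\<bar> * norm x * norm (g x) + \<Phi> (u x)) * norm x powr (- N)) \<partial>lborel)"
      by (rule nn_integral_cmult) measurable
    also have "\<dots> < ennreal (N + 3) * ennreal J"
      using N1 by (intro ennreal_mult_strict_left_mono J) (simp_all del: ennreal_plus)
    also have "\<dots> = ennreal ((N + 3) * J)" using N1 by (simp add: ennreal_mult')
    finally show "(\<integral>\<^sup>+x. ennreal (\<zeta> n x * \<bar>\<Phi>' (u x)\<bar> * (\<Sum>b\<in>Basis. \<bar>g x \<bullet> b\<bar>) + norm (G n x) * \<Phi> (u x)) \<partial>lborel)
       < ennreal ((N + 3) * J)" .
  qed auto
  show ?thesis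
  proof (rule sob_bound_limit)
    show "eventually (\<lambda>n. sob_bound (\<lambda>x. \<zeta> n x * \<Phi> (u x)) ((N + 3) * J)) sequentially"
      using sob by simp
    show "AE x in lborel. (\<lambda>n. \<zeta> n x * \<Phi> (u x)) \<longlonglongrightarrow> norm x powr (1 - N) * \<Phi> (u x)"
      using AE_lborel_singleton[of "0::'a"]
    proof eventually_elim
      case (elim x)
      have "(\<lambda>n. ln (norm x) / real (Suc n)) \<longlonglongrightarrow> 0"
        using tendsto_mult[OF tendsto_const LIMSEQ_inverse_real_of_nat, of "ln (norm x)"] by (simp add: divide_inverse)
      then have "(\<lambda>n. chi (ln (norm x) / real (Suc n))) \<longlonglongrightarrow> chi 0"
        by (rule isCont_tendsto_compose[OF DERIV_isCont[OF has_real_derivative_chi]])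
      then have "(\<lambda>n. norm x powr (1 - N) * chi (ln (norm x) / real (Suc n)) * \<Phi> (u x)) \<longlonglongrightarrow> norm x powr (1 - N) * 1 * \<Phi> (u x)"
        by (intro tendsto_intros) simp
      then show ?case using elim
        by (simp add: \<zeta>_def rad_def cutoff_def N_def[symmetric] exp_mult_ln_norm)
    qed
  qed measurable
qed

section \<open>The inequality in logarithmic measure\<close>

definition mu :: "'a::euclidean_space measure" where
  "mu = density lborel (\<lambda>x. ennreal (norm x powr (- real DIM('a))))"

lemma sets_mu [simp, measurable_cong]: "sets mu = sets borel"
  by (simp add: mu_def)

lemma nn_integral_mu:
  assumes [measurable]: "f \<in> borel_measurable borel"
  shows "(\<integral>\<^sup>+x. f x \<partial>mu) = (\<integral>\<^sup>+x. ennreal (norm (x::'a::euclidean_space) powr (- real DIM('a))) * f x \<partial>lborel)"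
  unfolding mu_def by (subst nn_integral_density) auto

lemma nn_integral_mu_ennreal:
  fixes f :: "'a::euclidean_space \<Rightarrow> real"
  assumes [measurable]: "f \<in> borel_measurable borel"
  shows "(\<integral>\<^sup>+x. ennreal (f x) \<partial>mu) = (\<integral>\<^sup>+x. ennreal (f x * norm x powr (- real DIM('a))) \<partial>lborel)"
  by (subst nn_integral_mu) (auto simp: ennreal_mult'' mult.commute intro!: nn_integral_cong)

text \<open>For N \<ge> 2 the power \<kappa> of the weight is the density of \<open>mu\<close>. For
  N = 1 there is a supremum bound, and \<Phi>^\<kappa> = \<Phi>^(\<kappa>-1) \<Phi> interpolates it
  with the L^1 bound, whatever \<kappa> > 1 is.\<close>

lemma key_inequality:
  fixes u :: "'a::euclidean_space \<Rightarrow> real" and \<kappa> :: real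
  assumes W: "wgrad u g"
    and \<kappa>: "1 < \<kappa>" "DIM('a) \<noteq> 1 \<Longrightarrow> \<kappa> = DIM('a) / (DIM('a) - 1)"
    and \<Phi>: "\<And>t. (\<Phi> has_real_derivative \<Phi>' t) (at t)" "continuous_on UNIV \<Phi>'" "\<And>t. 0 \<le> \<Phi> t" "\<And>t. \<Phi> t \<le> B" "\<And>t. \<bar>\<Phi>' t\<bar> \<le> B"
    and J: "(\<integral>\<^sup>+x. ennreal (\<bar>\<Phi>' (u x)\<bar> * (norm x * norm (g x)) + \<Phi> (u x)) \<partial>mu) < ennreal J"
  shows "(\<integral>\<^sup>+x. ennreal (\<Phi> (u x) powr \<kappa>) \<partial>mu) \<le> ennreal (((real DIM('a) + 3) * real DIM('a) ^ DIM('a) * J) powr \<kappa>)"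
proof -
  define N where "N = real DIM('a)"
  have N1: "1 \<le> N" using DIM_positive[where 'a='a] unfolding N_def by linarith
  have [measurable]: "u \<in> borel_measurable borel" "g \<in> borel_measurable borel" using W by (auto simp: wgrad_def)
  have [measurable]: "\<Phi> \<in> borel_measurable borel" "\<Phi>' \<in> borel_measurable borel"
    using \<Phi>(2) by (auto intro!: borel_measurable_continuous_onI continuous_at_imp_continuous_on DERIV_isCont[OF \<Phi>(1)])
  have J0: "0 < J" using J le_less_trans[OF zero_le J] by simp
  have J': "(\<integral>\<^sup>+x. ennreal ((\<bar>\<Phi>' (u x)\<bar> * norm x * norm (g x) + \<Phi> (u x)) * norm x powr (- N)) \<partial>lborel) < ennreal J"
    using J by (subst (asm) nn_integral_mu_ennreal) (auto simp: N_def mult.assoc)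
  have sob: "sob_bound (\<lambda>x. norm x powr (1 - N) * \<Phi> (u x)) ((N + 3) * J)"
    using sob_bound_weighted[OF W \<Phi>] J' by (simp add: N_def)
  show ?thesis
  proof (cases "DIM('a) = 1")
    case True
    then have N: "N = 1" by (simp add: N_def)
    \<comment> \<open>The weight is now \<open>norm x powr 0\<close>, which is 1 except at the
      origin, where \<open>0 powr 0 = 0\<close>; hence that point is excluded.\<close>
    have ae: "AE x in lborel. \<Phi> (u x) \<le> 4 * J"
      using sob AE_lborel_singleton[of "0::'a"] True N \<Phi>(3) by (auto simp: sob_bound_def)
    have "(\<integral>\<^sup>+x. ennreal (\<Phi> (u x) powr \<kappa>) \<partial>mu) = (\<integral>\<^sup>+x. ennreal (\<Phi> (u x) powr \<kappa> * norm x powr (- N)) \<partial>lborel)"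
      unfolding N_def by (rule nn_integral_mu_ennreal) measurable
    also have "\<dots> \<le> (\<integral>\<^sup>+x. ennreal ((4 * J) powr (\<kappa> - 1)) * ennreal ((\<bar>\<Phi>' (u x)\<bar> * norm x * norm (g x) + \<Phi> (u x)) * norm x powr (- N)) \<partial>lborel)"
    proof (rule nn_integral_mono_AE)
      show "AE x in lborel. ennreal (\<Phi> (u x) powr \<kappa> * norm x powr (- N)) \<le>
        ennreal ((4 * J) powr (\<kappa> - 1)) * ennreal ((\<bar>\<Phi>' (u x)\<bar> * norm x * norm (g x) + \<Phi> (u x)) * norm x powr (- N))"
        using ae
      proof eventually_elim
        case (elim x)
        have "\<Phi> (u x) powr \<kappa> = \<Phi> (u x) powr (\<kappa> - 1) * \<Phi> (u x)"
          using \<Phi>(3)[of "u x"] powr_add[of "\<Phi> (u x)" "\<kappa> - 1" 1] by simp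
        also have "\<dots> \<le> (4 * J) powr (\<kappa> - 1) * (\<bar>\<Phi>' (u x)\<bar> * norm x * norm (g x) + \<Phi> (u x))"
          using elim \<Phi>(3)[of "u x"] \<kappa>(1) by (intro mult_mono powr_mono2) auto
        finally have "\<Phi> (u x) powr \<kappa> * norm x powr (- N) \<le> (4 * J) powr (\<kappa> - 1) * ((\<bar>\<Phi>' (u x)\<bar> * norm x * norm (g x) + \<Phi> (u x)) * norm x powr (- N))"
          unfolding mult.assoc[of "(4 * J) powr (\<kappa> - 1)", symmetric] by (rule mult_right_mono) simp
        then show ?case by (subst ennreal_mult'[symmetric]) (auto intro!: ennreal_leI)
      qed
    qed
    also have "\<dots> = ennreal ((4 * J) powr (\<kappa> - 1)) * (\<integral>\<^sup>+x. ennreal ((\<bar>\<Phi>' (u x)\<bar> * norm x * norm (g x) + \<Phi> (u x)) * norm x powr (- N)) \<partial>lborel)"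
      by (rule nn_integral_cmult) measurable
    also have "\<dots> \<le> ennreal ((4 * J) powr (\<kappa> - 1)) * ennreal J"
      using J' by (intro mult_left_mono less_imp_le) auto
    also have "\<dots> \<le> ennreal ((4 * J) powr (\<kappa> - 1) * (4 * J))"
      using J0 by (subst ennreal_mult'[symmetric]) (auto intro!: ennreal_leI)
    also have "(4 * J) powr (\<kappa> - 1) * (4 * J) = (4 * J) powr \<kappa>"
      using J0 powr_add[of "4 * J" "\<kappa> - 1" 1] by simp
    finally show ?thesis using True by simp
  next
    case False
    have "DIM('a) > 1" using False DIM_positive[where 'a='a] by linarith
    then have \<kappa>': "\<kappa> = N / (N - 1)" "N > 1" using \<kappa>(2)[OF False] by (auto simp: N_def)
    have "(\<integral>\<^sup>+x. ennreal (\<Phi> (u x) powr \<kappa>) \<partial>mu) = (\<integral>\<^sup>+x. ennreal (\<Phi> (u x) powr \<kappa> * norm x powr (- N)) \<partial>lborel)"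
      unfolding N_def by (rule nn_integral_mu_ennreal) measurable
    also have "\<dots> = (\<integral>\<^sup>+x. ennreal (\<bar>norm x powr (1 - N) * \<Phi> (u x)\<bar> powr \<kappa>) \<partial>lborel)"
    proof (intro nn_integral_cong arg_cong[where f=ennreal])
      fix x :: 'a
      have "(norm x powr (1 - N)) powr \<kappa> = norm x powr (- N)"
        using \<kappa>' by (simp add: powr_powr field_simps)
      then show "\<Phi> (u x) powr \<kappa> * norm x powr (- N) = \<bar>norm x powr (1 - N) * \<Phi> (u x)\<bar> powr \<kappa>"
        using \<Phi>(3)[of "u x"] by (simp add: powr_mult abs_mult mult.commute)
    qed
    also have "\<dots> \<le> ennreal ((N - 1) ^ DIM('a) * ((N + 3) * J) powr \<kappa>)"
      using sob False N1 \<kappa>(2)[OF False] by (simp add: sob_bound_def N_def of_nat_diff)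
    \<comment> \<open>The Loomis-Whitney constant is enlarged to a power with exponent \<kappa>, so
      that it can be drawn inside and the constant of both dimensions has one shape.\<close>
    also have "(N - 1) ^ DIM('a) * ((N + 3) * J) powr \<kappa> \<le> (N ^ DIM('a)) powr \<kappa> * ((N + 3) * J) powr \<kappa>"
    proof (rule mult_right_mono)
      have "(N - 1) ^ DIM('a) \<le> N ^ DIM('a)" using N1 by (intro power_mono) auto
      also have "\<dots> = (N ^ DIM('a)) powr 1" using N1 by simp
      also have "\<dots> \<le> (N ^ DIM('a)) powr \<kappa>" using N1 \<kappa>(1) by (intro powr_mono) auto
      finally show "(N - 1) ^ DIM('a) \<le> (N ^ DIM('a)) powr \<kappa>" .
    qed simp
    also have "\<dots> = ((N + 3) * N ^ DIM('a) * J) powr \<kappa>"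
      using N1 J0 by (simp add: powr_mult mult_ac)
    finally show ?thesis by (simp add: N_def ennreal_leI)
  qed
qed

text \<open>Young's inequality with constants 1, by comparing b with y^(1/p): whichever is larger
  bounds the product. This form includes p = 1.\<close>

lemma powr_young:
  fixes y b p :: real
  assumes "0 \<le> y" "0 \<le> b" "1 \<le> p"
  shows "y powr (1 - 1 / p) * b \<le> y + b powr p"
proof (cases "b \<le> y powr (1 / p)")
  case True
  have "y powr (1 - 1 / p) * b \<le> y powr (1 - 1 / p) * y powr (1 / p)"
    using True by (intro mult_left_mono) auto
  also have "\<dots> = y" using assms by (cases "y = 0") (auto simp: powr_add[symmetric])
  finally show ?thesis using powr_ge_zero[of b p] by linarith
next
  case False
  then have b: "0 < b" using powr_ge_zero[of y "1 / p"] by linarith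
  have "y = (y powr (1 / p)) powr p" using assms by (simp add: powr_powr)
  also have "\<dots> \<le> b powr p" using False assms by (intro powr_mono2) auto
  finally have "y \<le> b powr p" .
  then have "y powr (1 - 1 / p) * b \<le> (b powr p) powr (1 - 1 / p) * b"
    using assms by (intro mult_right_mono powr_mono2) auto
  also have "\<dots> = b powr (p - 1) * b powr 1" using assms b by (simp add: powr_powr right_diff_distrib)
  also have "\<dots> = b powr p" by (simp only: powr_add[symmetric]) simp
  finally show ?thesis using assms by linarith
qed

text \<open>The sublinear power lies below \<tau> y as soon as y \<ge> \<tau>^(-D), and below its
  value at that threshold before. With y a multiple of \<Phi>^\<kappa> it trades the zero order term
  for a small share of \<Phi>^\<kappa> and a constant on a set of small measure.\<close>

lemma powr_le_linear:
  fixes y \<tau> D :: real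
  assumes "0 \<le> y" "0 < \<tau>" "1 < D"
  shows "y powr ((D - 1) / D) \<le> \<tau> * y + \<tau> powr (1 - D)"
proof (cases "\<tau> powr (- D) \<le> y")
  case True
  then have y: "0 < y" using powr_gt_zero[of \<tau> "- D"] assms by linarith
  have "y powr (- 1 / D) \<le> (\<tau> powr (- D)) powr (- 1 / D)"
    using True assms by (intro powr_mono2') auto
  also have "\<dots> = \<tau>" using assms by (simp add: powr_powr)
  finally have "y powr (- 1 / D) * y \<le> \<tau> * y" using y by (intro mult_right_mono) auto
  moreover have "y powr ((D - 1) / D) = y powr (- 1 / D) * y"
    using powr_add[of y "- 1 / D" 1] y assms by (simp add: field_simps)
  ultimately show ?thesis using powr_ge_zero[of \<tau> "1 - D"] by linarith
next
  case False
  have "y powr ((D - 1) / D) \<le> (\<tau> powr (- D)) powr ((D - 1) / D)"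
    using False assms by (intro powr_mono2) auto
  also have "\<dots> = \<tau> powr (1 - D)" using assms by (simp add: powr_powr)
  finally show ?thesis using assms by (smt (verit) mult_nonneg_nonneg)
qed

section \<open>Absorption and truncation\<close>

lemma one_plus_powr_le:
  fixes y \<kappa> :: real
  assumes "0 \<le> y" "0 \<le> \<kappa>"
  shows "(1 + y) powr \<kappa> \<le> 2 powr \<kappa> * (1 + y powr \<kappa>)"
proof (cases "y \<le> 1")
  case True
  have "(1 + y) powr \<kappa> \<le> 2 powr \<kappa> * 1" using assms True by (simp add: powr_mono2)
  also have "\<dots> \<le> 2 powr \<kappa> * (1 + y powr \<kappa>)" by (intro mult_left_mono) auto
  finally show ?thesis .
next
  case False
  have "(1 + y) powr \<kappa> \<le> (2 * y) powr \<kappa>" using assms False by (intro powr_mono2) auto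
  also have "\<dots> \<le> 2 powr \<kappa> * (1 + y powr \<kappa>)" using assms by (simp add: powr_mult)
  finally show ?thesis .
qed

text \<open>A bootstrap in Z = 1 + \<integral>\<Phi>^\<kappa>. For large Z, \<open>hyp\<close>
  bounds C = Z^(1/\<kappa>) by a multiple of Z^\<sigma> plus a multiple of C, and
  \<open>small\<close> makes the latter at most C/2. Since 1/\<kappa> - \<sigma> = 1/p - 1/D > 0,
  what remains bounds Z. The result is free of the bound \<open>B\<close>, so truncations can be
  removed afterwards.\<close>

lemma sobolev_absorption:
  fixes \<Phi> G :: "'a \<Rightarrow> real" and D p :: real
  defines "\<kappa> \<equiv> D / (D - 1)" and "\<sigma> \<equiv> 1 - 1 / p"
  assumes p: "1 \<le> p" "p < D" and K: "0 < K" and \<gamma>: "0 < \<gamma>" and \<tau>: "0 < \<tau>" and m: "0 \<le> m" "m \<le> 1"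
    and small: "8 * K * (\<tau> + \<tau> powr (1 - D) * m) \<le> 1"
    and E[measurable]: "E \<in> sets M" and Em: "emeasure M E \<le> ennreal m"
    and \<Phi>: "\<And>x. 0 \<le> \<Phi> x" "\<And>x. \<Phi> x \<le> B" "\<And>x. x \<notin> E \<Longrightarrow> \<Phi> x = 0"
    and [measurable]: "\<Phi> \<in> borel_measurable M" "G \<in> borel_measurable M"
    and G: "\<And>x. 0 \<le> G x" "(\<integral>\<^sup>+x. ennreal (indicator E x * G x powr p) \<partial>M) \<le> 2"
    and hyp: "\<And>J. (\<integral>\<^sup>+x. ennreal (\<gamma> * (1 + \<Phi> x) powr (\<kappa> * \<sigma>) * indicator E x * G x + \<Phi> x) \<partial>M) < ennreal J \<Longrightarrow>
       (\<integral>\<^sup>+x. ennreal (\<Phi> x powr \<kappa>) \<partial>M) \<le> ennreal ((K * J) powr \<kappa>)"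
  shows "(\<integral>\<^sup>+x. ennreal (\<Phi> x powr \<kappa>) \<partial>M) \<le> ennreal (1 + (24 * K * \<gamma> * 2 powr (\<kappa> * \<sigma>)) powr (1 / (1 / p - 1 / D)))"
proof -
  have D: "1 < D" using p by linarith
  have \<kappa>: "1 < \<kappa>" "1 / \<kappa> = (D - 1) / D" using D by (auto simp: \<kappa>_def)
  have \<kappa>0: "0 < \<kappa>" using \<kappa> by simp
  have \<sigma>: "0 \<le> \<sigma>" using p by (simp add: \<sigma>_def)
  have gap: "1 / \<kappa> - \<sigma> = 1 / p - 1 / D" using D by (simp add: \<kappa>(2) \<sigma>_def diff_divide_distrib)
  have gap0: "0 < 1 / p - 1 / D" using p by (simp add: frac_less2)
  define I where "I = (\<integral>\<^sup>+x. ennreal (\<Phi> x powr \<kappa>) \<partial>M)"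
  \<comment> \<open>Finiteness beforehand: \<Phi> is bounded and lives on a set of finite measure.
    Without it nothing could be moved to the left side.\<close>
  have "I \<le> (\<integral>\<^sup>+x. ennreal (B powr \<kappa>) * indicator E x \<partial>M)"
    unfolding I_def
  proof (intro nn_integral_mono)
    fix x show "ennreal (\<Phi> x powr \<kappa>) \<le> ennreal (B powr \<kappa>) * indicator E x"
      using \<Phi> \<kappa>0 by (cases "x \<in> E") (auto intro!: ennreal_leI powr_mono2)
  qed
  also have "\<dots> = ennreal (B powr \<kappa>) * emeasure M E" by (simp add: nn_integral_cmult_indicator)
  also have "\<dots> < \<infinity>" using Em by (auto simp: ennreal_mult_less_top intro: le_less_trans)
  finally have "I < \<infinity>" .
  define X where "X = enn2real I"
  have IX: "I = ennreal X" and X0: "0 \<le> X" using \<open>I < \<infinity>\<close> by (auto simp: X_def)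
  define Z where "Z = 1 + X"
  have Z: "1 \<le> Z" using X0 by (simp add: Z_def)
  \<comment> \<open>With this normalisation the integral of (1 + \<Phi>)^\<kappa> / Y over E is at
    most (m + X) / Z \<le> 1; the factor \<open>2 powr \<kappa>\<close> comes from
    \<open>one_plus_powr_le\<close>.\<close>
  define Y where "Y = 2 powr \<kappa> * Z"
  have Y: "0 < Y" using Z by (simp add: Y_def)
  define A where "A = \<gamma> * Y powr \<sigma>"
  define C where "C = Z powr (1 / \<kappa>)"
  have A: "0 < A" and C: "0 < C" using \<gamma> Y Z by (simp_all add: A_def C_def)
  define R where "R = 3 * A + C * (\<tau> + \<tau> powr (1 - D) * m)"
  have R: "0 < R" unfolding R_def using A C \<tau> m by (intro add_pos_nonneg) auto
  \<comment> \<open>Young's inequality splits the gradient term after division by Y, and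
    \<open>powr_le_linear\<close> splits \<Phi> after division by Z. Every resulting term has a
    controlled integral.\<close>
  have pt: "\<gamma> * (1 + \<Phi> x) powr (\<kappa> * \<sigma>) * indicator E x * G x + \<Phi> x
      \<le> (A / Z + C * \<tau> / Z) * \<Phi> x powr \<kappa> + (A / Z + C * \<tau> powr (1 - D)) * indicator E x + A * (indicator E x * G x powr p)" for x
  proof (cases "x \<in> E")
    case True
    have "(1 + \<Phi> x) powr (\<kappa> * \<sigma>) = (Y * ((1 + \<Phi> x) powr \<kappa> / Y)) powr \<sigma>"
      using Y by (simp add: powr_powr)
    also have "\<dots> = Y powr \<sigma> * ((1 + \<Phi> x) powr \<kappa> / Y) powr \<sigma>"
      using Y by (subst powr_mult) auto
    finally have 1: "(1 + \<Phi> x) powr (\<kappa> * \<sigma>) * G x = Y powr \<sigma> * (((1 + \<Phi> x) powr \<kappa> / Y) powr \<sigma> * G x)" by simp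
    also have "\<dots> \<le> Y powr \<sigma> * ((1 + \<Phi> x) powr \<kappa> / Y + G x powr p)"
      unfolding \<sigma>_def using p G Y by (intro mult_left_mono powr_young) auto
    also have "\<dots> \<le> Y powr \<sigma> * ((1 + \<Phi> x powr \<kappa>) / Z + G x powr p)"
    proof -
      have "(1 + \<Phi> x) powr \<kappa> / Y \<le> 2 powr \<kappa> * (1 + \<Phi> x powr \<kappa>) / Y"
        using Y \<Phi> \<kappa>0 by (intro divide_right_mono one_plus_powr_le) auto
      also have "\<dots> = (1 + \<Phi> x powr \<kappa>) / Z" by (simp add: Y_def)
      finally show ?thesis by (intro mult_left_mono) auto
    qed
    finally have "\<gamma> * ((1 + \<Phi> x) powr (\<kappa> * \<sigma>) * G x) \<le> \<gamma> * (Y powr \<sigma> * ((1 + \<Phi> x powr \<kappa>) / Z + G x powr p))"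
      using \<gamma> by (intro mult_left_mono) auto
    then have t1: "\<gamma> * (1 + \<Phi> x) powr (\<kappa> * \<sigma>) * G x \<le> A * ((1 + \<Phi> x powr \<kappa>) / Z + G x powr p)"
      by (simp add: A_def mult.assoc)
    have "\<Phi> x = (Z * (\<Phi> x powr \<kappa> / Z)) powr (1 / \<kappa>)"
      using Z \<Phi>(1)[of x] \<kappa>0 by (simp add: powr_powr)
    also have "\<dots> = C * (\<Phi> x powr \<kappa> / Z) powr ((D - 1) / D)"
      unfolding C_def \<kappa>(2)[symmetric] using Z by (subst powr_mult) auto
    also have "\<dots> \<le> C * (\<tau> * (\<Phi> x powr \<kappa> / Z) + \<tau> powr (1 - D))"
      using C Z \<tau> D by (intro mult_left_mono powr_le_linear) auto
    finally have t2: "\<Phi> x \<le> C * (\<tau> * (\<Phi> x powr \<kappa> / Z) + \<tau> powr (1 - D))" .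
    show ?thesis using t1 t2 True by (simp add: algebra_simps add_divide_distrib)
  next
    case False
    then show ?thesis using \<Phi>(3) \<kappa>0 by simp
  qed
  have "(\<integral>\<^sup>+x. ennreal (\<gamma> * (1 + \<Phi> x) powr (\<kappa> * \<sigma>) * indicator E x * G x + \<Phi> x) \<partial>M)
    \<le> (\<integral>\<^sup>+x. ennreal (A / Z + C * \<tau> / Z) * ennreal (\<Phi> x powr \<kappa>)
         + (ennreal (A / Z + C * \<tau> powr (1 - D)) * indicator E x + ennreal A * ennreal (indicator E x * G x powr p)) \<partial>M)"
  proof (intro nn_integral_mono)
    fix x
    have "ennreal (\<gamma> * (1 + \<Phi> x) powr (\<kappa> * \<sigma>) * indicator E x * G x + \<Phi> x)
      \<le> ennreal ((A / Z + C * \<tau> / Z) * \<Phi> x powr \<kappa> + ((A / Z + C * \<tau> powr (1 - D)) * indicator E x + A * (indicator E x * G x powr p)))"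
      using pt[of x] by (intro ennreal_leI) simp
    also have "\<dots> = ennreal ((A / Z + C * \<tau> / Z) * \<Phi> x powr \<kappa>) + (ennreal ((A / Z + C * \<tau> powr (1 - D)) * indicator E x) + ennreal (A * (indicator E x * G x powr p)))"
      using A C \<tau> Z by (subst ennreal_plus, simp, simp, subst ennreal_plus) auto
    also have "\<dots> = ennreal (A / Z + C * \<tau> / Z) * ennreal (\<Phi> x powr \<kappa>)
         + (ennreal (A / Z + C * \<tau> powr (1 - D)) * indicator E x + ennreal A * ennreal (indicator E x * G x powr p))"
      using A C \<tau> Z by (simp add: ennreal_mult' ennreal_indicator del: ennreal_plus)
    finally show "ennreal (\<gamma> * (1 + \<Phi> x) powr (\<kappa> * \<sigma>) * indicator E x * G x + \<Phi> x) \<le> \<dots>" .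
  qed
  also have "\<dots> = ennreal (A / Z + C * \<tau> / Z) * I + (ennreal (A / Z + C * \<tau> powr (1 - D)) * emeasure M E
      + ennreal A * (\<integral>\<^sup>+x. ennreal (indicator E x * G x powr p) \<partial>M))"
    unfolding I_def by (simp add: nn_integral_add nn_integral_cmult nn_integral_cmult_indicator del: ennreal_plus)
  also have "\<dots> \<le> ennreal (A / Z + C * \<tau> / Z) * ennreal X + (ennreal (A / Z + C * \<tau> powr (1 - D)) * ennreal m + ennreal A * ennreal 2)"
    unfolding IX using Em G(2) by (intro add_mono mult_left_mono) auto
  also have "\<dots> = ennreal ((A / Z + C * \<tau> / Z) * X + ((A / Z + C * \<tau> powr (1 - D)) * m + A * 2))"
    using A C \<tau> Z m X0 by (subst ennreal_plus, simp, simp, subst ennreal_plus) (auto simp: ennreal_mult' simp del: ennreal_plus)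
  \<comment> \<open>R itself already bounds the integral; doubling it provides the strict inequality
    that \<open>hyp\<close> demands.\<close>
  also have "\<dots> < ennreal (2 * R)"
  proof (rule ennreal_lessI)
    have "(A / Z + C * \<tau> / Z) * X + ((A / Z + C * \<tau> powr (1 - D)) * m + A * 2)
       = A * ((X + m) / Z) + C * \<tau> * (X / Z) + C * \<tau> powr (1 - D) * m + 2 * A"
      by (simp add: algebra_simps add_divide_distrib)
    also have "\<dots> \<le> A * 1 + C * \<tau> * 1 + C * \<tau> powr (1 - D) * m + 2 * A"
      using A C \<tau> Z m X0 by (intro add_mono mult_left_mono order_refl) (auto simp: Z_def)
    also have "\<dots> = R" by (simp add: R_def algebra_simps)
    finally show "(A / Z + C * \<tau> / Z) * X + ((A / Z + C * \<tau> powr (1 - D)) * m + A * 2) < 2 * R"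
      using R by linarith
  qed (use R in simp)
  finally have "I \<le> ennreal ((K * (2 * R)) powr \<kappa>)" unfolding I_def by (rule hyp)
  then have XR: "X \<le> (K * (2 * R)) powr \<kappa>" unfolding IX by (simp add: ennreal_le_iff)
  have "X \<le> 1 + (24 * K * \<gamma> * 2 powr (\<kappa> * \<sigma>)) powr (1 / (1 / p - 1 / D))"
  proof (cases "X \<le> 1")
    case True
    then show ?thesis using powr_ge_zero[of "24 * K * \<gamma> * 2 powr (\<kappa> * \<sigma>)" "1 / (1 / p - 1 / D)"] by linarith
  next
    case False
    have "C \<le> (2 * X) powr (1 / \<kappa>)" unfolding C_def using False Z \<kappa>0 by (intro powr_mono2) (auto simp: Z_def)
    also have "\<dots> = 2 powr (1 / \<kappa>) * X powr (1 / \<kappa>)" using X0 by (simp add: powr_mult)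
    also have "\<dots> \<le> 2 * X powr (1 / \<kappa>)"
    proof (rule mult_right_mono)
      have "2 powr (1 / \<kappa>) \<le> (2::real) powr 1" using \<kappa>(1) by (intro powr_mono) auto
      then show "2 powr (1 / \<kappa>) \<le> (2::real)" by simp
    qed simp
    also have "\<dots> \<le> 2 * ((K * (2 * R)) powr \<kappa>) powr (1 / \<kappa>)"
      using XR X0 \<kappa>0 by (intro mult_left_mono powr_mono2) auto
    also have "\<dots> = 2 * (K * (2 * R))" using K R \<kappa>0 by (simp add: powr_powr)
    \<comment> \<open>The part of R proportional to C appears with the factor from
      \<open>small\<close>, hence counts at most C/2; moving it left turns 12 into 24.\<close>
    also have "\<dots> = 12 * K * A + C * (8 * K * (\<tau> + \<tau> powr (1 - D) * m)) / 2"
      by (simp add: R_def algebra_simps)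
    also have "\<dots> \<le> 12 * K * A + C * 1 / 2"
      using small C by (intro add_left_mono divide_right_mono mult_left_mono) auto
    finally have "C \<le> 24 * K * A" by simp
    also have "A = \<gamma> * (2 powr (\<kappa> * \<sigma>) * Z powr \<sigma>)"
      using Z by (simp add: A_def Y_def powr_mult powr_powr)
    finally have "Z powr (1 / \<kappa>) \<le> (24 * K * \<gamma> * 2 powr (\<kappa> * \<sigma>)) * Z powr \<sigma>"
      by (simp add: C_def mult_ac)
    then have "Z powr (1 / \<kappa> - \<sigma>) \<le> 24 * K * \<gamma> * 2 powr (\<kappa> * \<sigma>)"
      using Z by (simp add: powr_diff pos_divide_le_eq)
    then have "(Z powr (1 / p - 1 / D)) powr (1 / (1 / p - 1 / D)) \<le> (24 * K * \<gamma> * 2 powr (\<kappa> * \<sigma>)) powr (1 / (1 / p - 1 / D))"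
      unfolding gap using gap0 by (intro powr_mono2) auto
    then have "Z \<le> (24 * K * \<gamma> * 2 powr (\<kappa> * \<sigma>)) powr (1 / (1 / p - 1 / D))"
      using gap0 Z p by (simp add: powr_powr)
    then show ?thesis by (simp add: Z_def)
  qed
  then show ?thesis using IX unfolding I_def by (simp add: ennreal_leI del: ennreal_plus)
qed

text \<open>A \<open>C\<^sup>1\<close> substitute for \<open>(|t| - 1)\<^sub>+\<close>.\<close>
definition softabs :: "real \<Rightarrow> real" where
  "softabs t = sqrt (1 + (max 0 (t - 1))\<^sup>2 + (max 0 (- t - 1))\<^sup>2) - 1"

definition softabs' :: "real \<Rightarrow> real" where
  "softabs' t = (max 0 (t - 1) - max 0 (- t - 1)) / sqrt (1 + (max 0 (t - 1))\<^sup>2 + (max 0 (- t - 1))\<^sup>2)"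

lemma softabs_radicand: "1 \<le> 1 + (max 0 (t - 1))\<^sup>2 + (max 0 (- t - 1))\<^sup>2"
  for t :: real by (simp add: add_nonneg_nonneg)

lemma softabs_sqrt_ge: "1 \<le> sqrt (1 + (max 0 (t - 1))\<^sup>2 + (max 0 (- t - 1))\<^sup>2)"
  for t :: real using real_sqrt_le_mono[OF softabs_radicand[of t]] by simp

lemma softabs_nonneg: "0 \<le> softabs t"
  using softabs_sqrt_ge[of t] by (simp add: softabs_def)

lemma has_real_derivative_softabs: "(softabs has_real_derivative softabs' t) (at t)"
proof -
  have pos: "0 < 1 + (max 0 (t - 1))\<^sup>2 + (max 0 (- t - 1))\<^sup>2" using softabs_radicand[of t] by linarith
  have 1: "((\<lambda>t. t - 1) has_real_derivative 1) (at t)" "((\<lambda>t. - t - 1) has_real_derivative - 1) (at t)"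
    by (auto intro!: derivative_eq_intros)
  have "((\<lambda>t. 1 + (max 0 (t - 1))\<^sup>2 + (max 0 (- t - 1))\<^sup>2) has_real_derivative
      0 + 2 * max 0 (t - 1) * 1 + 2 * max 0 (- t - 1) * (- 1)) (at t)"
    by (intro DERIV_add DERIV_const DERIV_chain2[OF has_real_derivative_max0_power2] 1)
  then have W: "((\<lambda>t. 1 + (max 0 (t - 1))\<^sup>2 + (max 0 (- t - 1))\<^sup>2) has_real_derivative
      2 * (max 0 (t - 1) - max 0 (- t - 1))) (at t)"
    by (rule DERIV_cong) simp
  have alg: "inverse s / 2 * (2 * y) = y / s" for s y :: real by (simp add: inverse_eq_divide)
  from DERIV_chain2[where f=sqrt and g="\<lambda>t. 1 + (max 0 (t - 1))\<^sup>2 + (max 0 (- t - 1))\<^sup>2", OF DERIV_real_sqrt[OF pos] W]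
  have "((\<lambda>t. sqrt (1 + (max 0 (t - 1))\<^sup>2 + (max 0 (- t - 1))\<^sup>2)) has_real_derivative softabs' t) (at t)"
    by (simp only: alg softabs'_def)
  from DERIV_diff[OF this DERIV_const[of 1]] show ?thesis
    unfolding softabs_def[abs_def] by (rule DERIV_cong) simp
qed

lemma continuous_softabs': "continuous_on UNIV softabs'"
proof -
  have "sqrt (1 + (max 0 (t - 1))\<^sup>2 + (max 0 (- t - 1))\<^sup>2) \<noteq> 0" for t :: real
    using softabs_sqrt_ge[of t] by linarith
  then show ?thesis unfolding softabs'_def by (intro continuous_intros) auto
qed

lemma abs_softabs'_le: "\<bar>softabs' t\<bar> \<le> 1"
proof -
  have "\<bar>max 0 (t - 1) - max 0 (- t - 1)\<bar> = sqrt ((max 0 (t - 1))\<^sup>2 + (max 0 (- t - 1))\<^sup>2)"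
    by (auto simp: max_def)
  also have "\<dots> \<le> sqrt (1 + (max 0 (t - 1))\<^sup>2 + (max 0 (- t - 1))\<^sup>2)" by (intro real_sqrt_le_mono) simp
  finally show ?thesis using softabs_sqrt_ge[of t]
    unfolding softabs'_def abs_divide by (subst divide_le_eq_1_pos) linarith+
qed

lemma softabs_small:
  assumes "\<bar>t\<bar> \<le> 1"
  shows "softabs t = 0" "softabs' t = 0"
  using assms by (auto simp: softabs_def softabs'_def max_def)

text \<open>With w = |t| - 1 \<ge> 1 one has sqrt(1 + w^2) \<ge> 1 + w/4, and half of w/4 pays for
  passing from w to |t|.\<close>

lemma softabs_large:
  assumes "2 \<le> \<bar>t\<bar>"
  shows "\<bar>t\<bar> / 8 \<le> softabs t"
proof -
  define w where "w = \<bar>t\<bar> - 1"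
  have w: "1 \<le> w" using assms by (simp add: w_def)
  have "(1 + w / 4)\<^sup>2 \<le> 1 + w\<^sup>2"
  proof -
    have "w \<le> w * w" using w by simp
    moreover have "(1 + w / 4)\<^sup>2 = 1 + w / 2 + w * w / 16" by (simp add: power2_eq_square algebra_simps)
    ultimately show ?thesis using w unfolding power2_eq_square[of w] by linarith
  qed
  then have "1 + w / 4 \<le> sqrt (1 + w\<^sup>2)" by (rule real_le_rsqrt)
  moreover have "1 + w\<^sup>2 = 1 + (max 0 (t - 1))\<^sup>2 + (max 0 (- t - 1))\<^sup>2"
    using assms by (cases "t < 0") (auto simp: w_def max_def)
  ultimately have "1 + w / 4 \<le> 1 + softabs t" by (simp add: softabs_def)
  moreover have "\<bar>t\<bar> / 8 = w / 8 + 1 / 8" by (simp add: w_def diff_divide_distrib)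
  ultimately show ?thesis using w by linarith
qed

text \<open>The quotient s / (1 + \<epsilon> s) stays below 1/\<epsilon> and tends to s as
  \<epsilon> goes to 0. Adding 1 keeps the base of the power away from 0, and subtracting 1 makes
  the result vanish wherever \<open>softabs\<close> does.\<close>

definition trunc :: "real \<Rightarrow> real \<Rightarrow> real \<Rightarrow> real" where
  "trunc \<epsilon> \<gamma> t = (1 + softabs t / (1 + \<epsilon> * softabs t)) powr \<gamma> - 1"

definition trunc' :: "real \<Rightarrow> real \<Rightarrow> real \<Rightarrow> real" where
  "trunc' \<epsilon> \<gamma> t = \<gamma> * (1 + softabs t / (1 + \<epsilon> * softabs t)) powr (\<gamma> - 1) * (softabs' t / (1 + \<epsilon> * softabs t)\<^sup>2)"

context
  fixes \<epsilon> \<gamma> :: real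
  assumes \<epsilon>: "0 < \<epsilon>" and \<gamma>: "1 \<le> \<gamma>"
begin

lemma trunc_denom: "1 \<le> 1 + \<epsilon> * softabs t"
  using \<epsilon> softabs_nonneg[of t] by simp

lemma trunc_base: "1 \<le> 1 + softabs t / (1 + \<epsilon> * softabs t)" "1 + softabs t / (1 + \<epsilon> * softabs t) \<le> 1 + 1 / \<epsilon>"
proof -
  have d: "0 < 1 + \<epsilon> * softabs t" using trunc_denom[of t] by linarith
  then show "1 \<le> 1 + softabs t / (1 + \<epsilon> * softabs t)" using softabs_nonneg[of t] by simp
  show "1 + softabs t / (1 + \<epsilon> * softabs t) \<le> 1 + 1 / \<epsilon>" using d \<epsilon> by (simp add: field_simps)
qed

lemma has_real_derivative_trunc: "(trunc \<epsilon> \<gamma> has_real_derivative trunc' \<epsilon> \<gamma> t) (at t)"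
proof -
  have d: "1 + \<epsilon> * softabs t \<noteq> 0" using trunc_denom[of t] by linarith
  have 1: "((\<lambda>t. 1 + \<epsilon> * softabs t) has_real_derivative \<epsilon> * softabs' t) (at t)"
    using DERIV_add[OF DERIV_const DERIV_cmult[OF has_real_derivative_softabs]] by (rule DERIV_cong) simp
  have "((\<lambda>t. softabs t / (1 + \<epsilon> * softabs t)) has_real_derivative softabs' t / (1 + \<epsilon> * softabs t)\<^sup>2) (at t)"
    using DERIV_divide[OF has_real_derivative_softabs 1 d]
    by (rule DERIV_cong) (simp add: power2_eq_square algebra_simps)
  from DERIV_add[OF DERIV_const this]
  have 2: "((\<lambda>t. 1 + softabs t / (1 + \<epsilon> * softabs t)) has_real_derivative softabs' t / (1 + \<epsilon> * softabs t)\<^sup>2) (at t)"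
    by (rule DERIV_cong) simp
  have 3: "((\<lambda>y. y powr \<gamma>) has_real_derivative \<gamma> * (1 + softabs t / (1 + \<epsilon> * softabs t)) powr (\<gamma> - 1)) (at (1 + softabs t / (1 + \<epsilon> * softabs t)))"
    using trunc_base(1)[of t] by (intro has_real_derivative_powr) linarith
  from DERIV_diff[OF DERIV_chain2[OF 3 2] DERIV_const]
  show ?thesis unfolding trunc_def[abs_def] trunc'_def by (rule DERIV_cong) simp
qed

lemma continuous_trunc': "continuous_on UNIV (trunc' \<epsilon> \<gamma>)"
proof -
  have "continuous_on UNIV softabs"
    by (intro continuous_at_imp_continuous_on ballI DERIV_isCont[OF has_real_derivative_softabs])
  moreover have "1 + \<epsilon> * softabs t \<noteq> 0" "1 + softabs t / (1 + \<epsilon> * softabs t) \<noteq> 0" for t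
    using trunc_denom[of t] trunc_base(1)[of t] by linarith+
  ultimately show ?thesis
    unfolding trunc'_def using continuous_softabs' by (intro continuous_intros) auto
qed

lemma trunc_nonneg: "0 \<le> trunc \<epsilon> \<gamma> t"
  using ge_one_powr_ge_zero[OF trunc_base(1)[of t], of \<gamma>] \<gamma> by (simp add: trunc_def)

text \<open>The factor \<gamma> makes this the same constant as for the derivative, so that a single
  \<open>B\<close> serves both bounds of \<open>key_inequality\<close>.\<close>

lemma trunc_le: "trunc \<epsilon> \<gamma> t \<le> \<gamma> * (1 + 1 / \<epsilon>) powr \<gamma>"
proof -
  have "(1 + softabs t / (1 + \<epsilon> * softabs t)) powr \<gamma> \<le> 1 * (1 + 1 / \<epsilon>) powr \<gamma>"
    using trunc_base[of t] \<gamma> by (simp add: powr_mono2)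
  also have "\<dots> \<le> \<gamma> * (1 + 1 / \<epsilon>) powr \<gamma>" using \<gamma> by (intro mult_right_mono) auto
  finally show ?thesis by (simp add: trunc_def)
qed

text \<open>1 + \<open>trunc\<close> is the power \<gamma> of the base, so the power \<gamma> - 1 in
  the derivative is a power of 1 + \<open>trunc\<close>. The remaining factors are at most 1, hence
  the bound has the same form for every \<epsilon>.\<close>

lemma abs_trunc'_le: "\<bar>trunc' \<epsilon> \<gamma> t\<bar> \<le> \<gamma> * (1 + trunc \<epsilon> \<gamma> t) powr ((\<gamma> - 1) / \<gamma>) * indicator {t. 1 < \<bar>t\<bar>} t"
proof (cases "1 < \<bar>t\<bar>")
  case True
  have "(1 + trunc \<epsilon> \<gamma> t) powr ((\<gamma> - 1) / \<gamma>) = (1 + softabs t / (1 + \<epsilon> * softabs t)) powr (\<gamma> - 1)"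
    using \<gamma> by (simp add: trunc_def powr_powr)
  moreover have "\<bar>softabs' t / (1 + \<epsilon> * softabs t)\<^sup>2\<bar> \<le> 1 / 1"
    unfolding abs_divide using trunc_denom[of t] abs_softabs'_le[of t]
    by (intro frac_le) (auto intro: one_le_power)
  then have "\<gamma> * (1 + softabs t / (1 + \<epsilon> * softabs t)) powr (\<gamma> - 1) * \<bar>softabs' t / (1 + \<epsilon> * softabs t)\<^sup>2\<bar>
      \<le> \<gamma> * (1 + softabs t / (1 + \<epsilon> * softabs t)) powr (\<gamma> - 1) * 1"
    using \<gamma> by (intro mult_left_mono) auto
  ultimately show ?thesis using True \<gamma> unfolding trunc'_def by (simp only: abs_mult) simp
next
  case False
  then show ?thesis using softabs_small(2)[of t] by (simp add: trunc'_def)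
qed

lemma abs_trunc'_le_const: "\<bar>trunc' \<epsilon> \<gamma> t\<bar> \<le> \<gamma> * (1 + 1 / \<epsilon>) powr \<gamma>"
proof -
  have "\<bar>trunc' \<epsilon> \<gamma> t\<bar> \<le> \<gamma> * (1 + trunc \<epsilon> \<gamma> t) powr ((\<gamma> - 1) / \<gamma>) * 1"
    using abs_trunc'_le[of t] \<gamma> by (auto simp: indicator_def split: if_splits intro: order_trans)
  also have "(1 + trunc \<epsilon> \<gamma> t) powr ((\<gamma> - 1) / \<gamma>) = (1 + softabs t / (1 + \<epsilon> * softabs t)) powr (\<gamma> - 1)"
    using \<gamma> by (simp add: trunc_def powr_powr)
  also have "\<gamma> * (1 + softabs t / (1 + \<epsilon> * softabs t)) powr (\<gamma> - 1) * 1 \<le> \<gamma> * (1 + 1 / \<epsilon>) powr \<gamma>"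
  proof -
    have "(1 + softabs t / (1 + \<epsilon> * softabs t)) powr (\<gamma> - 1) \<le> (1 + 1 / \<epsilon>) powr (\<gamma> - 1)"
      using trunc_base[of t] \<gamma> by (intro powr_mono2) auto
    also have "\<dots> \<le> (1 + 1 / \<epsilon>) powr \<gamma>" using \<epsilon> by (intro powr_mono) auto
    finally show ?thesis using \<gamma> by simp
  qed
  finally show ?thesis .
qed

lemma trunc_small: "\<bar>t\<bar> \<le> 1 \<Longrightarrow> trunc \<epsilon> \<gamma> t = 0"
  by (simp add: trunc_def softabs_small)

end

text \<open>For |t| \<ge> 2 the power is at least 5/4, so after subtracting 1 at least a fifth of it
  is left.\<close>

lemma trunc_0_lower:
  assumes "1 \<le> \<gamma>" "2 \<le> \<bar>t\<bar>"
  shows "(\<bar>t\<bar> / 8) powr \<gamma> / 5 \<le> trunc 0 \<gamma> t"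
proof -
  have S: "\<bar>t\<bar> / 8 \<le> softabs t" "1 / 4 \<le> softabs t" using softabs_large[OF assms(2)] assms(2) by linarith+
  have "1 + softabs t = (1 + softabs t) powr 1" using S by simp
  also have "\<dots> \<le> (1 + softabs t) powr \<gamma>" using S assms by (intro powr_mono) auto
  finally have "5 / 4 \<le> (1 + softabs t) powr \<gamma>" using S by linarith
  moreover have "(\<bar>t\<bar> / 8) powr \<gamma> \<le> (1 + softabs t) powr \<gamma>"
    using S assms by (intro powr_mono2) auto
  ultimately show ?thesis by (simp add: trunc_def)
qed

lemma trunc_tendsto: "(\<lambda>k. trunc (1 / Suc k) \<gamma> t) \<longlonglongrightarrow> trunc 0 \<gamma> t"
proof -
  have e: "(\<lambda>k. 1 / real (Suc k)) \<longlonglongrightarrow> 0" using LIMSEQ_inverse_real_of_nat by (simp add: divide_inverse)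
  have "1 + softabs t / (1 + 0 * softabs t) \<noteq> 0" using softabs_nonneg[of t] by simp
  then show ?thesis unfolding trunc_def by (intro tendsto_intros e) auto
qed

section \<open>The embedding\<close>

text \<open>D plays the part of the dimension. The choice of \<gamma> gives (\<gamma> - 1)/\<gamma>
  = \<kappa>(1 - 1/p), the exponent that \<open>sobolev_absorption\<close> expects, and
  \<gamma>\<kappa> = Dp/(D - p), the exponent in the conclusion. Fatou's lemma removes
  \<epsilon>.\<close>

lemma level_estimate:
  fixes D p :: real
  assumes p: "1 \<le> p" "p < D" and D: "DIM('a::euclidean_space) \<noteq> 1 \<Longrightarrow> D = DIM('a)"
  shows "\<exists>m L. 0 < m \<and> 0 < L \<and> (\<forall>(u::'a \<Rightarrow> real) g. wgrad u g \<longrightarrow> emeasure mu {x. 1 < \<bar>u x\<bar>} \<le> ennreal m \<longrightarrow>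
      (\<integral>\<^sup>+x. ennreal (indicator {x. 1 < \<bar>u x\<bar>} x * (norm x * norm (g x)) powr p) \<partial>mu) \<le> 2 \<longrightarrow>
      (\<integral>\<^sup>+x. ennreal (indicator {x. 2 \<le> \<bar>u x\<bar>} x * \<bar>u x\<bar> powr (D * p / (D - p))) \<partial>mu) \<le> ennreal L)"
proof -
  define \<kappa> where "\<kappa> = D / (D - 1)"
  define \<gamma> where "\<gamma> = p * (D - 1) / (D - p)"
  have \<kappa>: "1 < \<kappa>" "DIM('a) \<noteq> 1 \<Longrightarrow> \<kappa> = DIM('a) / (DIM('a) - 1)"
    using p D by (auto simp: \<kappa>_def)
  have \<gamma>1: "1 \<le> \<gamma>"
  proof -
    have "D * 1 \<le> D * p" using p by (intro mult_left_mono) auto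
    then show ?thesis using p by (simp add: \<gamma>_def field_simps)
  qed
  have \<gamma>\<kappa>: "\<gamma> * \<kappa> = D * p / (D - p)" using p by (simp add: \<gamma>_def \<kappa>_def)
  have e\<gamma>: "(\<gamma> - 1) / \<gamma> = \<kappa> * (1 - 1 / p)"
  proof -
    have "\<gamma> - 1 = D * (p - 1) / (D - p)" using p by (simp add: \<gamma>_def field_simps)
    then have "(\<gamma> - 1) / \<gamma> = D * (p - 1) / (p * (D - 1))" using p by (simp add: \<gamma>_def)
    moreover have "1 - 1 / p = (p - 1) / p" using p by (simp add: diff_divide_distrib)
    ultimately show ?thesis by (simp add: \<kappa>_def mult.commute)
  qed
  define K where "K = (real DIM('a) + 3) * real DIM('a) ^ DIM('a)"
  have K: "0 < K" by (simp add: K_def add_pos_pos)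
  \<comment> \<open>\<open>small\<close> has two summands. The cap on \<open>m\<close> keeps the
    second one below \<tau>, so that 8K times 2\<tau> is exactly 1.\<close>
  define \<tau> where "\<tau> = 1 / (16 * K)"
  have \<tau>: "0 < \<tau>" using K by (simp add: \<tau>_def)
  define m where "m = min 1 (\<tau> / \<tau> powr (1 - D))"
  have m: "0 < m" "m \<le> 1" using \<tau> by (auto simp: m_def)
  have small: "8 * K * (\<tau> + \<tau> powr (1 - D) * m) \<le> 1"
  proof -
    have "\<tau> powr (1 - D) * m \<le> \<tau> powr (1 - D) * (\<tau> / \<tau> powr (1 - D))" unfolding m_def by (intro mult_left_mono) auto
    then have "\<tau> + \<tau> powr (1 - D) * m \<le> 2 * \<tau>" using \<tau> by simp
    then have "8 * K * (\<tau> + \<tau> powr (1 - D) * m) \<le> 8 * K * (2 * \<tau>)" using K by (intro mult_left_mono) auto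
    also have "\<dots> = 1" using K by (simp add: \<tau>_def)
    finally show ?thesis .
  qed
  define C where "C = 1 + (24 * K * \<gamma> * 2 powr (\<kappa> * (1 - 1 / p))) powr (1 / (1 / p - 1 / D))"
  have C: "0 < C" by (simp add: C_def add_pos_nonneg)
  \<comment> \<open>Undoes the constants of \<open>trunc_0_lower\<close>: the 8 under the power
    \<gamma>\<kappa>, the 5 under \<kappa>.\<close>
  define c where "c = (5 powr \<kappa>) * (8 powr (\<gamma> * \<kappa>))"
  have c: "0 < c" by (simp add: c_def)
  have "(\<integral>\<^sup>+x. ennreal (indicator {x. 2 \<le> \<bar>u x\<bar>} x * \<bar>u x\<bar> powr (D * p / (D - p))) \<partial>mu) \<le> ennreal (c * C)"
    if W: "wgrad u g" and Em: "emeasure mu {x. 1 < \<bar>u x\<bar>} \<le> ennreal m"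
      and Gi: "(\<integral>\<^sup>+x. ennreal (indicator {x. 1 < \<bar>u x\<bar>} x * (norm x * norm (g x)) powr p) \<partial>mu) \<le> 2"
    for u :: "'a \<Rightarrow> real" and g
  proof -
    have [measurable]: "u \<in> borel_measurable borel" "g \<in> borel_measurable borel" using W by (auto simp: wgrad_def)
    have bound: "(\<integral>\<^sup>+x. ennreal (trunc \<epsilon> \<gamma> (u x) powr \<kappa>) \<partial>mu) \<le> ennreal C" if \<epsilon>: "0 < \<epsilon>" for \<epsilon>
    proof -
      note tr = has_real_derivative_trunc[OF \<epsilon> \<gamma>1] continuous_trunc'[OF \<epsilon> \<gamma>1] trunc_nonneg[OF \<epsilon> \<gamma>1]
        trunc_le[OF \<epsilon> \<gamma>1] abs_trunc'_le_const[OF \<epsilon> \<gamma>1]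
      have [measurable]: "trunc \<epsilon> \<gamma> \<in> borel_measurable borel" "trunc' \<epsilon> \<gamma> \<in> borel_measurable borel"
        using tr(2) by (auto intro!: borel_measurable_continuous_onI continuous_at_imp_continuous_on DERIV_isCont[OF tr(1)])
      have "(\<integral>\<^sup>+x. ennreal (trunc \<epsilon> \<gamma> (u x) powr (D / (D - 1))) \<partial>mu)
        \<le> ennreal (1 + (24 * K * \<gamma> * 2 powr (D / (D - 1) * (1 - 1 / p))) powr (1 / (1 / p - 1 / D)))"
      proof (rule sobolev_absorption[where E="{x. 1 < \<bar>u x\<bar>}" and G="\<lambda>x. norm x * norm (g x)" and m=m and \<tau>=\<tau>])
        show "trunc \<epsilon> \<gamma> (u x) \<le> \<gamma> * (1 + 1 / \<epsilon>) powr \<gamma>" for x by (rule tr)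
        show "0 \<le> trunc \<epsilon> \<gamma> (u x)" for x by (rule tr)
        show "trunc \<epsilon> \<gamma> (u x) = 0" if "x \<notin> {x. 1 < \<bar>u x\<bar>}" for x
          using that by (intro trunc_small[OF \<epsilon> \<gamma>1]) auto
        fix J
        assume J: "(\<integral>\<^sup>+x. ennreal (\<gamma> * (1 + trunc \<epsilon> \<gamma> (u x)) powr (D / (D - 1) * (1 - 1 / p)) * indicator {x. 1 < \<bar>u x\<bar>} x * (norm x * norm (g x)) + trunc \<epsilon> \<gamma> (u x)) \<partial>mu) < ennreal J"
        have "(\<integral>\<^sup>+x. ennreal (\<bar>trunc' \<epsilon> \<gamma> (u x)\<bar> * (norm x * norm (g x)) + trunc \<epsilon> \<gamma> (u x)) \<partial>mu)
         \<le> (\<integral>\<^sup>+x. ennreal (\<gamma> * (1 + trunc \<epsilon> \<gamma> (u x)) powr (D / (D - 1) * (1 - 1 / p)) * indicator {x. 1 < \<bar>u x\<bar>} x * (norm x * norm (g x)) + trunc \<epsilon> \<gamma> (u x)) \<partial>mu)"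
        proof (intro nn_integral_mono ennreal_leI add_right_mono mult_right_mono)
          fix x
          show "\<bar>trunc' \<epsilon> \<gamma> (u x)\<bar> \<le> \<gamma> * (1 + trunc \<epsilon> \<gamma> (u x)) powr (D / (D - 1) * (1 - 1 / p)) * indicator {x. 1 < \<bar>u x\<bar>} x"
            using abs_trunc'_le[OF \<epsilon> \<gamma>1, of "u x"] unfolding e\<gamma> \<kappa>_def[symmetric] by (simp add: indicator_def)
        qed simp
        with J have J': "(\<integral>\<^sup>+x. ennreal (\<bar>trunc' \<epsilon> \<gamma> (u x)\<bar> * (norm x * norm (g x)) + trunc \<epsilon> \<gamma> (u x)) \<partial>mu) < ennreal J"
          by order
        show "(\<integral>\<^sup>+x. ennreal (trunc \<epsilon> \<gamma> (u x) powr (D / (D - 1))) \<partial>mu) \<le> ennreal ((K * J) powr (D / (D - 1)))"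
          using key_inequality[OF W \<kappa> tr J'] unfolding K_def \<kappa>_def .
      qed (use p K \<gamma>1 \<tau> m small Em Gi in auto)
      then show ?thesis by (simp only: C_def \<kappa>_def)
    qed
    have [measurable]: "trunc (1 / Suc k) \<gamma> \<in> borel_measurable borel" for k
      by (intro borel_measurable_continuous_onI continuous_at_imp_continuous_on ballI DERIV_isCont[OF has_real_derivative_trunc] \<gamma>1) auto
    have [measurable]: "trunc 0 \<gamma> \<in> borel_measurable borel"
      by (rule borel_measurable_LIMSEQ_real[OF trunc_tendsto]) measurable
    have t0: "0 \<le> trunc 0 \<gamma> t" for t
      by (rule LIMSEQ_le_const[OF trunc_tendsto]) (auto intro!: trunc_nonneg \<gamma>1)
    have "(\<integral>\<^sup>+x. ennreal (trunc 0 \<gamma> (u x) powr \<kappa>) \<partial>mu) = (\<integral>\<^sup>+x. liminf (\<lambda>k. ennreal (trunc (1 / Suc k) \<gamma> (u x) powr \<kappa>)) \<partial>mu)"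
    proof (intro nn_integral_cong)
      fix x
      have "(\<lambda>k. ennreal (trunc (1 / Suc k) \<gamma> (u x) powr \<kappa>)) \<longlonglongrightarrow> ennreal (trunc 0 \<gamma> (u x) powr \<kappa>)"
        using \<kappa>(1) by (intro tendsto_ennrealI tendsto_powr' trunc_tendsto tendsto_const) (auto intro!: always_eventually trunc_nonneg \<gamma>1)
      then show "ennreal (trunc 0 \<gamma> (u x) powr \<kappa>) = liminf (\<lambda>k. ennreal (trunc (1 / Suc k) \<gamma> (u x) powr \<kappa>))"
        by (rule lim_imp_Liminf[OF sequentially_bot, symmetric])
    qed
    also have "\<dots> \<le> liminf (\<lambda>k. \<integral>\<^sup>+x. ennreal (trunc (1 / Suc k) \<gamma> (u x) powr \<kappa>) \<partial>mu)"
      by (rule nn_integral_liminf) measurable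
    also have "\<dots> \<le> liminf (\<lambda>k. ennreal C)"
      by (intro Liminf_mono always_eventually allI bound) auto
    also have "\<dots> = ennreal C" by (simp add: Liminf_const)
    finally have fin: "(\<integral>\<^sup>+x. ennreal (trunc 0 \<gamma> (u x) powr \<kappa>) \<partial>mu) \<le> ennreal C" .
    have pt: "indicator {x. 2 \<le> \<bar>u x\<bar>} x * \<bar>u x\<bar> powr (D * p / (D - p)) \<le> c * trunc 0 \<gamma> (u x) powr \<kappa>" for x
    proof (cases "2 \<le> \<bar>u x\<bar>")
      case True
      have "((\<bar>u x\<bar> / 8) powr \<gamma> / 5) powr \<kappa> \<le> trunc 0 \<gamma> (u x) powr \<kappa>"
        using \<kappa>(1) by (intro powr_mono2 trunc_0_lower \<gamma>1 True) auto
      moreover have "((\<bar>u x\<bar> / 8) powr \<gamma> / 5) powr \<kappa> = \<bar>u x\<bar> powr (\<gamma> * \<kappa>) / c"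
        by (simp add: powr_divide powr_mult powr_powr c_def mult.commute)
      ultimately show ?thesis using True c by (simp add: \<gamma>\<kappa>[symmetric] pos_divide_le_eq mult.commute)
    qed (use c in simp)
    have "(\<integral>\<^sup>+x. ennreal (indicator {x. 2 \<le> \<bar>u x\<bar>} x * \<bar>u x\<bar> powr (D * p / (D - p))) \<partial>mu)
      \<le> (\<integral>\<^sup>+x. ennreal c * ennreal (trunc 0 \<gamma> (u x) powr \<kappa>) \<partial>mu)"
      using pt c by (intro nn_integral_mono) (simp add: ennreal_mult'[symmetric] ennreal_leI)
    also have "\<dots> = ennreal c * (\<integral>\<^sup>+x. ennreal (trunc 0 \<gamma> (u x) powr \<kappa>) \<partial>mu)"
      by (rule nn_integral_cmult) measurable
    also have "\<dots> \<le> ennreal c * ennreal C" using fin by (intro mult_left_mono) auto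
    also have "\<dots> = ennreal (c * C)" using c by (simp add: ennreal_mult')
    finally show ?thesis .
  qed
  then show ?thesis using m C c by (intro exI[of _ m] exI[of _ "c * C"]) auto
qed

lemma wgrad_scale:
  assumes "wgrad u g"
  shows "wgrad (\<lambda>x. c * u x) (\<lambda>x. c *\<^sub>R g x)"
proof -
  have [measurable]: "u \<in> borel_measurable borel" "g \<in> borel_measurable borel" using assms by (auto simp: wgrad_def)
  have 1: "integrable lborel (\<lambda>x. indicator (annulus r R) x * (c * u x))" if "0 < r" for r R
  proof -
    have "integrable lborel (\<lambda>x. c * (indicator (annulus r R) x * u x))"
      using assms that by (intro integrable_mult_right) (auto simp: wgrad_def)
    then show ?thesis by (simp add: mult.left_commute)
  qed
  have 2: "integrable lborel (\<lambda>x. indicator (annulus r R) x * (c *\<^sub>R g x \<bullet> i))" if "0 < r" "i \<in> Basis" for r R i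
  proof -
    have "integrable lborel (\<lambda>x. c * (indicator (annulus r R) x * (g x \<bullet> i)))"
      using assms that by (intro integrable_mult_right) (auto simp: wgrad_def)
    then show ?thesis by (simp add: mult.left_commute)
  qed
  have 3: "(\<integral>x. c * u x * frechet_derivative \<phi> (at x) i \<partial>lborel) = - (\<integral>x. (c *\<^sub>R g x \<bullet> i) * \<phi> x \<partial>lborel)"
    if "test_fun_punct \<phi>" "i \<in> Basis" for \<phi> i
  proof -
    have "(\<integral>x. u x * frechet_derivative \<phi> (at x) i \<partial>lborel) = - (\<integral>x. (g x \<bullet> i) * \<phi> x \<partial>lborel)"
      using assms that by (auto simp: wgrad_def)
    then have "c * (\<integral>x. u x * frechet_derivative \<phi> (at x) i \<partial>lborel) = - (c * (\<integral>x. (g x \<bullet> i) * \<phi> x \<partial>lborel))" by simp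
    then show ?thesis by (simp add: mult.assoc)
  qed
  show ?thesis unfolding wgrad_def using 1 2 3 by auto
qed

text \<open>For N = 1, t = 1 and D = (r + 1)/r give the conjugate exponent r + 1. For p < N nothing
  is changed. For p \<ge> N \<ge> 2, t = Ns/(N + s) is the exponent below N whose Sobolev conjugate
  is s = max r 2; taking s \<ge> 2 ensures N + s \<le> Ns, that is t \<ge> 1.\<close>

lemma exponent_choice:
  fixes p r :: real and N :: nat
  assumes "1 \<le> p" "1 \<le> r" "1 \<le> N" "p \<ge> N \<or> r \<le> N * p / (N - p)"
  shows "\<exists>D t. 1 \<le> t \<and> t \<le> p \<and> t < D \<and> (N \<noteq> 1 \<longrightarrow> D = real N) \<and> r \<le> D * t / (D - t)"
proof (cases "N = 1")
  case True
  define D where "D = (r + 1) / r"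
  have "D * 1 / (D - 1) = r + 1" "1 < D" using assms by (simp_all add: D_def field_simps)
  then show ?thesis using True assms by (intro exI[of _ D] exI[of _ 1]) auto
next
  case False
  show ?thesis
  proof (cases "p < N")
    case True
    then show ?thesis using assms False by (intro exI[of _ "real N"] exI[of _ p]) auto
  next
    case pN: False
    have N2: "2 \<le> real N" using False assms(3) by simp
    define s where "s = max r 2"
    define t where "t = N * s / (N + s)"
    have s: "r \<le> s" "2 \<le> s" by (auto simp: s_def)
    have t: "t < N" using N2 s by (simp add: t_def pos_divide_less_eq algebra_simps)
    have "2 * s \<le> N * s" "2 * N \<le> N * s" using N2 s by (auto intro: mult_right_mono simp: mult.commute[of 2])
    then have "N + s \<le> N * s" by linarith
    then have t1: "1 \<le> t" using N2 s by (simp add: t_def)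
    have "N - t = N * N / (N + s)" using N2 s by (simp add: t_def field_simps)
    then have "N * t / (N - t) = s" using N2 s by (simp add: t_def)
    then show ?thesis using t t1 s pN by (intro exI[of _ "real N"] exI[of _ t]) auto
  qed
qed

text \<open>Both norms are bounded by a common A, and v = (c/A) u brings them down to a universal
  size. Chebyshev's inequality then makes the measure of {|v| > 1} small enough for
  \<open>level_estimate\<close>, and homogeneity carries the result back to u.\<close>

lemma embedding_borel:
  fixes p q r :: real
  assumes pqr: "1 \<le> p" "1 \<le> q" "1 \<le> r" "q < r"
    and pr: "p \<ge> real DIM('a::euclidean_space) \<or> r \<le> real DIM('a) * p / (real DIM('a) - p)"
  shows "\<exists>C>0. \<forall>(u::'a \<Rightarrow> real) g A. wgrad u g \<longrightarrow> 0 < A \<longrightarrow>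
      (\<integral>\<^sup>+x. ennreal (\<bar>u x\<bar> powr q) \<partial>mu) \<le> ennreal (A powr q) \<longrightarrow>
      (\<integral>\<^sup>+x. ennreal ((norm x * norm (g x)) powr p) \<partial>mu) \<le> ennreal (A powr p) \<longrightarrow>
      (\<integral>\<^sup>+x. ennreal (\<bar>u x\<bar> powr r) \<partial>mu) \<le> ennreal ((C * A) powr r)"
proof -
  obtain D t where t: "1 \<le> t" "t \<le> p" "t < D" "DIM('a) \<noteq> 1 \<Longrightarrow> D = DIM('a)" "r \<le> D * t / (D - t)"
    using exponent_choice[of p r "DIM('a)"] assms by (auto simp: Suc_leI)
  from level_estimate[OF t(1,3,4)] obtain m L where m: "0 < m" "0 < L" and
    lev: "\<And>(u::'a \<Rightarrow> real) g. wgrad u g \<Longrightarrow> emeasure mu {x. 1 < \<bar>u x\<bar>} \<le> ennreal m \<Longrightarrow>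
      (\<integral>\<^sup>+x. ennreal (indicator {x. 1 < \<bar>u x\<bar>} x * (norm x * norm (g x)) powr t) \<partial>mu) \<le> 2 \<Longrightarrow>
      (\<integral>\<^sup>+x. ennreal (indicator {x. 2 \<le> \<bar>u x\<bar>} x * \<bar>u x\<bar> powr (D * t / (D - t))) \<partial>mu) \<le> ennreal L"
    by blast
  \<comment> \<open>c^q \<le> m controls the measure of the level set; c \<le> 1 keeps that measure
    and the gradient integral below 1 each, which adds up to the 2 in
    \<open>level_estimate\<close>.\<close>
  define c where "c = min 1 (m powr (1 / q))"
  have c: "0 < c" "c \<le> 1" using m by (auto simp: c_def)
  have cq: "c powr q \<le> m" "c powr q \<le> 1" "c powr p \<le> 1"
  proof -
    have "c powr q \<le> (m powr (1 / q)) powr q" using pqr c by (intro powr_mono2) (auto simp: c_def)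
    then show "c powr q \<le> m" using pqr m by (simp add: powr_powr)
    show "c powr q \<le> 1" "c powr p \<le> 1" using powr_le1[of q c] powr_le1[of p c] pqr c by auto
  qed
  define L' where "L' = 2 powr (r - q) + L"
  have L': "0 < L'" using m by (simp add: L'_def add_pos_pos)
  have "(\<integral>\<^sup>+x. ennreal (\<bar>u x\<bar> powr r) \<partial>mu) \<le> ennreal ((L' powr (1 / r) / c * A) powr r)"
    if W: "wgrad u g" and A: "0 < A"
      and uq: "(\<integral>\<^sup>+x. ennreal (\<bar>u x\<bar> powr q) \<partial>mu) \<le> ennreal (A powr q)"
      and gp: "(\<integral>\<^sup>+x. ennreal ((norm x * norm (g x)) powr p) \<partial>mu) \<le> ennreal (A powr p)"
    for u :: "'a \<Rightarrow> real" and g A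
  proof -
    have [measurable]: "u \<in> borel_measurable borel" "g \<in> borel_measurable borel" using W by (auto simp: wgrad_def)
    define d where "d = c / A"
    have d: "0 < d" "d * A = c" using c A by (auto simp: d_def)
    define v where "v x = d * u x" for x
    define h where "h x = d *\<^sub>R g x" for x
    have Wv: "wgrad v h" unfolding v_def[abs_def] h_def[abs_def] by (rule wgrad_scale[OF W])
    have [measurable]: "v \<in> borel_measurable borel" "h \<in> borel_measurable borel" using Wv by (auto simp: wgrad_def)
    have scale: "(\<integral>\<^sup>+x. ennreal ((d * f x) powr e) \<partial>mu) = ennreal (d powr e) * (\<integral>\<^sup>+x. ennreal (f x powr e) \<partial>mu)"
      if "f \<in> borel_measurable borel" "\<And>x. 0 \<le> f x" for f :: "'a \<Rightarrow> real" and e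
    proof -
      note [measurable] = that(1)
      have "(\<integral>\<^sup>+x. ennreal ((d * f x) powr e) \<partial>mu) = (\<integral>\<^sup>+x. ennreal (d powr e) * ennreal (f x powr e) \<partial>mu)"
        using d that(2) by (intro nn_integral_cong) (simp add: powr_mult ennreal_mult')
      then show ?thesis by (simp add: nn_integral_cmult)
    qed
    have vabs: "\<bar>v x\<bar> = d * \<bar>u x\<bar>" "norm x * norm (h x) = d * (norm x * norm (g x))" for x
      using d by (auto simp: v_def h_def abs_mult)
    have vq: "(\<integral>\<^sup>+x. ennreal (\<bar>v x\<bar> powr q) \<partial>mu) \<le> ennreal (c powr q)"
    proof -
      have "(\<integral>\<^sup>+x. ennreal (\<bar>v x\<bar> powr q) \<partial>mu) \<le> ennreal (d powr q) * ennreal (A powr q)"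
        unfolding vabs by (subst scale) (auto intro!: mult_left_mono uq)
      also have "\<dots> = ennreal (c powr q)" using d A by (simp add: ennreal_mult'[symmetric] powr_mult[symmetric])
      finally show ?thesis .
    qed
    have hp: "(\<integral>\<^sup>+x. ennreal ((norm x * norm (h x)) powr p) \<partial>mu) \<le> 1"
    proof -
      have "(\<integral>\<^sup>+x. ennreal ((norm x * norm (h x)) powr p) \<partial>mu) \<le> ennreal (d powr p) * ennreal (A powr p)"
        unfolding vabs by (subst scale) (auto intro!: mult_left_mono gp)
      also have "\<dots> = ennreal (c powr p)" using d A by (simp add: ennreal_mult'[symmetric] powr_mult[symmetric])
      also have "\<dots> \<le> 1" using cq by (simp add: ennreal_le_1)
      finally show ?thesis .
    qed
    define E where "E = {x. 1 < \<bar>v x\<bar>}"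
    have E[measurable]: "E \<in> sets borel" unfolding E_def by measurable
    have Em: "emeasure mu E \<le> ennreal (c powr q)"
    proof -
      have "emeasure mu E = (\<integral>\<^sup>+x. indicator E x \<partial>mu)" by simp
      also have "\<dots> \<le> (\<integral>\<^sup>+x. ennreal (\<bar>v x\<bar> powr q) \<partial>mu)"
      proof (intro nn_integral_mono)
        fix x show "indicator E x \<le> ennreal (\<bar>v x\<bar> powr q)"
          using pqr by (auto simp: E_def indicator_def ennreal_ge_1 intro!: ge_one_powr_ge_zero)
      qed
      finally show ?thesis using vq by order
    qed
    have "(\<integral>\<^sup>+x. ennreal (indicator E x * (norm x * norm (h x)) powr t) \<partial>mu)
       \<le> (\<integral>\<^sup>+x. indicator E x + ennreal ((norm x * norm (h x)) powr p) \<partial>mu)"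
    proof (intro nn_integral_mono)
      fix x
      define b where "b = norm x * norm (h x)"
      \<comment> \<open>Lowering the exponent from p to t costs a constant, which on the level set
        integrates to at most 1.\<close>
      have "b powr t \<le> 1 + b powr p"
      proof (cases "1 \<le> b")
        case True
        then have "b powr t \<le> b powr p" using t by (intro powr_mono) auto
        then show ?thesis by linarith
      next
        case False
        then have "b powr t \<le> 1" using t by (intro powr_le1) (auto simp: b_def)
        then show ?thesis using powr_ge_zero[of b p] by linarith
      qed
      then have "ennreal (b powr t) \<le> 1 + ennreal (b powr p)"
        by (simp add: ennreal_leI flip: ennreal_1 ennreal_plus)
      then show "ennreal (indicator E x * (norm x * norm (h x)) powr t) \<le> indicator E x + ennreal ((norm x * norm (h x)) powr p)"
        by (cases "x \<in> E") (auto simp: b_def)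
    qed
    also have "\<dots> = emeasure mu E + (\<integral>\<^sup>+x. ennreal ((norm x * norm (h x)) powr p) \<partial>mu)"
      by (subst nn_integral_add) auto
    also have "\<dots> \<le> 1 + 1"
      using Em hp cq(2) by (intro add_mono) (auto intro: order_trans simp: ennreal_le_1)
    finally have "(\<integral>\<^sup>+x. ennreal (indicator E x * (norm x * norm (h x)) powr t) \<partial>mu) \<le> 2" by simp
    moreover have "emeasure mu E \<le> ennreal m" using Em cq(1) by (auto intro: order_trans ennreal_leI)
    ultimately have lv: "(\<integral>\<^sup>+x. ennreal (indicator {x. 2 \<le> \<bar>v x\<bar>} x * \<bar>v x\<bar> powr (D * t / (D - t))) \<partial>mu) \<le> ennreal L"
      using lev[OF Wv] unfolding E_def by blast
    have "(\<integral>\<^sup>+x. ennreal (\<bar>v x\<bar> powr r) \<partial>mu) \<le> (\<integral>\<^sup>+x. ennreal (2 powr (r - q)) * ennreal (\<bar>v x\<bar> powr q)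
       + ennreal (indicator {x. 2 \<le> \<bar>v x\<bar>} x * \<bar>v x\<bar> powr (D * t / (D - t))) \<partial>mu)"
    proof (intro nn_integral_mono)
      fix x
      \<comment> \<open>Below the level 2 the surplus power r - q is bounded and the L^q norm
        suffices; above it r does not exceed the exponent of \<open>level_estimate\<close>.\<close>
      have "\<bar>v x\<bar> powr r \<le> 2 powr (r - q) * \<bar>v x\<bar> powr q + indicator {x. 2 \<le> \<bar>v x\<bar>} x * \<bar>v x\<bar> powr (D * t / (D - t))"
      proof (cases "2 \<le> \<bar>v x\<bar>")
        case True
        then have "\<bar>v x\<bar> powr r \<le> \<bar>v x\<bar> powr (D * t / (D - t))" using t by (intro powr_mono) auto
        moreover have "0 \<le> 2 powr (r - q) * \<bar>v x\<bar> powr q" by simp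

        ultimately have "\<bar>v x\<bar> powr r \<le> 2 powr (r - q) * \<bar>v x\<bar> powr q + \<bar>v x\<bar> powr (D * t / (D - t))" by linarith
        then show ?thesis using True by simp
      next
        case False
        have "\<bar>v x\<bar> powr r = \<bar>v x\<bar> powr (r - q) * \<bar>v x\<bar> powr q" by (simp add: powr_add[symmetric])
        also have "\<dots> \<le> 2 powr (r - q) * \<bar>v x\<bar> powr q"
          using False pqr by (intro mult_right_mono powr_mono2) auto
        finally show ?thesis using False by simp
      qed
      then show "ennreal (\<bar>v x\<bar> powr r) \<le> ennreal (2 powr (r - q)) * ennreal (\<bar>v x\<bar> powr q)
       + ennreal (indicator {x. 2 \<le> \<bar>v x\<bar>} x * \<bar>v x\<bar> powr (D * t / (D - t)))"
        by (simp add: ennreal_mult'[symmetric] ennreal_leI flip: ennreal_plus)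
    qed
    also have "\<dots> = ennreal (2 powr (r - q)) * (\<integral>\<^sup>+x. ennreal (\<bar>v x\<bar> powr q) \<partial>mu)
       + (\<integral>\<^sup>+x. ennreal (indicator {x. 2 \<le> \<bar>v x\<bar>} x * \<bar>v x\<bar> powr (D * t / (D - t))) \<partial>mu)"
      by (simp add: nn_integral_add nn_integral_cmult)
    also have "\<dots> \<le> ennreal (2 powr (r - q)) * 1 + ennreal L"
      using vq cq(2) lv by (intro add_mono mult_left_mono) (auto intro: order_trans simp: ennreal_le_1)
    also have "\<dots> = ennreal L'" using m by (simp add: L'_def)
    finally have vr: "(\<integral>\<^sup>+x. ennreal (\<bar>v x\<bar> powr r) \<partial>mu) \<le> ennreal L'" .
    have "(\<integral>\<^sup>+x. ennreal (\<bar>u x\<bar> powr r) \<partial>mu) = (\<integral>\<^sup>+x. ennreal ((1 / d) powr r) * ennreal (\<bar>v x\<bar> powr r) \<partial>mu)"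
      using d by (intro nn_integral_cong) (simp add: vabs ennreal_mult'[symmetric] powr_mult[symmetric])
    also have "\<dots> = ennreal ((1 / d) powr r) * (\<integral>\<^sup>+x. ennreal (\<bar>v x\<bar> powr r) \<partial>mu)"
      by (rule nn_integral_cmult) measurable
    also have "\<dots> \<le> ennreal ((1 / d) powr r) * ennreal L'" using vr by (intro mult_left_mono) auto
    also have "\<dots> = ennreal ((1 / d) powr r * L')" by (simp add: ennreal_mult')
    also have "(1 / d) powr r * L' = (1 / d) powr r * (L' powr (1 / r)) powr r" using pqr L' by (simp add: powr_powr)
    also have "\<dots> = (1 / d * L' powr (1 / r)) powr r" using d by (subst powr_mult) auto
    also have "1 / d * L' powr (1 / r) = L' powr (1 / r) / c * A" using A c by (simp add: d_def)
    finally show ?thesis .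
  qed
  moreover have "0 < L' powr (1 / r) / c" using L' c by simp
  ultimately show ?thesis by blast
qed

section \<open>Borel representatives and weighted norms\<close>

lemma loc_int_punct_representative:
  fixes u u0 :: "'a::euclidean_space \<Rightarrow> real"
  assumes "loc_int_punct u" "AE x in lborel. u x = u0 x" and [measurable]: "u0 \<in> borel_measurable borel" and "0 < r"
  shows "integrable lborel (\<lambda>x. indicator (annulus r R) x * u0 x)"
proof -
  have "annulus r R = cball 0 R - ball (0::'a) r" by (auto simp: annulus_def)
  then have "compact (annulus r R :: 'a set)" by (simp add: compact_diff)
  moreover have "annulus r R \<subseteq> - {0::'a}" using \<open>0 < r\<close> by (auto simp: annulus_def)
  ultimately have int: "integrable lebesgue (\<lambda>x. indicator (annulus r R) x *\<^sub>R u x)"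
    using assms(1) unfolding loc_int_punct_def set_integrable_def by blast
  have "integrable lebesgue (\<lambda>x. indicator (annulus r R) x * u0 x)"
  proof (rule integrable_cong_AE_imp[OF int])
    show "(\<lambda>x. indicator (annulus r R) x * u0 x) \<in> borel_measurable lebesgue"
      by (rule measurable_completion) measurable
    have "AE x in lborel. indicator (annulus r R) x *\<^sub>R u x = indicator (annulus r R) x * u0 x"
      using assms(2) by eventually_elim simp
    then show "AE x in lebesgue. indicator (annulus r R) x *\<^sub>R u x = indicator (annulus r R) x * u0 x"
      by (rule AE_completion)
  qed
  then show ?thesis by (subst (asm) integrable_completion) auto
qed

lemma borel_representative_vector:
  fixes g :: "'a::euclidean_space \<Rightarrow> 'b::euclidean_space"
  assumes "g \<in> borel_measurable lebesgue"
  shows "\<exists>g0\<in>borel_measurable borel. AE x in lborel. g x = g0 x"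
proof -
  have "\<forall>b. \<exists>g'. g' \<in> borel_measurable lborel \<and> (AE x in lborel. g x \<bullet> b = g' x)"
    using assms by (intro allI completion_ex_borel_measurable_real[unfolded Bex_def]) auto
  from choice[OF this] obtain G where G: "\<And>b. G b \<in> borel_measurable lborel" "\<And>b. AE x in lborel. g x \<bullet> b = G b x" by blast
  have [measurable]: "G b \<in> borel_measurable borel" for b using G(1)[of b] by simp
  have "AE x in lborel. \<forall>b\<in>Basis. g x \<bullet> b = G b x"
    using G(2) by (intro AE_finite_allI) auto
  then have "AE x in lborel. g x = (\<Sum>b\<in>Basis. G b x *\<^sub>R b)"
  proof eventually_elim
    case (elim x)
    have "g x = (\<Sum>b\<in>Basis. (g x \<bullet> b) *\<^sub>R b)" by (simp add: euclidean_representation)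
    then show ?case using elim by simp
  qed
  moreover have "(\<lambda>x. \<Sum>b\<in>Basis. G b x *\<^sub>R b) \<in> borel_measurable borel" by measurable
  ultimately show ?thesis by (rule bexI)
qed

text \<open>Membership in the space concerns Lebesgue measurable functions, while Tonelli and line
  integrals are applied to Borel ones. A change on a null set alters none of the integrals in the
  weak formulation.\<close>

lemma wgrad_representative:
  fixes u :: "'a::euclidean_space \<Rightarrow> real"
  assumes "weak_grad_punct u g" "u \<in> borel_measurable lebesgue" "g \<in> borel_measurable lebesgue"
  shows "\<exists>u0 g0. wgrad u0 g0 \<and> (AE x in lborel. u x = u0 x) \<and> (AE x in lborel. g x = g0 x)"
proof -
  obtain u0 where u0[measurable]: "u0 \<in> borel_measurable borel" and ae: "AE x in lborel. u x = u0 x"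
    using borel_representative_vector[OF assms(2)] by blast
  obtain g0 where g0[measurable]: "g0 \<in> borel_measurable borel" and aeg: "AE x in lborel. g x = g0 x"
    using borel_representative_vector[OF assms(3)] by blast
  have aei: "AE x in lborel. g x \<bullet> i = g0 x \<bullet> i" for i using aeg by eventually_elim simp
  have weak: "(\<integral>x. u0 x * frechet_derivative \<phi> (at x) i \<partial>lborel) = - (\<integral>x. (g0 x \<bullet> i) * \<phi> x \<partial>lborel)"
    if \<phi>: "test_fun_punct \<phi>" and i: "i \<in> Basis" for \<phi> i
  proof -
    have C: "Cinf_on UNIV \<phi>" using \<phi> by (simp add: test_fun_punct_def)
    obtain \<phi>' where \<phi>': "\<And>x. (\<phi> has_derivative \<phi>' x) (at x)" "\<And>v. continuous_on UNIV (\<lambda>x. \<phi>' x v)"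
      using Cinf_on_has_continuous_derivative[OF C] by blast
    have fd: "frechet_derivative \<phi> (at x) = \<phi>' x" for x
      using frechet_derivative_at[OF \<phi>'(1)] by simp
    have "continuous_on UNIV \<phi>" by (intro continuous_at_imp_continuous_on ballI has_derivative_continuous[OF \<phi>'(1)])
    then have [measurable]: "\<phi> \<in> borel_measurable borel" "(\<lambda>x. \<phi>' x i) \<in> borel_measurable borel"
      using \<phi>'(2) by (auto intro: borel_measurable_continuous_onI)
    have [measurable]: "\<phi> \<in> borel_measurable lebesgue" "(\<lambda>x. \<phi>' x i) \<in> borel_measurable lebesgue"
      "u0 \<in> borel_measurable lebesgue" "(\<lambda>x. g0 x \<bullet> i) \<in> borel_measurable lebesgue"
      by (auto intro!: measurable_completion)
    have [measurable]: "u \<in> borel_measurable lebesgue" "(\<lambda>x. g x \<bullet> i) \<in> borel_measurable lebesgue" using assms by auto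
    have "(\<integral>x. u x * \<phi>' x i \<partial>lebesgue) = (\<integral>x. u0 x * \<phi>' x i \<partial>lebesgue)"
    proof (rule integral_cong_AE)
      have "AE x in lborel. u x * \<phi>' x i = u0 x * \<phi>' x i" using ae by eventually_elim simp
      then show "AE x in lebesgue. u x * \<phi>' x i = u0 x * \<phi>' x i" by (rule AE_completion)
    qed measurable
    also have "\<dots> = (\<integral>x. u0 x * \<phi>' x i \<partial>lborel)" by (rule integral_completion) measurable
    finally have 1: "(\<integral>x. u x * \<phi>' x i \<partial>lebesgue) = (\<integral>x. u0 x * \<phi>' x i \<partial>lborel)" .
    have "(\<integral>x. (g x \<bullet> i) * \<phi> x \<partial>lebesgue) = (\<integral>x. (g0 x \<bullet> i) * \<phi> x \<partial>lebesgue)"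
    proof (rule integral_cong_AE)
      have "AE x in lborel. (g x \<bullet> i) * \<phi> x = (g0 x \<bullet> i) * \<phi> x" using aei[of i] by eventually_elim simp
      then show "AE x in lebesgue. (g x \<bullet> i) * \<phi> x = (g0 x \<bullet> i) * \<phi> x" by (rule AE_completion)
    qed measurable
    also have "\<dots> = (\<integral>x. (g0 x \<bullet> i) * \<phi> x \<partial>lborel)" by (rule integral_completion) measurable
    finally have 2: "(\<integral>x. (g x \<bullet> i) * \<phi> x \<partial>lebesgue) = (\<integral>x. (g0 x \<bullet> i) * \<phi> x \<partial>lborel)" .
    have "(\<integral>x. u x * frechet_derivative \<phi> (at x) i \<partial>lebesgue) = - (\<integral>x. (g x \<bullet> i) * \<phi> x \<partial>lebesgue)"
      using assms(1) \<phi> i unfolding weak_grad_punct_def by blast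
    then show ?thesis unfolding fd 1 2 .
  qed
  have "wgrad u0 g0"
    unfolding wgrad_def
    using assms(1) weak loc_int_punct_representative[OF _ ae u0] loc_int_punct_representative[OF _ aei]
    by (auto simp: weak_grad_punct_def)
  then show ?thesis using ae aeg by blast
qed

lemma wint_mu_real:
  fixes u u0 :: "'a::euclidean_space \<Rightarrow> real"
  assumes "AE x in lborel. u x = u0 x" and [measurable]: "u0 \<in> borel_measurable borel"
  shows "wint (- real DIM('a)) s u = (\<integral>\<^sup>+x. ennreal (\<bar>u0 x\<bar> powr s) \<partial>mu)"
proof -
  have "wint (- real DIM('a)) s u = (\<integral>\<^sup>+x. ennreal (norm x powr (- real DIM('a)) * norm (u x) powr s) \<partial>lborel)"
    unfolding wint_def by (rule nn_integral_completion)
  also have "\<dots> = (\<integral>\<^sup>+x. ennreal (\<bar>u0 x\<bar> powr s * norm x powr (- real DIM('a))) \<partial>lborel)"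
  proof (rule nn_integral_cong_AE)
    show "AE x in lborel. ennreal (norm x powr (- real DIM('a)) * norm (u x) powr s) =
        ennreal (\<bar>u0 x\<bar> powr s * norm x powr (- real DIM('a)))"
      using assms(1) by eventually_elim (simp add: mult.commute)
  qed
  also have "\<dots> = (\<integral>\<^sup>+x. ennreal (\<bar>u0 x\<bar> powr s) \<partial>mu)"
    by (rule nn_integral_mu_ennreal[symmetric]) measurable
  finally show ?thesis .
qed

text \<open>|x|^(p-N) |g|^p = (|x||g|)^p |x|^(-N): in this weight the gradient is measured with the
  metric of the cylinder. At the origin both sides are 0, since \<open>0 powr a = 0\<close>.\<close>

lemma wint_mu_grad:
  fixes g g0 :: "'a::euclidean_space \<Rightarrow> 'a"
  assumes "AE x in lborel. g x = g0 x" and [measurable]: "g0 \<in> borel_measurable borel"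
  shows "wint (p - real DIM('a)) p g = (\<integral>\<^sup>+x. ennreal ((norm x * norm (g0 x)) powr p) \<partial>mu)"
proof -
  have "wint (p - real DIM('a)) p g = (\<integral>\<^sup>+x. ennreal (norm x powr (p - real DIM('a)) * norm (g x) powr p) \<partial>lborel)"
    unfolding wint_def by (rule nn_integral_completion)
  also have "\<dots> = (\<integral>\<^sup>+x. ennreal ((norm x * norm (g0 x)) powr p * norm x powr (- real DIM('a))) \<partial>lborel)"
  proof (rule nn_integral_cong_AE)
    show "AE x in lborel. ennreal (norm x powr (p - real DIM('a)) * norm (g x) powr p) =
        ennreal ((norm x * norm (g0 x)) powr p * norm x powr (- real DIM('a)))"
      using assms(1) by eventually_elim (simp add: powr_mult powr_diff powr_minus divide_inverse mult_ac)
  qed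
  also have "\<dots> = (\<integral>\<^sup>+x. ennreal ((norm x * norm (g0 x)) powr p) \<partial>mu)"
    by (rule nn_integral_mu_ennreal[symmetric]) measurable
  finally show ?thesis .
qed

lemma wint_eq_wnorm_powr:
  assumes "wint d s u < \<infinity>" "0 < s"
  shows "wint d s u = ennreal (wnorm d s u powr s)"
  using assms by (simp add: wnorm_def powr_powr)

lemma weighted_embedding:
  fixes p q r :: real
  assumes pqr: "1 \<le> p" "1 \<le> q" "1 \<le> r" "q < r"
    and pr: "p \<ge> real DIM('a::euclidean_space) \<or> r \<le> real DIM('a) * p / (real DIM('a) - p)"
  shows "\<exists>C. \<forall>(u::'a \<Rightarrow> real) g. in_W q p (- real DIM('a)) (p - real DIM('a)) u g \<longrightarrow>
            in_wL (- real DIM('a)) r u \<and>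
            wnorm (- real DIM('a)) r u \<le> C * (wnorm (- real DIM('a)) q u + wnorm (p - real DIM('a)) p g)"
proof -
  obtain C where C: "0 < C" and emb: "\<And>(u::'a \<Rightarrow> real) g A. wgrad u g \<Longrightarrow> 0 < A \<Longrightarrow>
      (\<integral>\<^sup>+x. ennreal (\<bar>u x\<bar> powr q) \<partial>mu) \<le> ennreal (A powr q) \<Longrightarrow>
      (\<integral>\<^sup>+x. ennreal ((norm x * norm (g x)) powr p) \<partial>mu) \<le> ennreal (A powr p) \<Longrightarrow>
      (\<integral>\<^sup>+x. ennreal (\<bar>u x\<bar> powr r) \<partial>mu) \<le> ennreal ((C * A) powr r)"
    using embedding_borel[OF assms] by blast
  have "in_wL (- real DIM('a)) r u \<and>
      wnorm (- real DIM('a)) r u \<le> C * (wnorm (- real DIM('a)) q u + wnorm (p - real DIM('a)) p g)"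
    if W: "in_W q p (- real DIM('a)) (p - real DIM('a)) u g" for u :: "'a \<Rightarrow> real" and g
  proof -
    define a where "a = wnorm (- real DIM('a)) q u"
    define b where "b = wnorm (p - real DIM('a)) p g"
    have ab: "0 \<le> a" "0 \<le> b" by (auto simp: a_def b_def wnorm_def)
    have fin: "wint (- real DIM('a)) q u < \<infinity>" "wint (p - real DIM('a)) p g < \<infinity>"
      and meas: "u \<in> borel_measurable lebesgue" "g \<in> borel_measurable lebesgue" and wk: "weak_grad_punct u g"
      using W by (auto simp: in_W_def in_wL_def)
    obtain u0 g0 where W0: "wgrad u0 g0" and ae: "AE x in lborel. u x = u0 x" "AE x in lborel. g x = g0 x"
      using wgrad_representative[OF wk meas] by blast
    have [measurable]: "u0 \<in> borel_measurable borel" "g0 \<in> borel_measurable borel" using W0 by (auto simp: wgrad_def)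
    have uq: "(\<integral>\<^sup>+x. ennreal (\<bar>u0 x\<bar> powr q) \<partial>mu) = ennreal (a powr q)"
      using wint_eq_wnorm_powr[OF fin(1)] wint_mu_real[OF ae(1), of q] pqr by (simp add: a_def)
    have gp: "(\<integral>\<^sup>+x. ennreal ((norm x * norm (g0 x)) powr p) \<partial>mu) = ennreal (b powr p)"
      using wint_eq_wnorm_powr[OF fin(2)] wint_mu_grad[OF ae(2), of p] pqr by (simp add: b_def)
    \<comment> \<open>The common bound A must be positive, while both norms may vanish; e is sent to
      0 at the end.\<close>
    have bound: "wint (- real DIM('a)) r u \<le> ennreal ((C * (a + b + e)) powr r)" if "0 < e" for e
      unfolding wint_mu_real[OF ae(1) \<open>u0 \<in> borel_measurable borel\<close>]
    proof (rule emb[OF W0, of "a + b + e"])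
      show "0 < a + b + e" using ab that by linarith
      show "(\<integral>\<^sup>+x. ennreal (\<bar>u0 x\<bar> powr q) \<partial>mu) \<le> ennreal ((a + b + e) powr q)"
        unfolding uq using ab that pqr by (intro ennreal_leI powr_mono2) auto
      show "(\<integral>\<^sup>+x. ennreal ((norm x * norm (g0 x)) powr p) \<partial>mu) \<le> ennreal ((a + b + e) powr p)"
        unfolding gp using ab that pqr by (intro ennreal_leI powr_mono2) auto
    qed
    have "wint (- real DIM('a)) r u < \<infinity>" using bound[of 1] le_less_trans by fastforce
    moreover have "wnorm (- real DIM('a)) r u \<le> C * (a + b)"
    proof (rule field_le_epsilon)
      fix e :: real assume "0 < e"
      have "enn2real (wint (- real DIM('a)) r u) \<le> (C * (a + b + e / C)) powr r"
        using bound[of "e / C"] \<open>0 < e\<close> C by (intro enn2real_leI) auto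
      then have "wnorm (- real DIM('a)) r u \<le> ((C * (a + b + e / C)) powr r) powr (1 / r)"
        unfolding wnorm_def using pqr by (intro powr_mono2) auto
      also have "\<dots> = C * (a + b) + e"
        using pqr C ab \<open>0 < e\<close> by (simp add: powr_powr distrib_left)
      finally show "wnorm (- real DIM('a)) r u \<le> C * (a + b) + e" .
    qed
    ultimately show ?thesis using meas by (simp add: in_wL_def a_def b_def)
  qed
  then show ?thesis by blast
qed

section \<open>Test functions for the failing inequality\<close>

text \<open>The integral of a translate does not depend on the translation, so its derivative
  vanishes. Written as the convolution of a large ball with the reflected function, it can be
  differentiated by \<open>has_real_derivative_conv\<close>.\<close>

lemma integral_partial_derivative_zero:
  fixes F :: "'a::euclidean_space \<Rightarrow> real"
  assumes F: "\<And>x. (F has_derivative F' x) (at x)" "\<And>v. continuous_on UNIV (\<lambda>x. F' x v)"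
    and supp: "\<And>x. R < norm x \<Longrightarrow> F x = 0" and b: "norm b = 1"
  shows "(\<integral>x. F' x b \<partial>lborel) = 0"
proof -
  have F'0: "F' x v = 0" if "R < norm x" for x v
    using has_derivative_zero_outside[OF F(1) supp that] by simp
  define h where "h z = F (- z)" for z
  define h' where "h' z v = F' (- z) (- v)" for z v
  have h': "(h has_derivative h' z) (at z)" for z
    unfolding h_def[abs_def] h'_def[abs_def]
    by (rule has_derivative_compose[of "\<lambda>z. - z" "\<lambda>v. - v" z UNIV F "F' (- z)"]) (auto intro!: derivative_eq_intros F)
  have conth: "continuous_on UNIV h"
    by (intro continuous_at_imp_continuous_on ballI has_derivative_continuous[OF h'])
  have conth': "continuous_on UNIV (\<lambda>z. h' z b)"
    unfolding h'_def by (rule continuous_on_compose2[OF F(2)]) (auto intro!: continuous_intros)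
  obtain M where M: "\<And>x. \<bar>h x\<bar> \<le> M"
    using bounded_of_compact_support[OF conth, of R] supp by (auto simp: h_def)
  obtain M' where M': "\<And>x. \<bar>h' x b\<bar> \<le> M'"
    using bounded_of_compact_support[OF conth', of R] F'0 by (auto simp: h'_def)
  \<comment> \<open>Translations by less than 1 move the support within the ball of radius R + 1,
    where this indicator is constantly 1.\<close>
  define f :: "'a \<Rightarrow> real" where "f = indicator (ball 0 (R + 2))"
  have f: "integrable lborel f"
    unfolding f_def using emeasure_lborel_ball_finite[of "0::'a" "R + 2"] by (simp add: integrable_indicator_iff)
  have [measurable]: "F \<in> borel_measurable borel"
    by (intro borel_measurable_continuous_onI continuous_at_imp_continuous_on ballI has_derivative_continuous[OF F(1)])
  have const: "conv f h (0 + t *\<^sub>R b) = (\<integral>y. F y \<partial>lborel)" if "\<bar>t\<bar> < 1" for t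
  proof -
    have "f y * h (0 + t *\<^sub>R b - y) = F (- (t *\<^sub>R b) + y)" for y
    proof (cases "y \<in> ball 0 (R + 2)")
      case True
      then show ?thesis by (simp add: f_def h_def)
    next
      case False
      have "norm y \<le> norm (- (t *\<^sub>R b) + y) + norm (t *\<^sub>R b)"
        using norm_triangle_ineq[of "- (t *\<^sub>R b) + y" "t *\<^sub>R b"] by simp
      then have "R < norm (- (t *\<^sub>R b) + y)" using False that b by simp
      then show ?thesis using supp False by (simp add: f_def)
    qed
    then have "conv f h (0 + t *\<^sub>R b) = (\<integral>y. F (- (t *\<^sub>R b) + y) \<partial>lborel)" by (simp add: conv_def)
    also have "\<dots> = (\<integral>y. F y \<partial>distr lborel borel ((+) (- (t *\<^sub>R b))))" by (subst integral_distr) auto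
    finally show ?thesis by (simp only: lborel_distr_plus)
  qed
  have "((\<lambda>t. conv f h (0 + t *\<^sub>R b)) has_real_derivative conv f (\<lambda>x. h' x b) (0 + 0 *\<^sub>R b)) (at 0)"
    by (rule has_real_derivative_conv[OF f conth M h' conth' M'])
  then have "((\<lambda>t. \<integral>y. F y \<partial>lborel) has_real_derivative conv f (\<lambda>x. h' x b) (0 + 0 *\<^sub>R b)) (at 0)"
    by (rule has_field_derivative_transform_within_open[where S="{-1<..<1}"]) (use const in auto)
  then have "conv f (\<lambda>x. h' x b) (0 + 0 *\<^sub>R b) = 0" by (rule DERIV_unique[OF _ DERIV_const])
  then have "conv f (\<lambda>x. h' x b) 0 = 0" by simp
  moreover have "f y * h' (0 - y) b = - F' y b" for y
  proof (cases "y \<in> ball 0 (R + 2)")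
    case True
    then show ?thesis using linear_neg[OF has_derivative_linear[OF F(1)]] by (simp add: f_def h'_def)
  next
    case False
    then show ?thesis using F'0[of y b] by (simp add: f_def)
  qed
  ultimately show ?thesis by (simp add: conv_def)
qed

lemma integrable_of_compact_support:
  fixes f :: "'a::euclidean_space \<Rightarrow> real"
  assumes "continuous_on UNIV f" "\<And>x. R < norm x \<Longrightarrow> f x = 0"
  shows "integrable lborel f"
proof -
  have "integrable lborel (\<lambda>x. indicator (cball 0 R) x *\<^sub>R f x)"
    using assms(1) continuous_on_subset by (intro borel_integrable_compact) auto
  moreover have "indicator (cball 0 R) x *\<^sub>R f x = f x" for x using assms(2)[of x] by (auto simp: indicator_def)
  ultimately show ?thesis by (simp only:)
qed

lemma loc_int_punct_continuous:
  fixes f :: "'a::euclidean_space \<Rightarrow> real"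
  assumes "continuous_on UNIV f"
  shows "loc_int_punct f"
  unfolding loc_int_punct_def set_integrable_def
proof (intro allI impI)
  fix K :: "'a set" assume "compact K \<and> K \<subseteq> - {0}"
  then have "integrable lborel (\<lambda>x. indicator K x *\<^sub>R f x)"
    using assms continuous_on_subset by (intro borel_integrable_compact) auto
  then show "integrable lebesgue (\<lambda>x. indicator K x *\<^sub>R f x)"
    by (subst integrable_completion) auto
qed

text \<open>Integration by parts: the partial derivatives of u \<phi> integrate to zero. Both halves
  of the product rule have compact support, so they can be integrated separately.\<close>

lemma weak_grad_punct_C1:
  fixes u :: "'a::euclidean_space \<Rightarrow> real"
  assumes u: "\<And>x. (u has_derivative (\<lambda>v. G x \<bullet> v)) (at x)" and G: "continuous_on UNIV G"
    and supp: "\<And>x. R < norm x \<Longrightarrow> u x = 0"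
  shows "weak_grad_punct u G"
proof -
  have contu: "continuous_on UNIV u"
    by (intro continuous_at_imp_continuous_on ballI has_derivative_continuous[OF u])
  have contG: "continuous_on UNIV (\<lambda>x. G x \<bullet> i)" for i by (intro continuous_intros G)
  have G0: "G x \<bullet> v = 0" if "R < norm x" for x v
    using fun_cong[OF has_derivative_zero_outside[OF u supp that], of v] .
  have "(\<integral>x. u x * frechet_derivative \<phi> (at x) i \<partial>lebesgue) = - (\<integral>x. (G x \<bullet> i) * \<phi> x \<partial>lebesgue)"
    if \<phi>: "test_fun_punct \<phi>" and i: "i \<in> Basis" for \<phi> i
  proof -
    have C: "Cinf_on UNIV \<phi>" using \<phi> by (simp add: test_fun_punct_def)
    obtain \<phi>' where \<phi>': "\<And>x. (\<phi> has_derivative \<phi>' x) (at x)" "\<And>v. continuous_on UNIV (\<lambda>x. \<phi>' x v)"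
      using Cinf_on_has_continuous_derivative[OF C] by blast
    have fd: "frechet_derivative \<phi> (at x) = \<phi>' x" for x
      using frechet_derivative_at[OF \<phi>'(1)] by simp
    have cont\<phi>: "continuous_on UNIV \<phi>" by (intro continuous_at_imp_continuous_on ballI has_derivative_continuous[OF \<phi>'(1)])
    have c1: "continuous_on UNIV (\<lambda>x. u x * \<phi>' x v)" and c2: "continuous_on UNIV (\<lambda>x. (G x \<bullet> v) * \<phi> x)" for v
      by (intro continuous_intros contu contG cont\<phi> \<phi>'(2))+
    have "(\<integral>x. u x * \<phi>' x i + (G x \<bullet> i) * \<phi> x \<partial>lborel) = 0"
    proof (rule integral_partial_derivative_zero[where F="\<lambda>x. u x * \<phi> x"])
      show "((\<lambda>x. u x * \<phi> x) has_derivative (\<lambda>v. u x * \<phi>' x v + (G x \<bullet> v) * \<phi> x)) (at x)" for x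
        by (rule has_derivative_mult[OF u \<phi>'(1)])
      show "continuous_on UNIV (\<lambda>x. u x * \<phi>' x v + (G x \<bullet> v) * \<phi> x)" for v
        by (intro continuous_on_add c1 c2)
      show "R < norm x \<Longrightarrow> u x * \<phi> x = 0" for x using supp by simp
    qed (use i in simp)
    moreover have "integrable lborel (\<lambda>x. u x * \<phi>' x i)" "integrable lborel (\<lambda>x. (G x \<bullet> i) * \<phi> x)"
      using supp G0 by (intro integrable_of_compact_support[OF c1, of R] integrable_of_compact_support[OF c2, of R]; simp)+
    ultimately have "(\<integral>x. u x * \<phi>' x i \<partial>lborel) = - (\<integral>x. (G x \<bullet> i) * \<phi> x \<partial>lborel)" by simp
    moreover have "(\<integral>x. u x * \<phi>' x i \<partial>lebesgue) = (\<integral>x. u x * \<phi>' x i \<partial>lborel)"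
      "(\<integral>x. (G x \<bullet> i) * \<phi> x \<partial>lebesgue) = (\<integral>x. (G x \<bullet> i) * \<phi> x \<partial>lborel)"
      using c1 c2 by (intro integral_completion, simp add: borel_measurable_continuous_onI)+
    ultimately show ?thesis unfolding fd by simp
  qed
  then show ?thesis unfolding weak_grad_punct_def using loc_int_punct_continuous contu contG by blast
qed

lemma pw_le:
  assumes "0 \<le> t" "t \<le> T" "0 < T" "0 \<le> e"
  shows "pw t e \<le> T powr e"
  using assms by (auto simp: pw_def powr_mono2)

lemma pw_nonneg: "0 \<le> pw t e"
  by (simp add: pw_def)

text \<open>Turns a supposed interpolation inequality into one between explicit bounds, so that a
  family of test functions has to deliver only upper bounds A and B and a lower bound c.\<close>

lemma interpolation_C1_test:
  fixes u :: "'a::euclidean_space \<Rightarrow> real" and C \<theta> p q r :: real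
  assumes hyp: "\<And>(u::'a \<Rightarrow> real) g. in_W q p (- real DIM('a)) (p - real DIM('a)) u g \<Longrightarrow>
      wnorm (- real DIM('a)) r u \<le> C * pw (wnorm (p - real DIM('a)) p g) \<theta> * pw (wnorm (- real DIM('a)) q u) (1 - \<theta>)"
    and par: "0 < C" "0 \<le> \<theta>" "\<theta> \<le> 1" "1 \<le> p" "1 \<le> q" "q < r"
    and u: "\<And>x. (u has_derivative (\<lambda>v. G x \<bullet> v)) (at x)" "continuous_on UNIV G" "\<And>x. R < norm x \<Longrightarrow> u x = 0"
    and u01: "\<And>x. 0 \<le> u x" "\<And>x. u x \<le> 1"
    and A: "(\<integral>\<^sup>+x. ennreal (u x powr q) \<partial>mu) \<le> ennreal A" "0 < A"
    and B: "(\<integral>\<^sup>+x. ennreal ((norm x * norm (G x)) powr p) \<partial>mu) \<le> ennreal B" "0 < B"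
    and c: "ennreal c \<le> (\<integral>\<^sup>+x. ennreal (u x powr r) \<partial>mu)" "0 < c"
  shows "c powr (1 / r) \<le> C * B powr (\<theta> / p) * A powr ((1 - \<theta>) / q)"
proof -
  have "continuous_on UNIV u"
    by (intro continuous_at_imp_continuous_on ballI has_derivative_continuous[OF u(1)])
  then have [measurable]: "u \<in> borel_measurable borel" "G \<in> borel_measurable borel"
    using u(2) by (auto intro: borel_measurable_continuous_onI)
  have wu: "wint (- real DIM('a)) s u = (\<integral>\<^sup>+x. ennreal (u x powr s) \<partial>mu)" for s
    using wint_mu_real[of u u s] u01 by simp
  have wG: "wint (p - real DIM('a)) p G = (\<integral>\<^sup>+x. ennreal ((norm x * norm (G x)) powr p) \<partial>mu)"
    using wint_mu_grad[of G G p] by simp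
  have W: "in_W q p (- real DIM('a)) (p - real DIM('a)) u G"
    unfolding in_W_def in_wL_def wu wG
    using weak_grad_punct_C1[OF u] A B by (auto intro!: measurable_completion intro: le_less_trans)
  have "(\<integral>\<^sup>+x. ennreal (u x powr r) \<partial>mu) \<le> (\<integral>\<^sup>+x. ennreal (u x powr q) \<partial>mu)"
    using u01 par by (intro nn_integral_mono ennreal_leI powr_mono') auto
  \<comment> \<open>Finiteness matters because \<open>enn2real\<close> sends infinity to 0, which
    would destroy the lower bound. It follows from 0 \<le> u \<le> 1 and q < r.\<close>
  then have fin: "(\<integral>\<^sup>+x. ennreal (u x powr r) \<partial>mu) < \<infinity>"
    using le_less_trans[OF order_trans[OF _ A(1)] ennreal_less_top] by simp
  then have "c \<le> enn2real (wint (- real DIM('a)) r u)"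
    using c enn2real_mono[OF c(1)] unfolding wu by simp
  then have "c powr (1 / r) \<le> wnorm (- real DIM('a)) r u"
    unfolding wnorm_def using c par by (intro powr_mono2) auto
  also have "\<dots> \<le> C * pw (wnorm (p - real DIM('a)) p G) \<theta> * pw (wnorm (- real DIM('a)) q u) (1 - \<theta>)"
    by (rule hyp[OF W])
  also have "\<dots> \<le> C * (B powr (1 / p)) powr \<theta> * (A powr (1 / q)) powr (1 - \<theta>)"
  proof -
    have "enn2real (wint (p - real DIM('a)) p G) \<le> B" "enn2real (wint (- real DIM('a)) q u) \<le> A"
      using A B unfolding wu wG by (auto intro!: enn2real_leI)
    then have "wnorm (p - real DIM('a)) p G \<le> B powr (1 / p)" "wnorm (- real DIM('a)) q u \<le> A powr (1 / q)"
      unfolding wnorm_def using par by (auto intro!: powr_mono2)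
    \<comment> \<open>\<open>pw\<close> is 1 at exponent 0 even for a vanishing norm. As the upper
      bounds A and B are positive, ordinary powers of them dominate in that case too.\<close>
    then have "pw (wnorm (p - real DIM('a)) p G) \<theta> \<le> (B powr (1 / p)) powr \<theta>"
      "pw (wnorm (- real DIM('a)) q u) (1 - \<theta>) \<le> (A powr (1 / q)) powr (1 - \<theta>)"
      using par A B by (auto intro!: pw_le simp: wnorm_def)
    then show ?thesis using par pw_nonneg by (intro mult_mono) auto
  qed
  finally show ?thesis by (simp add: powr_powr)
qed

section \<open>Growth exponents and volumes in logarithmic measure\<close>

lemma powr_comparison:
  fixes \<alpha> \<beta> K :: real
  assumes "\<And>m::nat. 2 \<le> m \<Longrightarrow> real m powr \<alpha> \<le> K * real m powr \<beta>"
  shows "\<alpha> \<le> \<beta>"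
proof (rule ccontr)
  assume "\<not> \<alpha> \<le> \<beta>"
  then have d: "0 < \<alpha> - \<beta>" by simp
  obtain m0 :: nat where "(\<bar>K\<bar> + 1) powr (1 / (\<alpha> - \<beta>)) < m0" using reals_Archimedean2 by blast
  then have m: "(\<bar>K\<bar> + 1) powr (1 / (\<alpha> - \<beta>)) < real (m0 + 2)" by simp
  have "\<bar>K\<bar> + 1 = ((\<bar>K\<bar> + 1) powr (1 / (\<alpha> - \<beta>))) powr (\<alpha> - \<beta>)" using d by (simp add: powr_powr)
  also have "\<dots> \<le> real (m0 + 2) powr (\<alpha> - \<beta>)" using m d by (intro powr_mono2) auto
  also have "\<dots> = real (m0 + 2) powr \<alpha> / real (m0 + 2) powr \<beta>" by (rule powr_diff)
  also have "\<dots> \<le> K" using assms[of "m0 + 2"] by (simp add: pos_divide_le_eq)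
  finally show False by simp
qed

text \<open>Dilations are the translations along the axis of the cylinder: the Jacobian a^N cancels
  the scaling of the weight.\<close>

lemma nn_integral_mu_scale:
  fixes f :: "'a::euclidean_space \<Rightarrow> ennreal"
  assumes [measurable]: "f \<in> borel_measurable borel" and a: "0 < a"
  shows "(\<integral>\<^sup>+x. f (a *\<^sub>R x) \<partial>mu) = (\<integral>\<^sup>+x. f x \<partial>mu)"
proof -
  have "(\<integral>\<^sup>+x. f x \<partial>mu) = (\<integral>\<^sup>+x. ennreal (norm x powr (- real DIM('a))) * f x \<partial>lborel)"
    by (rule nn_integral_mu) measurable
  also have "\<dots> = (\<integral>\<^sup>+x. ennreal (norm x powr (- real DIM('a))) * f x \<partial>density (distr lborel borel (\<lambda>x. 0 + a *\<^sub>R x)) (\<lambda>_. \<bar>a\<bar> ^ DIM('a)))"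
    using a by (subst lborel_affine[of a 0]) auto
  also have "\<dots> = (\<integral>\<^sup>+x. ennreal (a ^ DIM('a)) * (ennreal (norm (a *\<^sub>R x) powr (- real DIM('a))) * f (a *\<^sub>R x)) \<partial>lborel)"
    using a by (simp add: nn_integral_density nn_integral_distr)
  also have "\<dots> = (\<integral>\<^sup>+x. ennreal (norm x powr (- real DIM('a))) * f (a *\<^sub>R x) \<partial>lborel)"
  proof (intro nn_integral_cong)
    fix x :: 'a
    have "a ^ DIM('a) * norm (a *\<^sub>R x) powr (- real DIM('a)) = norm x powr (- real DIM('a))"
      using a by (simp add: powr_mult powr_minus powr_realpow)
    then have "ennreal (a ^ DIM('a)) * ennreal (norm (a *\<^sub>R x) powr (- real DIM('a))) = ennreal (norm x powr (- real DIM('a)))"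
      using a by (subst ennreal_mult'[symmetric]) auto
    then show "ennreal (a ^ DIM('a)) * (ennreal (norm (a *\<^sub>R x) powr (- real DIM('a))) * f (a *\<^sub>R x)) = ennreal (norm x powr (- real DIM('a))) * f (a *\<^sub>R x)"
      by (simp only: mult.assoc[symmetric])
  qed
  also have "\<dots> = (\<integral>\<^sup>+x. f (a *\<^sub>R x) \<partial>mu)"
    by (rule nn_integral_mu[symmetric]) measurable
  finally show ?thesis by simp
qed

text \<open>The piece k \<le> ln |x| < k + 1 of the cylinder, half open so that different pieces are
  disjoint. All have the same measure by dilation.\<close>

definition shell :: "int \<Rightarrow> 'a::euclidean_space set" where
  "shell k = {x. exp (real_of_int k) \<le> norm x \<and> norm x < exp (real_of_int k + 1)}"

lemma shell_borel [measurable]: "shell k \<in> sets borel"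
  unfolding shell_def by measurable

lemma emeasure_mu_shell: "emeasure mu (shell k :: 'a::euclidean_space set) = emeasure mu (shell 0 :: 'a set)"
proof -
  have "x \<in> shell 0 \<longleftrightarrow> exp (real_of_int k) *\<^sub>R x \<in> shell k" for x :: 'a
    by (simp add: shell_def exp_add)
  then have "emeasure mu (shell 0 :: 'a set) = (\<integral>\<^sup>+x. indicator (shell k :: 'a set) (exp (real_of_int k) *\<^sub>R x) \<partial>mu)"
    by (simp add: nn_integral_indicator[symmetric] indicator_def del: nn_integral_indicator)
  also have "\<dots> = emeasure mu (shell k :: 'a set)"
    by (subst nn_integral_mu_scale) auto
  finally show ?thesis by simp
qed

lemma emeasure_mu_shell_0: "\<exists>c>0. emeasure mu (shell 0 :: 'a::euclidean_space set) = ennreal c"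
proof -
  have eq: "emeasure mu (shell 0 :: 'a set) = (\<integral>\<^sup>+x. ennreal (norm (x::'a) powr (- real DIM('a))) * indicator (shell 0) x \<partial>lborel)"
    unfolding mu_def by (rule emeasure_density) auto
  have "\<dots> \<le> (\<integral>\<^sup>+x. indicator (cball 0 (exp 1)) x \<partial>(lborel :: 'a measure))"
  proof (intro nn_integral_mono)
    fix x :: 'a
    have "norm x powr (- real DIM('a)) \<le> 1 powr (- real DIM('a))" if "x \<in> shell 0"
      using that by (intro powr_mono2') (auto simp: shell_def)
    then show "ennreal (norm x powr (- real DIM('a))) * indicator (shell 0) x \<le> indicator (cball 0 (exp 1)) x"
      by (auto simp: indicator_def ennreal_le_1) (auto simp: shell_def)
  qed
  also have "\<dots> < \<infinity>" using emeasure_lborel_cball_finite[of "0::'a" "exp 1"] by simp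
  finally have fin: "emeasure mu (shell 0 :: 'a set) < \<infinity>" unfolding eq .
  have "emeasure mu (shell 0 :: 'a set) \<noteq> 0"
  proof
    assume "emeasure mu (shell 0 :: 'a set) = 0"
    then have "AE x in lborel. ennreal (norm (x::'a) powr (- real DIM('a))) * indicator (shell 0) x = 0"
      unfolding eq by (subst (asm) nn_integral_0_iff_AE) auto
    then have "AE x in lborel. x \<notin> {x::'a. 1 < norm x \<and> norm x < exp 1}"
    proof eventually_elim
      case (elim x)
      then show ?case by (auto simp: shell_def indicator_def split: if_splits)
    qed
    moreover have op: "open {x::'a. 1 < norm x \<and> norm x < exp 1}"
      by (intro open_Collect_conj open_Collect_less continuous_intros)
    ultimately have "{x::'a. 1 < norm x \<and> norm x < exp 1} \<in> null_sets lborel"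
      by (subst AE_iff_null_sets) auto
    then have "negligible {x::'a. 1 < norm x \<and> norm x < exp 1}"
      unfolding negligible_iff_null_sets by (rule null_sets_completionI)
    then have "{x::'a. 1 < norm x \<and> norm x < exp 1} = {}"
      using open_not_negligible[OF op] by blast
    moreover obtain b :: 'a where "b \<in> Basis" using nonempty_Basis by blast
    \<comment> \<open>A witness that the interior is nonempty: 1 < 2 < e.\<close>
    then have "2 *\<^sub>R b \<in> {x::'a. 1 < norm x \<and> norm x < exp 1}"
      using exp_gt_one exp_ge_add_one_self[of "1::real"] exp_lower_Taylor_quadratic[of "1::real"] by simp
    ultimately show False by blast
  qed
  then show ?thesis using fin
    by (cases "emeasure mu (shell 0 :: 'a set)") (auto simp: less_le)
qed

lemma emeasure_mu_annulus_le:
  assumes c: "emeasure mu (shell 0 :: 'a::euclidean_space set) = ennreal c" "0 < c" and m: "1 \<le> m"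
  shows "emeasure mu (annulus (exp (- real (2 * m))) (exp (real (2 * m))) :: 'a set) \<le> ennreal (5 * m * c)"
proof -
  have sh: "emeasure mu (shell k :: 'a set) = ennreal c" for k
    using emeasure_mu_shell[of k] c(1) by (rule trans)
  let ?I = "{- int (2 * m)..int (2 * m)}"
  have "annulus (exp (- real (2 * m))) (exp (real (2 * m))) \<subseteq> (\<Union>k\<in>?I. shell k :: 'a set)"
  proof
    fix x :: 'a assume x: "x \<in> annulus (exp (- real (2 * m))) (exp (real (2 * m)))"
    then have x0: "x \<noteq> 0" by (auto simp: annulus_def not_le)
    then have ab: "\<bar>ln (norm x)\<bar> \<le> real (2 * m)" using x annulus_iff_ln by blast
    define k where "k = \<lfloor>ln (norm x)\<rfloor>"
    have "k \<in> ?I" using ab by (auto simp: k_def floor_le_iff le_floor_iff abs_le_iff)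
    moreover have "x \<in> shell k"
    proof -
      have "exp (real_of_int k) \<le> exp (ln (norm x))" "exp (ln (norm x)) < exp (real_of_int k + 1)"
        unfolding k_def by (simp_all del: exp_ln_iff)
      then show ?thesis using x0 by (simp add: shell_def)
    qed
    ultimately show "x \<in> (\<Union>k\<in>?I. shell k)" by blast
  qed
  then have "emeasure mu (annulus (exp (- real (2 * m))) (exp (real (2 * m))) :: 'a set) \<le> emeasure mu (\<Union>k\<in>?I. shell k :: 'a set)"
    by (intro emeasure_mono) auto
  also have "\<dots> \<le> (\<Sum>k\<in>?I. emeasure mu (shell k :: 'a set))"
    by (intro emeasure_subadditive_finite) auto
  also have "\<dots> = of_nat (card ?I) * ennreal c" by (simp only: sh sum_constant)
  also have "\<dots> = ennreal (real (card ?I) * c)"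
    using c(2) by (simp only: ennreal_of_nat_eq_real_of_nat ennreal_mult'' less_imp_le)
  \<comment> \<open>The indices run from -2m to 2m inclusive, the last one covering the closed outer
    boundary; m \<ge> 1 absorbs the extra shell.\<close>
  also have "card ?I = 4 * m + 1" by simp
  also have "ennreal (real (4 * m + 1) * c) \<le> ennreal (5 * real m * c)"
    using m c by (intro ennreal_leI mult_right_mono) auto
  finally show ?thesis .
qed

lemma emeasure_mu_annulus_ge:
  assumes c: "emeasure mu (shell 0 :: 'a::euclidean_space set) = ennreal c" "0 < c"
  shows "ennreal (m * c) \<le> emeasure mu (annulus (exp (- real m)) (exp (real m)) :: 'a set)"
proof -
  have sh: "emeasure mu (shell k :: 'a set) = ennreal c" for k
    using emeasure_mu_shell[of k] c(1) by (rule trans)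
  \<comment> \<open>The outer half of the annulus is enough for a lower bound of the right
    order.\<close>
  let ?I = "{0..<int m}"
  have "disjoint_family_on (shell :: int \<Rightarrow> 'a set) ?I"
    unfolding disjoint_family_on_def
  proof (intro ballI impI)
    fix j k :: int assume "j \<noteq> k"
    then have "j + 1 \<le> k \<or> k + 1 \<le> j" by linarith
    then have "exp (real_of_int j + 1) \<le> exp (real_of_int k) \<or> exp (real_of_int k + 1) \<le> exp (real_of_int j)"
      by (simp only: exp_le_cancel_iff) linarith
    moreover have "exp (real_of_int i) \<le> norm x" "norm x < exp (real_of_int i + 1)" if "x \<in> shell i" for x :: 'a and i
      using that by (simp_all add: shell_def)
    ultimately show "(shell j :: 'a set) \<inter> shell k = {}" by (meson disjoint_iff not_less order_trans)
  qed
  then have "(\<Sum>k\<in>?I. emeasure mu (shell k :: 'a set)) = emeasure mu (\<Union>k\<in>?I. shell k :: 'a set)"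
    by (intro sum_emeasure) auto
  also have "\<dots> \<le> emeasure mu (annulus (exp (- real m)) (exp (real m)) :: 'a set)"
  proof (intro emeasure_mono subsetI)
    fix x :: 'a assume "x \<in> (\<Union>k\<in>?I. shell k)"
    then obtain k where k: "0 \<le> k" "k < int m" "x \<in> shell k" by auto
    have e: "exp (- real m) \<le> exp (real_of_int k)" "exp (real_of_int k + 1) \<le> exp (real m)"
      using k unfolding exp_le_cancel_iff by linarith+
    then show "x \<in> annulus (exp (- real m)) (exp (real m))" using e k(3)
      unfolding shell_def annulus_def mem_Collect_eq by linarith
  qed auto
  finally have "(\<Sum>k\<in>?I. ennreal c) \<le> emeasure mu (annulus (exp (- real m)) (exp (real m)) :: 'a set)"
    by (simp only: sh)
  then show ?thesis using c(2) by (simp add: ennreal_of_nat_eq_real_of_nat ennreal_mult)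
qed

lemma chi_half_lower: "\<bar>t\<bar> \<le> 1 / 2 \<Longrightarrow> 9 / 16 \<le> chi t"
proof -
  assume "\<bar>t\<bar> \<le> 1 / 2"
  then have "t\<^sup>2 \<le> (1 / 2)\<^sup>2" by (simp add: abs_le_square_iff[symmetric])
  then have "3 / 4 \<le> 1 - t\<^sup>2" by (simp add: power_divide)
  then have h: "3 / 4 \<le> max 0 (1 - t\<^sup>2)" by linarith
  have "(3 / 4)\<^sup>2 \<le> (max 0 (1 - t\<^sup>2))\<^sup>2" by (rule power_mono[OF h]) simp
  then show ?thesis by (simp add: chi_def power_divide)
qed

text \<open>The test function is chi(ln |x| / (2m)). It is supported on |ln |x|| \<le> 2m, is at
  least 9/16 on |ln |x|| \<le> m, and has |x||\<nabla>u| \<le> 4/(2m). So the integrals of u^q and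
  u^r are of order m and that of the gradient is at most of order m^(1-p); comparing powers of m
  gives the condition.\<close>

lemma wide_family:
  fixes C \<theta> p q r :: real
  assumes hyp: "\<And>(u::'a::euclidean_space \<Rightarrow> real) g. in_W q p (- real DIM('a)) (p - real DIM('a)) u g \<Longrightarrow>
      wnorm (- real DIM('a)) r u \<le> C * pw (wnorm (p - real DIM('a)) p g) \<theta> * pw (wnorm (- real DIM('a)) q u) (1 - \<theta>)"
    and par: "0 < C" "0 \<le> \<theta>" "\<theta> \<le> 1" "1 \<le> p" "1 \<le> q" "q < r"
  shows "1 / r \<le> \<theta> / p - \<theta> + (1 - \<theta>) / q"
proof -
  obtain c where c: "0 < c" "emeasure mu (shell 0 :: 'a set) = ennreal c" using emeasure_mu_shell_0 by blast
  define K where "K = C * (2 powr p * 5 * c) powr (\<theta> / p) * (5 * c) powr ((1 - \<theta>) / q) / ((9 / 16) powr r * c) powr (1 / r)"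
  have "real m powr (1 / r) \<le> K * real m powr (\<theta> / p - \<theta> + (1 - \<theta>) / q)" if m: "2 \<le> m" for m :: nat
  proof -
    define n where "n = real (2 * m)"
    have n: "0 < n" using m by (simp add: n_def)
    define z where "z t = chi (t / n)" for t
    define z' where "z' t = chi' (t / n) / n" for t
    have dz: "(z has_real_derivative z' t) (at t)" for t
    proof -
      have "((\<lambda>t. t / n) has_real_derivative 1 / n) (at t)"
        using n by (intro DERIV_cdivide DERIV_ident)
      from DERIV_chain2[OF has_real_derivative_chi this] show ?thesis unfolding z_def[abs_def] z'_def by simp
    qed
    have cz: "continuous_on UNIV z'"
      unfolding z'_def by (intro continuous_intros continuous_on_compose2[OF continuous_chi']) (use n in auto)
    have out: "z t = 0" "z' t = 0" if "n \<le> \<bar>t\<bar>" for t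
    proof -
      have "1 \<le> \<bar>t / n\<bar>" using that n by simp
      then show "z t = 0" "z' t = 0" using chi_outside by (auto simp: z_def z'_def)
    qed
    note r1 = has_derivative_rad[OF dz cz out] continuous_rad_grad[OF dz cz out] rad_outside[OF dz cz out]
    let ?u = "rad z :: 'a \<Rightarrow> real" let ?G = "rad_grad z' :: 'a \<Rightarrow> 'a"
    let ?A = "annulus (exp (- n)) (exp n) :: 'a set"
    have V: "emeasure mu ?A \<le> ennreal (5 * m * c)"
      using emeasure_mu_annulus_le[OF c(2,1), of m] m by (simp add: n_def)
    have u01: "0 \<le> ?u x" "?u x \<le> 1" for x by (simp_all add: rad_def z_def chi_nonneg chi_le_1)
    have "((9 / 16) powr r * (m * c)) powr (1 / r) \<le> C * ((2 / m) powr p * (5 * m * c)) powr (\<theta> / p) * (5 * m * c) powr ((1 - \<theta>) / q)"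
    proof (rule interpolation_C1_test[OF hyp par])
      show "(?u has_derivative (\<lambda>v. ?G x \<bullet> v)) (at x)" for x by (rule r1)
      show "continuous_on UNIV ?G" by (rule r1)
      show "?u x = 0" if "exp n < norm x" for x using that by (intro r1(3)) (auto simp: annulus_def)
      show "0 \<le> ?u x" "?u x \<le> 1" for x by (rule u01)+
      have "(\<integral>\<^sup>+x. ennreal (?u x powr q) \<partial>mu) \<le> (\<integral>\<^sup>+x. indicator ?A x \<partial>mu)"
      proof (intro nn_integral_mono)
        fix x show "ennreal (?u x powr q) \<le> indicator ?A x"
          using r1(3)[where x=x] u01[of x] par by (cases "x \<in> ?A") (auto simp: ennreal_le_1 intro!: powr_le1)
      qed
      then show "(\<integral>\<^sup>+x. ennreal (?u x powr q) \<partial>mu) \<le> ennreal (5 * m * c)" using V by simp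
      have "(\<integral>\<^sup>+x. ennreal ((norm x * norm (?G x)) powr p) \<partial>mu) \<le> (\<integral>\<^sup>+x. ennreal ((2 / m) powr p) * indicator ?A x \<partial>mu)"
      proof (intro nn_integral_mono)
        fix x :: 'a show "ennreal ((norm x * norm (?G x)) powr p) \<le> ennreal ((2 / m) powr p) * indicator ?A x"
        proof (cases "x \<in> ?A")
          case True
          then have "x \<noteq> 0" by (auto simp: annulus_def not_le)
          then have "norm x * norm (?G x) = \<bar>chi' (ln (norm x) / n)\<bar> / n" using n by (simp add: norm_rad_grad z'_def)
          also have "\<dots> \<le> 4 / n" using n by (intro divide_right_mono abs_chi'_le) auto
          also have "\<dots> = 2 / m" by (simp add: n_def)
          finally have "(norm x * norm (?G x)) powr p \<le> (2 / m) powr p" using par by (intro powr_mono2) auto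
          then show ?thesis using True by (simp add: ennreal_leI)
        next
          case False
          then show ?thesis using r1(4)[where x=x] by simp
        qed
      qed
      also have "\<dots> = ennreal ((2 / m) powr p) * emeasure mu ?A" by (rule nn_integral_cmult_indicator) simp
      also have "\<dots> \<le> ennreal ((2 / m) powr p) * ennreal (5 * m * c)" using V by (intro mult_left_mono) auto
      finally show "(\<integral>\<^sup>+x. ennreal ((norm x * norm (?G x)) powr p) \<partial>mu) \<le> ennreal ((2 / m) powr p * (5 * m * c))"
        by (simp add: ennreal_mult')
      have "ennreal ((9 / 16) powr r * (m * c)) = ennreal ((9 / 16) powr r) * ennreal (m * c)" by (simp add: ennreal_mult')
      also have "\<dots> \<le> ennreal ((9 / 16) powr r) * emeasure mu (annulus (exp (- real m)) (exp (real m)) :: 'a set)"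
        by (intro mult_left_mono emeasure_mu_annulus_ge c) auto
      also have "\<dots> = (\<integral>\<^sup>+x. ennreal ((9 / 16) powr r) * indicator (annulus (exp (- real m)) (exp (real m))) x \<partial>(mu :: 'a measure))"
        by (rule nn_integral_cmult_indicator[symmetric]) simp
      also have "\<dots> \<le> (\<integral>\<^sup>+x. ennreal (?u x powr r) \<partial>mu)"
      proof (intro nn_integral_mono)
        fix x :: 'a
        show "ennreal ((9 / 16) powr r) * indicator (annulus (exp (- real m)) (exp (real m))) x \<le> ennreal (?u x powr r)"
        proof (cases "x \<in> annulus (exp (- real m)) (exp (real m))")
          case True
          then have x0: "x \<noteq> 0" by (auto simp: annulus_def not_le)
          then have "\<bar>ln (norm x)\<bar> \<le> m" using True annulus_iff_ln by blast
          then have "\<bar>ln (norm x) / n\<bar> \<le> 1 / 2" using m by (simp add: n_def)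
          then have "9 / 16 \<le> ?u x" using x0 chi_half_lower by (simp add: rad_def z_def)
          then have "(9 / 16) powr r \<le> ?u x powr r" using par by (intro powr_mono2) auto
          then show ?thesis using True by (simp add: ennreal_leI)
        qed simp
      qed
      finally show "ennreal ((9 / 16) powr r * (m * c)) \<le> (\<integral>\<^sup>+x. ennreal (?u x powr r) \<partial>mu)" .
    qed (use m c in auto)
    moreover have "((9 / 16) powr r * (m * c)) powr (1 / r) = ((9 / 16) powr r * c) powr (1 / r) * m powr (1 / r)"
      by (subst powr_mult[symmetric]) (simp add: mult_ac)
    moreover have "((2 / m) powr p * (5 * m * c)) powr (\<theta> / p) = (2 powr p * 5 * c) powr (\<theta> / p) * m powr (\<theta> / p - \<theta>)"
    proof -
      have "(2 / m) powr p * (5 * m * c) = (2 powr p * 5 * c) * m powr (1 - p)"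
        using m by (simp add: powr_divide powr_diff)
      moreover have "(m powr (1 - p)) powr (\<theta> / p) = m powr (\<theta> / p - \<theta>)"
      proof -
        have "(1 - p) * (\<theta> / p) = \<theta> / p - \<theta>" using par by (simp add: field_simps)
        then show ?thesis by (simp only: powr_powr)
      qed
      ultimately show ?thesis by (simp only: powr_mult)
    qed
    moreover have "(5 * m * c) powr ((1 - \<theta>) / q) = (5 * c) powr ((1 - \<theta>) / q) * m powr ((1 - \<theta>) / q)"
      by (subst powr_mult[symmetric]) (simp add: mult_ac)
    ultimately have "((9 / 16) powr r * c) powr (1 / r) * m powr (1 / r) \<le>
        C * (2 powr p * 5 * c) powr (\<theta> / p) * (5 * c) powr ((1 - \<theta>) / q) * m powr (\<theta> / p - \<theta> + (1 - \<theta>) / q)"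
      by (simp add: powr_add mult_ac)
    then show ?thesis using c by (simp add: K_def pos_le_divide_eq mult.commute)
  qed
  then show ?thesis by (rule powr_comparison)
qed

section \<open>Bumps concentrating at a unit vector\<close>

lemma emeasure_mu_cball_le:
  assumes e: "norm (e :: 'a::euclidean_space) = 1" and \<rho>: "0 \<le> \<rho>" "\<rho> \<le> 1 / 2"
  shows "emeasure mu (cball e \<rho>) \<le> ennreal ((1 / 2) powr (- real DIM('a)) * (unit_ball_vol DIM('a) * \<rho> ^ DIM('a)))"
proof -
  have "emeasure mu (cball e \<rho>) = (\<integral>\<^sup>+x. ennreal (norm (x::'a) powr (- real DIM('a))) * indicator (cball e \<rho>) x \<partial>lborel)"
    unfolding mu_def by (rule emeasure_density) auto
  also have "\<dots> \<le> (\<integral>\<^sup>+x. ennreal ((1 / 2) powr (- real DIM('a))) * indicator (cball e \<rho>) x \<partial>lborel)"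
  proof (intro nn_integral_mono)
    fix x :: 'a
    show "ennreal (norm x powr (- real DIM('a))) * indicator (cball e \<rho>) x \<le> ennreal ((1 / 2) powr (- real DIM('a))) * indicator (cball e \<rho>) x"
    proof (cases "x \<in> cball e \<rho>")
      case True
      then have "1 / 2 \<le> norm x" using norm_triangle_ineq2[of e x] e \<rho> by (simp add: dist_norm)
      then show ?thesis by (intro mult_right_mono ennreal_leI powr_mono2') auto
    qed simp
  qed
  also have "\<dots> = ennreal ((1 / 2) powr (- real DIM('a))) * emeasure lborel (cball e \<rho>)"
    by (rule nn_integral_cmult_indicator) simp
  also have "\<dots> = ennreal ((1 / 2) powr (- real DIM('a)) * (unit_ball_vol DIM('a) * \<rho> ^ DIM('a)))"
    using \<rho> by (simp add: emeasure_cball ennreal_mult')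
  finally show ?thesis .
qed

lemma emeasure_mu_cball_ge:
  assumes e: "norm (e :: 'a::euclidean_space) = 1" and \<rho>: "0 \<le> \<rho>" "\<rho> < 1"
  shows "ennreal (2 powr (- real DIM('a)) * (unit_ball_vol DIM('a) * \<rho> ^ DIM('a))) \<le> emeasure mu (cball e \<rho>)"
proof -
  have "ennreal (2 powr (- real DIM('a)) * (unit_ball_vol DIM('a) * \<rho> ^ DIM('a)))
      = ennreal (2 powr (- real DIM('a))) * emeasure lborel (cball e \<rho>)"
    using \<rho> by (simp add: emeasure_cball ennreal_mult')
  also have "\<dots> = (\<integral>\<^sup>+x. ennreal (2 powr (- real DIM('a))) * indicator (cball e \<rho>) x \<partial>lborel)"
    by (rule nn_integral_cmult_indicator[symmetric]) simp
  also have "\<dots> \<le> (\<integral>\<^sup>+x. ennreal (norm (x::'a) powr (- real DIM('a))) * indicator (cball e \<rho>) x \<partial>lborel)"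
  proof (intro nn_integral_mono)
    fix x :: 'a
    show "ennreal (2 powr (- real DIM('a))) * indicator (cball e \<rho>) x \<le> ennreal (norm x powr (- real DIM('a))) * indicator (cball e \<rho>) x"
    proof (cases "x \<in> cball e \<rho>")
      case True
      then have "norm x \<le> 2" "0 < norm x"
        using norm_triangle_ineq2[of e x] norm_triangle_ineq2[of x e] e \<rho> by (auto simp: dist_norm norm_minus_commute)
      then show ?thesis by (intro mult_right_mono ennreal_leI powr_mono2') auto
    qed simp
  qed
  also have "\<dots> = emeasure mu (cball e \<rho>)"
    unfolding mu_def by (rule emeasure_density[symmetric]) auto
  finally show ?thesis .
qed

text \<open>The test function is chi(k |x - e|). Near the unit vector e the weight is comparable to
  1, so volumes are of order k^(-N), while |x||\<nabla>u| is at most 3/2 times 4k. Comparing powers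
  of k gives the condition.\<close>

lemma concentrating_family:
  fixes C \<theta> p q r :: real
  assumes hyp: "\<And>(u::'a::euclidean_space \<Rightarrow> real) g. in_W q p (- real DIM('a)) (p - real DIM('a)) u g \<Longrightarrow>
      wnorm (- real DIM('a)) r u \<le> C * pw (wnorm (p - real DIM('a)) p g) \<theta> * pw (wnorm (- real DIM('a)) q u) (1 - \<theta>)"
    and par: "0 < C" "0 \<le> \<theta>" "\<theta> \<le> 1" "1 \<le> p" "1 \<le> q" "q < r"
  shows "- real DIM('a) / r \<le> \<theta> - DIM('a) * \<theta> / p - DIM('a) * (1 - \<theta>) / q"
proof -
  define N where "N = real DIM('a)"
  obtain e :: 'a where "e \<in> Basis" using nonempty_Basis by blast
  then have e: "norm e = 1" by simp
  define a where "a = (1 / 2) powr (- N) * unit_ball_vol N"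
  define b where "b = 2 powr (- N) * (unit_ball_vol N * (1 / 2) powr N)"
  have ab: "0 < a" "0 < b" by (simp_all add: a_def b_def N_def)
  define K where "K = C * (6 powr p * a) powr (\<theta> / p) * a powr ((1 - \<theta>) / q) / ((9 / 16) powr r * b) powr (1 / r)"
  have "real k powr (- N / r) \<le> K * real k powr (\<theta> - N * \<theta> / p - N * (1 - \<theta>) / q)" if k: "2 \<le> k" for k :: nat
  proof -
    \<comment> \<open>The inner product in place of the norm keeps W differentiable at e.\<close>
    define W where "W x = 1 - (real k)\<^sup>2 * ((x - e) \<bullet> (x - e))" for x
    define u where "u x = (max 0 (W x))\<^sup>2" for x
    define G where "G x = (- 4 * (real k)\<^sup>2 * max 0 (W x)) *\<^sub>R (x - e)" for x
    have W_eq: "W x = 1 - (k * norm (x - e))\<^sup>2" for x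
      by (simp add: W_def power_mult_distrib power2_norm_eq_inner)
    have W1: "W x \<le> 1" for x by (simp add: W_eq)
    have off: "W x \<le> 0" if "x \<notin> cball e (1 / k)" for x
    proof -
      have "1 \<le> k * norm (x - e)" using that k by (simp add: dist_norm norm_minus_commute field_simps)
      then have "1 \<le> (k * norm (x - e))\<^sup>2" by simp
      then show ?thesis by (simp add: W_eq)
    qed
    have du: "(u has_derivative (\<lambda>v. G x \<bullet> v)) (at x)" for x
    proof -
      have "(W has_derivative (\<lambda>v. - 2 * (real k)\<^sup>2 * ((x - e) \<bullet> v))) (at x)"
        unfolding W_def[abs_def] by (auto intro!: derivative_eq_intros simp: inner_commute algebra_simps)
      from has_derivative_compose[OF this has_real_derivative_max0_power2[unfolded has_field_derivative_def]]
      show ?thesis unfolding u_def[abs_def] G_def by (simp add: mult_ac)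
    qed
    have cG: "continuous_on UNIV G" unfolding G_def W_def by (intro continuous_intros)
    have [measurable]: "u \<in> borel_measurable borel" "G \<in> borel_measurable borel"
      using cG by (auto intro!: borel_measurable_continuous_onI continuous_at_imp_continuous_on has_derivative_continuous[OF du])
    have u01: "0 \<le> u x" "u x \<le> 1" for x
      using W1[of x] by (auto simp: u_def power_le_one)
    have pk0: "real k powr (- N) = 1 / real k ^ DIM('a)" "(1 / 2) powr N = (1 / 2 :: real) ^ DIM('a)"
      using k by (simp_all add: N_def powr_minus_divide powr_realpow)
    have pk: "(1 / real k) ^ DIM('a) = k powr (- N)" "(1 / (2 * real k)) ^ DIM('a) = (1 / 2) powr N * k powr (- N)"
      unfolding pk0 by (simp_all add: power_divide power_mult_distrib)
    have V: "emeasure mu (cball e (1 / k)) \<le> ennreal (a * k powr (- N))"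
      using emeasure_mu_cball_le[OF e, of "1 / k"] k unfolding pk(1) by (simp add: a_def N_def mult.assoc)
    have V': "ennreal (b * k powr (- N)) \<le> emeasure mu (cball e (1 / (2 * real k)))"
    proof -
      have "1 / (2 * real k) < 1" using k by simp
      then have "ennreal (2 powr (- real DIM('a)) * (unit_ball_vol DIM('a) * (1 / (2 * real k)) ^ DIM('a))) \<le> emeasure mu (cball e (1 / (2 * real k)))"
        by (intro emeasure_mu_cball_ge e) simp_all
      then show ?thesis unfolding pk(2) by (simp add: b_def N_def mult.assoc)
    qed
    have "((9 / 16) powr r * (b * k powr (- N))) powr (1 / r) \<le> C * ((6 * k) powr p * (a * k powr (- N))) powr (\<theta> / p) * (a * k powr (- N)) powr ((1 - \<theta>) / q)"
    proof (rule interpolation_C1_test[OF hyp par du cG])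
      show "u x = 0" if "2 < norm x" for x
      proof -
        have "1 / k \<le> 1" using k by simp
        then have "x \<notin> cball e (1 / k)" using that e norm_triangle_ineq2[of x e] by (auto simp: dist_norm norm_minus_commute)
        then show ?thesis using off by (simp add: u_def)
      qed
      show "0 \<le> u x" "u x \<le> 1" for x by (rule u01)+
      have "(\<integral>\<^sup>+x. ennreal (u x powr q) \<partial>mu) \<le> (\<integral>\<^sup>+x. indicator (cball e (1 / k)) x \<partial>mu)"
      proof (intro nn_integral_mono)
        fix x show "ennreal (u x powr q) \<le> indicator (cball e (1 / k)) x"
        proof (cases "x \<in> cball e (1 / k)")
          case True
          then show ?thesis using u01[of x] par by (simp add: ennreal_le_1 powr_le1)
        next
          case False
          then show ?thesis using off[of x] by (simp add: u_def)
        qed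
      qed
      then show "(\<integral>\<^sup>+x. ennreal (u x powr q) \<partial>mu) \<le> ennreal (a * k powr (- N))" using V by simp
      have "(\<integral>\<^sup>+x. ennreal ((norm x * norm (G x)) powr p) \<partial>mu) \<le> (\<integral>\<^sup>+x. ennreal ((6 * k) powr p) * indicator (cball e (1 / k)) x \<partial>mu)"
      proof (intro nn_integral_mono)
        fix x :: 'a
        show "ennreal ((norm x * norm (G x)) powr p) \<le> ennreal ((6 * k) powr p) * indicator (cball e (1 / k)) x"
        proof (cases "x \<in> cball e (1 / k)")
          case True
          then have xe: "norm (x - e) \<le> 1 / k" by (simp add: dist_norm norm_minus_commute)
          moreover have "1 / real k \<le> 1 / 2" using k by simp
          ultimately have "norm x \<le> 3 / 2" using norm_triangle_ineq2[of x e] e by linarith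
          moreover have "norm (G x) \<le> 4 * k"
          proof -
            have "norm (G x) = 4 * (real k)\<^sup>2 * max 0 (W x) * norm (x - e)" by (simp add: G_def)
            also have "\<dots> \<le> 4 * (real k)\<^sup>2 * 1 * (1 / k)"
              using W1[of x] xe by (intro mult_mono) auto
            also have "\<dots> = 4 * k" using k by (simp add: power2_eq_square)
            finally show ?thesis .
          qed
          ultimately have "norm x * norm (G x) \<le> 3 / 2 * (4 * k)" by (intro mult_mono) auto
          then have "(norm x * norm (G x)) powr p \<le> (6 * k) powr p" using par by (intro powr_mono2) auto
          then show ?thesis using True by (simp add: ennreal_leI)
        next
          case False
          then show ?thesis using off[of x] by (simp add: G_def)
        qed
      qed
      also have "\<dots> = ennreal ((6 * k) powr p) * emeasure mu (cball e (1 / k))" by (rule nn_integral_cmult_indicator) simp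
      also have "\<dots> \<le> ennreal ((6 * k) powr p) * ennreal (a * k powr (- N))" using V by (intro mult_left_mono) auto
      finally show "(\<integral>\<^sup>+x. ennreal ((norm x * norm (G x)) powr p) \<partial>mu) \<le> ennreal ((6 * k) powr p * (a * k powr (- N)))"
        by (simp add: ennreal_mult')
      have "ennreal ((9 / 16) powr r * (b * k powr (- N))) = ennreal ((9 / 16) powr r) * ennreal (b * k powr (- N))" by (simp add: ennreal_mult')
      also have "\<dots> \<le> ennreal ((9 / 16) powr r) * emeasure mu (cball e (1 / (2 * real k)))"
        using V' by (intro mult_left_mono) auto
      also have "\<dots> = (\<integral>\<^sup>+x. ennreal ((9 / 16) powr r) * indicator (cball e (1 / (2 * real k))) x \<partial>mu)"
        by (rule nn_integral_cmult_indicator[symmetric]) simp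
      also have "\<dots> \<le> (\<integral>\<^sup>+x. ennreal (u x powr r) \<partial>mu)"
      proof (intro nn_integral_mono)
        fix x :: 'a
        show "ennreal ((9 / 16) powr r) * indicator (cball e (1 / (2 * real k))) x \<le> ennreal (u x powr r)"
        proof (cases "x \<in> cball e (1 / (2 * real k))")
          case True
          then have "k * norm (x - e) \<le> 1 / 2" using k by (simp add: dist_norm norm_minus_commute field_simps)
          then have "9 / 16 \<le> chi (k * norm (x - e))" by (intro chi_half_lower) simp
          also have "chi (k * norm (x - e)) = u x" by (simp only: chi_def u_def W_eq)
          finally have "(9 / 16) powr r \<le> u x powr r" using par by (intro powr_mono2) auto
          then show ?thesis using True by (simp add: ennreal_leI)
        qed simp
      qed
      finally show "ennreal ((9 / 16) powr r * (b * k powr (- N))) \<le> (\<integral>\<^sup>+x. ennreal (u x powr r) \<partial>mu)" .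
    qed (use k ab in auto)
    moreover have "((9 / 16) powr r * (b * k powr (- N))) powr (1 / r) = ((9 / 16) powr r * b) powr (1 / r) * k powr (- N / r)"
      using powr_mult[of "(9 / 16) powr r * b" "k powr (- N)" "1 / r"] by (simp add: powr_powr mult.assoc)
    moreover have "((6 * k) powr p * (a * k powr (- N))) powr (\<theta> / p) = (6 powr p * a) powr (\<theta> / p) * k powr (\<theta> - N * \<theta> / p)"
    proof -
      have "(6 * k) powr p * (a * k powr (- N)) = (6 powr p * a) * k powr (p - N)"
        using k by (simp add: powr_mult powr_diff powr_minus_divide)
      moreover have "(p - N) * (\<theta> / p) = \<theta> - N * \<theta> / p" using par by (simp add: field_simps)
      ultimately show ?thesis by (simp only: powr_mult powr_powr)
    qed
    moreover have "(a * k powr (- N)) powr ((1 - \<theta>) / q) = a powr ((1 - \<theta>) / q) * k powr (- (N * (1 - \<theta>) / q))"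
      by (simp add: powr_mult powr_powr)
    moreover have "real k powr (\<theta> - N * \<theta> / p - N * (1 - \<theta>) / q) = k powr (\<theta> - N * \<theta> / p) * k powr (- (N * (1 - \<theta>) / q))"
      by (simp add: powr_add[symmetric])
    ultimately have "((9 / 16) powr r * b) powr (1 / r) * k powr (- N / r) \<le>
        C * (6 powr p * a) powr (\<theta> / p) * a powr ((1 - \<theta>) / q) * k powr (\<theta> - N * \<theta> / p - N * (1 - \<theta>) / q)"
      by (simp only: mult_ac)
    then show ?thesis using ab by (simp add: K_def pos_le_divide_eq mult.commute)
  qed
  then have "- N / r \<le> \<theta> - N * \<theta> / p - N * (1 - \<theta>) / q" by (rule powr_comparison)
  then show ?thesis by (simp add: N_def)
qed

lemma interpolation_fails:
  fixes C \<theta> p q r :: real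
  assumes "2 \<le> DIM('a::euclidean_space)"
    and par: "0 < C" "0 \<le> \<theta>" "\<theta> \<le> 1" "1 \<le> p" "1 \<le> q" "q < r"
  shows "\<exists>(u::'a \<Rightarrow> real) g. in_W q p (- real DIM('a)) (p - real DIM('a)) u g \<and>
    \<not> wnorm (- real DIM('a)) r u \<le> C * pw (wnorm (p - real DIM('a)) p g) \<theta> * pw (wnorm (- real DIM('a)) q u) (1 - \<theta>)"
proof (rule ccontr)
  assume "\<not> ?thesis"
  then have hyp: "\<And>(u::'a \<Rightarrow> real) g. in_W q p (- real DIM('a)) (p - real DIM('a)) u g \<Longrightarrow>
      wnorm (- real DIM('a)) r u \<le> C * pw (wnorm (p - real DIM('a)) p g) \<theta> * pw (wnorm (- real DIM('a)) q u) (1 - \<theta>)"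
    by blast
  define N where "N = real DIM('a)"
  have N: "2 \<le> N" using assms(1) by (simp add: N_def)
  define s where "s = \<theta> / p + (1 - \<theta>) / q - 1 / r"
  have 1: "\<theta> \<le> s" using wide_family[OF hyp par] by (simp add: s_def)
  have "- N / r \<le> \<theta> - N * \<theta> / p - N * (1 - \<theta>) / q"
    using concentrating_family[OF hyp par] by (simp add: N_def)
  moreover have "N * s = N * \<theta> / p + N * (1 - \<theta>) / q - N / r" by (simp add: s_def distrib_left right_diff_distrib)
  ultimately have 2: "N * s \<le> \<theta>" by simp
  \<comment> \<open>The two necessary conditions meet in N\<theta> \<le> Ns \<le> \<theta>; with N
    \<ge> 2 and \<theta> \<ge> 0 no room is left.\<close>
  have "N * \<theta> \<le> N * s" using 1 N by (intro mult_left_mono) auto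
  moreover have "2 * \<theta> \<le> N * \<theta>" using N par by (intro mult_right_mono) auto
  ultimately have "\<theta> = 0" using 2 par by linarith
  moreover have "N * s \<le> 0" using 2 \<open>\<theta> = 0\<close> by simp
  ultimately have "1 / q \<le> 1 / r" using N by (simp add: s_def mult_le_0_iff)
  then show False using par by (simp add: field_simps)
qed

theorem theorem10p3:
  fixes p q r :: real
  defines "N \<equiv> real DIM('a::euclidean_space)"
  assumes "1 \<le> p" and "1 \<le> q" and "1 \<le> r" and "q < r"
    and "p \<ge> N \<or> r \<le> N * p / (N - p)"
  shows "(\<exists>C. \<forall>(u::'a \<Rightarrow> real) g. in_W q p (-N) (p - N) u g \<longrightarrow>
            in_wL (-N) r u \<and> wnorm (-N) r u \<le> C * (wnorm (-N) q u + wnorm (p - N) p g))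
       \<and> (DIM('a) \<ge> 2 \<longrightarrow>
           (\<forall>C>0. \<forall>\<theta>\<in>{0..1}. \<exists>(u::'a \<Rightarrow> real) g. in_W q p (-N) (p - N) u g \<and>
              \<not> (wnorm (-N) r u \<le> C * pw (wnorm (p - N) p g) \<theta> * pw (wnorm (-N) q u) (1 - \<theta>))))"
proof (intro conjI impI allI ballI)
  show "\<exists>C. \<forall>(u::'a \<Rightarrow> real) g. in_W q p (-N) (p - N) u g \<longrightarrow>
            in_wL (-N) r u \<and> wnorm (-N) r u \<le> C * (wnorm (-N) q u + wnorm (p - N) p g)"
    using weighted_embedding[where 'a='a, of p q r] assms unfolding N_def by blast
next
  fix C \<theta> :: real
  assume "2 \<le> DIM('a)" "0 < C" "\<theta> \<in> {0..1}"
  then show "\<exists>(u::'a \<Rightarrow> real) g. in_W q p (-N) (p - N) u g \<and>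
              \<not> (wnorm (-N) r u \<le> C * pw (wnorm (p - N) p g) \<theta> * pw (wnorm (-N) q u) (1 - \<theta>))"
    unfolding N_def using assms by (intro interpolation_fails) auto
qed

end
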